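(* There is a polynomial-time algorithm that, given a formula of existential Presburger arithmetic ($\exists\mathrm{PA}$), constructs an equivalent formula of bounded existential Presburger arithmetic ($\exists^{\le}\mathrm{PA}$) with the same free variables.
   Context: Presburger arithmetic (PA) is the first-order theory of $\langle \mathbb{Z};+,<,(\equiv_m)_{m\in\mathbb{Z}},0,1\rangle$. Atomic formulas are linear inequalities $a_1x_1+\cdots+a_nx_n\le b$ and modulo constraints $a_1x_1+\cdots+a_nx_n\equiv b \pmod{m}$, with integer constants $a_i,b,m$ written in binary. A formula is quantifier-free if it is a Boolean combination of atoms. An $\exists\mathrm{PA}$ formula has the form $\exists x_1\cdots\exists x_k\colon \varphi$ with $\varphi$ quantifier-free. The size $|\varphi|$ of a formula is the number of symbols used to write it, constants in binary. An $\exists^{\le}\mathrm{PA}$ formula over free variables $y_1,\dots,y_m$ has the form $\exists^{\le k_1}x_1\cdots\exists^{\le k_n}x_n\colon\varphi$, where each $k_i\in\mathbb{N}$ is given in binary, $\exists^{\le k_i}x_i$ means "there exists $x_i\in\mathbb{Z}$ with $|x_i|\le k_i$", and $\varphi$ is a Boolean combination of atoms of the forms $\sum_{i=1}^m p_iy_i\le q$ or $\sum_{i=1}^m p_iy_i\equiv r\pmod{q}$ with $p_1,\dots,p_m,q,r\in\mathbb{Z}[x_1,\dots,x_n]$ polynomials (written explicitly, coefficients in binary). Two formulas are equivalent if they define the same set of assignments to the free variables over $\mathbb{Z}$. *)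

theory Defs
  imports Main
begin

datatype 'a bform = BTrue | BFalse | BAtom 'a | BNot "'a bform"
  | BAnd "'a bform" "'a bform" | BOr "'a bform" "'a bform"

fun beval :: "('a \<Rightarrow> bool) \<Rightarrow> 'a bform \<Rightarrow> bool" where
  "beval I BTrue = True"
| "beval I BFalse = False"
| "beval I (BAtom a) = I a"
| "beval I (BNot f) = (\<not> beval I f)"
| "beval I (BAnd f g) = (beval I f \<and> beval I g)"
| "beval I (BOr f g) = (beval I f \<or> beval I g)"

fun batoms :: "'a bform \<Rightarrow> 'a list" where
  "batoms BTrue = []"
| "batoms BFalse = []"
| "batoms (BAtom a) = [a]"
| "batoms (BNot f) = batoms f"
| "batoms (BAnd f g) = batoms f @ batoms g"
| "batoms (BOr f g) = batoms f @ batoms g"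

type_synonym var = nat
type_synonym lin = "(int \<times> var) list"

datatype pa_atom = LinLe lin int
                 | LinCong lin int int

fun lin_eval :: "(var \<Rightarrow> int) \<Rightarrow> lin \<Rightarrow> int" where
  "lin_eval \<nu> t = sum_list (map (\<lambda>(a, x). a * \<nu> x) t)"

fun pa_atom_sat :: "(var \<Rightarrow> int) \<Rightarrow> pa_atom \<Rightarrow> bool" where
  "pa_atom_sat \<nu> (LinLe t b) = (lin_eval \<nu> t \<le> b)"
| "pa_atom_sat \<nu> (LinCong t b m) = (lin_eval \<nu> t mod m = b mod m)"

fun pa_atom_vars :: "pa_atom \<Rightarrow> var set" where
  "pa_atom_vars (LinLe t b) = set (map snd t)"
| "pa_atom_vars (LinCong t b m) = set (map snd t)"

datatype epa = EPA "var list" "pa_atom bform"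

fun exists_prefix :: "var list \<Rightarrow> ((var \<Rightarrow> int) \<Rightarrow> bool) \<Rightarrow> (var \<Rightarrow> int) \<Rightarrow> bool" where
  "exists_prefix [] P \<nu> = P \<nu>"
| "exists_prefix (x # xs) P \<nu> = (\<exists>v::int. exists_prefix xs P (\<nu>(x := v)))"

fun epa_sat :: "(var \<Rightarrow> int) \<Rightarrow> epa \<Rightarrow> bool" where
  "epa_sat \<nu> (EPA xs \<phi>) = exists_prefix xs (\<lambda>\<mu>. beval (pa_atom_sat \<mu>) \<phi>) \<nu>"

fun epa_fv :: "epa \<Rightarrow> var set" where
  "epa_fv (EPA xs \<phi>) = (\<Union>a \<in> set (batoms \<phi>). pa_atom_vars a) - set xs"

text \<open>A polynomial in the bounded variables x_1..x_n is an explicit list of monomials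
  (c, [e_1,...,e_l]) standing for c * x_1^e_1 * ... * x_l^e_l (l \<le> n).\<close>
type_synonym mpoly = "(int \<times> nat list) list"

definition mpoly_eval :: "int list \<Rightarrow> mpoly \<Rightarrow> int" where
  "mpoly_eval xs p = sum_list (map (\<lambda>(c, es). c * prod_list (map (\<lambda>(x, e). x ^ e) (zip xs es))) p)"

datatype bpa_atom = PolyLe "mpoly list" mpoly
                  | PolyCong "mpoly list" mpoly mpoly

datatype bpa = BPA "nat list" "var list" "bpa_atom bform"

definition lincomb :: "(var \<Rightarrow> int) \<Rightarrow> int list \<Rightarrow> var list \<Rightarrow> mpoly list \<Rightarrow> int" where
  "lincomb \<nu> xs ys ps = sum_list (map (\<lambda>(p, y). mpoly_eval xs p * \<nu> y) (zip ps ys))"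

fun bpa_atom_sat :: "(var \<Rightarrow> int) \<Rightarrow> var list \<Rightarrow> int list \<Rightarrow> bpa_atom \<Rightarrow> bool" where
  "bpa_atom_sat \<nu> ys xs (PolyLe ps q) = (lincomb \<nu> xs ys ps \<le> mpoly_eval xs q)"
| "bpa_atom_sat \<nu> ys xs (PolyCong ps r q) =
     (lincomb \<nu> xs ys ps mod mpoly_eval xs q = mpoly_eval xs r mod mpoly_eval xs q)"

fun bpa_sat :: "(var \<Rightarrow> int) \<Rightarrow> bpa \<Rightarrow> bool" where
  "bpa_sat \<nu> (BPA ks ys \<phi>) =
     (\<exists>xs::int list. length xs = length ks \<and> (\<forall>i < length ks. \<bar>xs ! i\<bar> \<le> int (ks ! i))
        \<and> beval (bpa_atom_sat \<nu> ys xs) \<phi>)"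

fun bpa_fv :: "bpa \<Rightarrow> var set" where
  "bpa_fv (BPA ks ys \<phi>) = set ys"

fun bpa_atom_polys :: "bpa_atom \<Rightarrow> mpoly list" where
  "bpa_atom_polys (PolyLe ps q) = q # ps"
| "bpa_atom_polys (PolyCong ps r q) = r # q # ps"

fun bpa_atom_arity :: "bpa_atom \<Rightarrow> nat" where
  "bpa_atom_arity (PolyLe ps q) = length ps"
| "bpa_atom_arity (PolyCong ps r q) = length ps"

fun bpa_wf :: "bpa \<Rightarrow> bool" where
  "bpa_wf (BPA ks ys \<phi>) =
     (distinct ys \<and> (\<forall>a \<in> set (batoms \<phi>). bpa_atom_arity a = length ys \<and>
        (\<forall>p \<in> set (bpa_atom_polys a). \<forall>(c, es) \<in> set p. length es \<le> length ks)))"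

fun enc_nat :: "nat \<Rightarrow> bool list" where
  "enc_nat n = (if n = 0 then [False] else True # odd n # enc_nat (n div 2))"

definition enc_int :: "int \<Rightarrow> bool list" where
  "enc_int i = (i < 0) # enc_nat (nat \<bar>i\<bar>)"

definition enc_list :: "('a \<Rightarrow> bool list) \<Rightarrow> 'a list \<Rightarrow> bool list" where
  "enc_list f xs = concat (map (\<lambda>x. True # f x) xs) @ [False]"

definition enc_pair :: "('a \<Rightarrow> bool list) \<Rightarrow> ('b \<Rightarrow> bool list) \<Rightarrow> 'a \<times> 'b \<Rightarrow> bool list" where
  "enc_pair f g p = f (fst p) @ g (snd p)"

fun enc_bform :: "('a \<Rightarrow> bool list) \<Rightarrow> 'a bform \<Rightarrow> bool list" where
  "enc_bform f BTrue = enc_nat 0"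
| "enc_bform f BFalse = enc_nat 1"
| "enc_bform f (BAtom a) = enc_nat 2 @ f a"
| "enc_bform f (BNot g) = enc_nat 3 @ enc_bform f g"
| "enc_bform f (BAnd g h) = enc_nat 4 @ enc_bform f g @ enc_bform f h"
| "enc_bform f (BOr g h) = enc_nat 5 @ enc_bform f g @ enc_bform f h"

definition enc_lin :: "lin \<Rightarrow> bool list" where
  "enc_lin = enc_list (enc_pair enc_int enc_nat)"

fun enc_pa_atom :: "pa_atom \<Rightarrow> bool list" where
  "enc_pa_atom (LinLe t b) = enc_nat 0 @ enc_lin t @ enc_int b"
| "enc_pa_atom (LinCong t b m) = enc_nat 1 @ enc_lin t @ enc_int b @ enc_int m"

fun enc_epa :: "epa \<Rightarrow> bool list" where
  "enc_epa (EPA xs \<phi>) = enc_list enc_nat xs @ enc_bform enc_pa_atom \<phi>"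

definition enc_mpoly :: "mpoly \<Rightarrow> bool list" where
  "enc_mpoly = enc_list (enc_pair enc_int (enc_list enc_nat))"

fun enc_bpa_atom :: "bpa_atom \<Rightarrow> bool list" where
  "enc_bpa_atom (PolyLe ps q) = enc_nat 0 @ enc_list enc_mpoly ps @ enc_mpoly q"
| "enc_bpa_atom (PolyCong ps r q) = enc_nat 1 @ enc_list enc_mpoly ps @ enc_mpoly r @ enc_mpoly q"

fun enc_bpa :: "bpa \<Rightarrow> bool list" where
  "enc_bpa (BPA ks ys \<phi>) = enc_list enc_nat ks @ enc_list enc_nat ys @ enc_bform enc_bpa_atom \<phi>"

text \<open>States are 0..tm_states-1 (0 start, 1 halting), tape symbols 0..tm_syms-1
  (0 blank, 1 encodes bit False, 2 encodes bit True). The transition table maps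
  (state, symbol) to (new state, written symbol, head move in {-1,0,1}); only its
  values on the finite domain of states and symbols are ever used.\<close>
record tm =
  tm_states :: nat
  tm_syms :: nat
  tm_delta :: "nat \<Rightarrow> nat \<Rightarrow> nat \<times> nat \<times> int"

definition tm_wf :: "tm \<Rightarrow> bool" where
  "tm_wf M = (tm_states M \<ge> 2 \<and> tm_syms M \<ge> 3 \<and>
     (\<forall>q < tm_states M. \<forall>a < tm_syms M. case tm_delta M q a of (q', a', d) \<Rightarrow>
        q' < tm_states M \<and> a' < tm_syms M \<and> d \<in> {-1, 0, 1}))"

type_synonym config = "nat \<times> (int \<Rightarrow> nat) \<times> int"

definition sym_of_bit :: "bool \<Rightarrow> nat" where
  "sym_of_bit b = (if b then 2 else 1)"

definition tm_init :: "bool list \<Rightarrow> config" where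
  "tm_init w = (0, (\<lambda>i. if 0 \<le> i \<and> i < int (length w) then sym_of_bit (w ! nat i) else 0), 0)"

definition tm_step :: "tm \<Rightarrow> config \<Rightarrow> config" where
  "tm_step M c = (case c of (q, tp, h) \<Rightarrow>
     if q = 1 then c else (case tm_delta M q (tp h) of (q', a', d) \<Rightarrow> (q', tp(h := a'), h + d)))"

definition tm_run :: "tm \<Rightarrow> nat \<Rightarrow> bool list \<Rightarrow> config" where
  "tm_run M t w = (tm_step M ^^ t) (tm_init w)"

definition tm_halts_with :: "tm \<Rightarrow> bool list \<Rightarrow> nat \<Rightarrow> bool list \<Rightarrow> bool" where
  "tm_halts_with M w t v = (case tm_run M t w of (q, tp, h) \<Rightarrow>
     q = 1 \<and> (\<forall>i < length v. tp (int i) = sym_of_bit (v ! i))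
           \<and> tp (int (length v)) \<notin> {1, 2})"

end

theory Submission
  imports Defs "Jordan_Normal_Form.Determinant"
begin

text \<open>
  Replace each bound variable \<open>z\<close> by \<open>(\<Sum>y. P z y * y - r z) div e\<close>, where \<open>y\<close> ranges over the free variables and
  \<open>e\<close>, \<open>P z y\<close>, \<open>r z\<close> are new variables bounded by \<open>2 ^ (N ^ 6) - 1\<close> for \<open>N\<close> the input length; atoms are
  multiplied by \<open>e\<close>, and a congruence states that the quotients are integers. Soundness is immediate.
  Completeness is a small model property of parametric integer programming: freeze the residues
  modulo the product of all moduli, and walk from an arbitrary integer solution of the true linear literals
  along columns of adjugates until \<open>n\<close> independent constraints are almost tight. Cramer's rule then
  expresses the point as an affine function of the parameters with coefficients bounded by subdeterminants.

  For the machine, \<open>e\<close>, \<open>P z y\<close>, \<open>r z\<close> are indexed by positions of names in the input word, so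
  that writing the output only takes nested loops over input positions and searches by bounded primitive
  recursion on [0, N]. Such programs run on registers with values in [0, N], each of which is a
  marker on the tape.
\<close>

subsection \<open>Integer points near a vertex\<close>

text \<open>A vertex of the polyhedron need not be integral, so the walk visits integer points only
  and settles for slacks below the determinant bound; these slacks are absorbed into the constant
  term, so \<open>e\<close>, \<open>P\<close> and \<open>r\<close> are integers whose bounds do not
  mention the parameters. Which values work does depend on the parameters, and may, since the new
  variables are quantified under them. No case distinction over truth values of atoms is made: the
  constraint system contains every small inequality that happens to hold, among them the negations
  of false atoms. The exponent \<open>N ^ 6\<close> is crude: with
  \<open>D = 2 ^ (4 * N ^ 2)\<close> all quantities of the small model stay below
  \<open>D ^ 4 = 2 ^ (16 * N ^ 2)\<close>, and \<open>2 \<le> N\<close>. The shape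
  \<open>2 ^ k - 1\<close> matters for writing: its encoding is \<open>k\<close> equal pairs of bits
  and a terminator, hence six nested loops. The indices of \<open>P z y\<close> and
  \<open>r z\<close> may exceed \<open>N\<close>, but no register holds one, since an exponent list
  is unary in its length. The formula comes in prefix notation, so its nodes are visited from left
  to right without a stack.\<close>

lemma det_abs_le:
  fixes A :: "int mat"
  assumes A: "A \<in> carrier_mat n n" and H: "\<And>i j. i < n \<Longrightarrow> j < n \<Longrightarrow> \<bar>A $$ (i, j)\<bar> \<le> H"
  shows "\<bar>det A\<bar> \<le> fact n * H ^ n"
proof -
  let ?P = "{p. p permutes {0..<n}}"
  have "\<bar>det A\<bar> \<le> (\<Sum>p\<in>?P. \<bar>signof p * (\<Prod>i = 0..<n. A $$ (i, p i))\<bar>)"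
    unfolding det_def'[OF A] by (rule sum_abs)
  also have "\<dots> \<le> (\<Sum>p\<in>?P. H ^ n)"
  proof (rule sum_mono)
    fix p assume p: "p \<in> ?P"
    have "\<bar>signof p * (\<Prod>i = 0..<n. A $$ (i, p i))\<bar> = (\<Prod>i = 0..<n. \<bar>A $$ (i, p i)\<bar>)"
      by (simp add: abs_mult abs_prod sign_def)
    also have "\<dots> \<le> (\<Prod>i = 0..<n. H)"
      using p permutes_in_image[of p "{0..<n}"] by (intro prod_mono) (auto intro!: H)
    finally show "\<bar>signof p * (\<Prod>i = 0..<n. A $$ (i, p i))\<bar> \<le> H ^ n" by simp
  qed
  also have "\<dots> = fact n * H ^ n" by (simp add: card_permutations)
  finally show ?thesis .
qed

text \<open>Laplace expansion along row \<open>j\<close>; deleting that row removes the only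
  difference between the two matrices, so they share these cofactors.\<close>

lemma sum_cofactor_row:
  fixes A :: "int mat"
  assumes A: "A \<in> carrier_mat n n" and j: "j < n"
  shows "(\<Sum>k<n. a k * cofactor A j k) = det (mat n n (\<lambda>(i, k). if i = j then a k else A $$ (i, k)))"
proof -
  let ?A = "mat n n (\<lambda>(i, k). if i = j then a k else A $$ (i, k))"
  have "mat_delete ?A j k = mat_delete A j k" if "k < n" for k
    unfolding mat_delete_def using A j by (intro eq_matI) auto
  then have "cofactor ?A j k = cofactor A j k" if "k < n" for k
    using that by (simp add: cofactor_def)
  then show ?thesis using j by (subst laplace_expansion_row[of ?A n j]) auto
qed

text \<open>The cofactor is the determinant of the matrix whose row \<open>j\<close> is replaced by
  a unit vector. Keeping the size \<open>n\<close> lets one bound serve determinants and cofactors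
  alike; the entry 1 of the new row is where \<open>1 \<le> H\<close> enters.\<close>

lemma cofactor_abs_le:
  fixes A :: "int mat"
  assumes A: "A \<in> carrier_mat n n" and H: "\<And>i j. i < n \<Longrightarrow> j < n \<Longrightarrow> \<bar>A $$ (i, j)\<bar> \<le> H" "1 \<le> H"
    and jk: "j < n" "k < n"
  shows "\<bar>cofactor A j k\<bar> \<le> fact n * H ^ n"
proof -
  have "cofactor A j k = (\<Sum>i<n. of_bool (i = k) * cofactor A j i)"
    using jk by (simp add: of_bool_def if_distrib[of "\<lambda>x. x * _"] cong: if_cong)
  also have "\<dots> = det (mat n n (\<lambda>(i, k'). if i = j then of_bool (k' = k) else A $$ (i, k')))"
    by (rule sum_cofactor_row[OF A jk(1)])
  finally show ?thesis using det_abs_le[of _ n H] H by (auto simp: of_bool_def)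
qed

text \<open>A row is an inequality: \<open>fst\<close> holds the coefficients and \<open>snd\<close>
  the right-hand side, so a point satisfies it iff its \<open>slack\<close> is nonnegative.\<close>

definition rowmat :: "nat \<Rightarrow> (nat \<Rightarrow> (nat \<Rightarrow> int) \<times> int) \<Rightarrow> int mat" where
  "rowmat n B = mat n n (\<lambda>(i, k). fst (B i) k)"

definition slack :: "nat \<Rightarrow> (nat \<Rightarrow> int) \<times> int \<Rightarrow> (nat \<Rightarrow> int) \<Rightarrow> int" where
  "slack n r x = snd r - (\<Sum>k<n. fst r k * x k)"

lemma rowmat_carrier [simp]: "rowmat n B \<in> carrier_mat n n"
  by (simp add: rowmat_def)

lemma sum_row_cofactor:
  assumes "i < n" "j < n"
  shows "(\<Sum>k<n. fst (B i) k * cofactor (rowmat n B) j k) = (if i = j then det (rowmat n B) else 0)"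
proof -
  have "(rowmat n B * adj_mat (rowmat n B)) $$ (i, j) = (det (rowmat n B) \<cdot>\<^sub>m 1\<^sub>m n) $$ (i, j)"
    using adj_mat(2)[OF rowmat_carrier[of n B]] by simp
  then show ?thesis using assms
    by (simp add: adj_mat_def scalar_prod_def rowmat_def lessThan_atLeast0)
qed

lemma sum_cofactor_col:
  assumes "k < n" "l < n"
  shows "(\<Sum>i<n. cofactor (rowmat n B) i k * fst (B i) l) = (if k = l then det (rowmat n B) else 0)"
proof -
  have "(adj_mat (rowmat n B) * rowmat n B) $$ (k, l) = (det (rowmat n B) \<cdot>\<^sub>m 1\<^sub>m n) $$ (k, l)"
    using adj_mat(3)[OF rowmat_carrier[of n B]] by simp
  then show ?thesis using assms
    by (simp add: adj_mat_def scalar_prod_def rowmat_def lessThan_atLeast0)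
qed

lemma rowmat_abs_le:
  "(\<And>i k. i < n \<Longrightarrow> k < n \<Longrightarrow> \<bar>fst (B i) k\<bar> \<le> H) \<Longrightarrow> \<bar>det (rowmat n B)\<bar> \<le> fact n * H ^ n"
  by (rule det_abs_le[of _ n]) (auto simp: rowmat_def)

text \<open>Cramer's rule with slacks: \<open>x\<close> solves the rows of \<open>B\<close> with
  equality once the slacks are subtracted from the right-hand sides, and the adjugate isolates
  \<open>x k\<close>.\<close>

lemma cofactor_solve:
  assumes "k < n"
  shows "det (rowmat n B) * x k = (\<Sum>i<n. cofactor (rowmat n B) i k * (snd (B i) - slack n (B i) x))"
proof -
  have "(\<Sum>i<n. cofactor (rowmat n B) i k * (snd (B i) - slack n (B i) x))
      = (\<Sum>i<n. \<Sum>l<n. cofactor (rowmat n B) i k * fst (B i) l * x l)"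
    by (simp add: slack_def sum_distrib_left mult.assoc)
  also have "\<dots> = (\<Sum>l<n. (\<Sum>i<n. cofactor (rowmat n B) i k * fst (B i) l) * x l)"
    by (subst sum.swap) (simp add: sum_distrib_right)
  also have "\<dots> = (\<Sum>l<n. (if k = l then det (rowmat n B) else 0) * x l)"
    using assms by (intro sum.cong) (auto simp: sum_cofactor_col)
  also have "\<dots> = det (rowmat n B) * x k"
    using assms by (simp add: if_distrib[of "\<lambda>t. t * _"] cong: if_cong)
  finally show ?thesis by simp
qed

text \<open>The basis exchange step: moving along a column of the adjugate changes the slack of one
  basic row only, and the first row that blocks the move replaces it; the new determinant is the
  rate of change of the blocking row, so it does not vanish and bounds the new slack.\<close>
lemma exchange_step:
  fixes R :: "((nat \<Rightarrow> int) \<times> int) set"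
  assumes H: "\<And>r k. r \<in> R \<Longrightarrow> k < n \<Longrightarrow> \<bar>fst r k\<bar> \<le> H"
    and B: "\<And>i. i < n \<Longrightarrow> B i \<in> R" "det (rowmat n B) \<noteq> 0"
    and x: "\<And>r. r \<in> R \<Longrightarrow> 0 \<le> slack n r x" and j: "j < n"
  shows "\<exists>r\<in>R. \<exists>x'. (\<forall>r\<in>R. 0 \<le> slack n r x') \<and> det (rowmat n (B(j := r))) \<noteq> 0
    \<and> slack n r x' < fact n * H ^ n \<and> (\<forall>i<n. i \<noteq> j \<longrightarrow> slack n (B i) x' = slack n (B i) x)"
proof -
  define d where "d = det (rowmat n B)"
  \<comment> \<open>A column of the adjugate; the sign makes the move lower the slack of row
    \<open>j\<close>, by the absolute value of \<open>d\<close> per step.\<close>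
  define v where "v k = sgn d * cofactor (rowmat n B) j k" for k
  define rate where "rate r = (\<Sum>k<n. fst r k * v k)" for r :: "(nat \<Rightarrow> int) \<times> int"
  define y where "y t k = x k + int t * v k" for t k
  have slack_y: "slack n r (y t) = slack n r x - int t * rate r" for r t
    by (simp add: slack_def y_def rate_def algebra_simps sum.distrib sum_distrib_left)
  have rate_cof: "rate r = sgn d * (\<Sum>k<n. fst r k * cofactor (rowmat n B) j k)" for r
    by (simp add: rate_def v_def sum_distrib_left algebra_simps)
  have rate_B: "rate (B i) = (if i = j then \<bar>d\<bar> else 0)" if "i < n" for i
    using that j by (simp add: rate_cof sum_row_cofactor d_def abs_sgn)
  have rate_det: "rate r = sgn d * det (rowmat n (B(j := r)))" for r
  proof -
    have "mat n n (\<lambda>(i, k). if i = j then fst r k else rowmat n B $$ (i, k)) = rowmat n (B(j := r))"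
      by (rule eq_matI) (auto simp: rowmat_def)
    then show ?thesis by (simp add: rate_cof sum_cofactor_row[OF rowmat_carrier j])
  qed
  define T where "T = {t. \<forall>r\<in>R. 0 \<le> slack n r (y t)}"
  have "t \<le> nat (slack n (B j) x)" if "t \<in> T" for t
  proof -
    have "int t * 1 \<le> int t * \<bar>d\<bar>" using B(2) by (intro mult_left_mono) (auto simp: d_def)
    moreover have "0 \<le> slack n (B j) (y t)" using that B(1)[OF j] by (auto simp: T_def)
    ultimately show ?thesis using rate_B[OF j] by (simp add: slack_y)
  qed
  then have fin: "finite T" by (meson finite_nat_set_iff_bounded_le)
  have "0 \<in> T" using x by (auto simp: T_def slack_y)
  then have t: "Max T \<in> T" using fin by (intro Max_in) auto
  have t': "Suc (Max T) \<notin> T" using Max_ge[OF fin, of "Suc (Max T)"] by linarith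
  define t where "t = Max T"
  from t' obtain r where r: "r \<in> R" "slack n r (y (Suc t)) < 0"
    by (auto simp: T_def t_def not_le)
  have lt: "slack n r (y t) < rate r" using r(2) by (simp add: slack_y algebra_simps)
  have ge: "\<forall>r\<in>R. 0 \<le> slack n r (y t)" using t by (simp add: T_def t_def)
  have "0 < rate r" using lt ge r(1) by fastforce
  moreover have "rate r \<le> \<bar>det (rowmat n (B(j := r)))\<bar>"
    unfolding rate_det by (cases "d = 0"; cases "d > 0") auto
  moreover have "\<bar>det (rowmat n (B(j := r)))\<bar> \<le> fact n * H ^ n"
    by (rule rowmat_abs_le) (use H B(1) r(1) in auto)
  ultimately have "det (rowmat n (B(j := r))) \<noteq> 0" "slack n r (y t) < fact n * H ^ n"
    using lt by auto
  moreover have "\<forall>i<n. i \<noteq> j \<longrightarrow> slack n (B i) (y t) = slack n (B i) x"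
    by (simp add: slack_y rate_B)
  ultimately show ?thesis using r(1) ge by blast
qed

text \<open>The measure is the number of basic rows with large slack: an exchange replaces one of
  them by a row with small slack and leaves the other slacks alone.\<close>

lemma vertex_descent:
  fixes R :: "((nat \<Rightarrow> int) \<times> int) set"
  assumes H: "\<And>r k. r \<in> R \<Longrightarrow> k < n \<Longrightarrow> \<bar>fst r k\<bar> \<le> H"
    and "\<forall>i<n. B i \<in> R" "det (rowmat n B) \<noteq> 0" "\<forall>r\<in>R. 0 \<le> slack n r x"
  shows "\<exists>B x. (\<forall>i<n. B i \<in> R) \<and> det (rowmat n B) \<noteq> 0 \<and> (\<forall>r\<in>R. 0 \<le> slack n r x)
    \<and> (\<forall>i<n. slack n (B i) x < fact n * H ^ n)"
  using assms(2-)
proof (induction "card {i. i < n \<and> fact n * H ^ n \<le> slack n (B i) x}" arbitrary: B x rule: less_induct)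
  case less
  show ?case
  proof (cases "\<exists>j<n. fact n * H ^ n \<le> slack n (B j) x")
    case True
    then obtain j where j: "j < n" "fact n * H ^ n \<le> slack n (B j) x" by blast
    from exchange_step[of R n H B x j] H less.prems j(1)
    obtain r x' where r: "r \<in> R" "\<forall>r\<in>R. 0 \<le> slack n r x'" "det (rowmat n (B(j := r))) \<noteq> 0"
      "slack n r x' < fact n * H ^ n" "\<forall>i<n. i \<noteq> j \<longrightarrow> slack n (B i) x' = slack n (B i) x" by metis
    have "{i. i < n \<and> fact n * H ^ n \<le> slack n ((B(j := r)) i) x'}
        \<subset> {i. i < n \<and> fact n * H ^ n \<le> slack n (B i) x}"
      using r(4,5) j by (auto split: if_splits)
    then have "card {i. i < n \<and> fact n * H ^ n \<le> slack n ((B(j := r)) i) x'}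
        < card {i. i < n \<and> fact n * H ^ n \<le> slack n (B i) x}"
      by (intro psubset_card_mono) auto
    then show ?thesis
    proof (rule less.hyps)
      show "\<forall>i<n. (B(j := r)) i \<in> R" using less.prems(1) r(1) by auto
    qed (use r in blast)+
  qed (use less.prems in \<open>auto simp: not_le\<close>)
qed

text \<open>The hypothesis \<open>unit\<close> supplies a starting basis with a diagonal matrix. In
  the result \<open>e\<close> is the absolute value of the final determinant, \<open>D\<close> the
  adjugate up to the same sign, and \<open>s\<close> the remaining slacks.\<close>

lemma near_vertex_solution:
  fixes R :: "((nat \<Rightarrow> int) \<times> int) set"
  assumes H: "\<And>r k. r \<in> R \<Longrightarrow> k < n \<Longrightarrow> \<bar>fst r k\<bar> \<le> H" and H1: "1 \<le> H"
    and unit: "\<And>k. k < n \<Longrightarrow> \<exists>s c. s \<noteq> 0 \<and> ((\<lambda>i. if i = k then s else 0), c) \<in> R"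
    and feas: "\<forall>r\<in>R. 0 \<le> slack n r x0"
  shows "\<exists>B x D e s. (\<forall>i<n. B i \<in> R) \<and> (\<forall>r\<in>R. 0 \<le> slack n r x)
    \<and> 1 \<le> e \<and> e \<le> fact n * H ^ n
    \<and> (\<forall>i<n. \<forall>k<n. \<bar>D k i\<bar> \<le> fact n * H ^ n)
    \<and> (\<forall>i<n. 0 \<le> s i \<and> s i \<le> fact n * H ^ n)
    \<and> (\<forall>k<n. e * x k = (\<Sum>i<n. D k i * (snd (B i) - s i)))"
proof -
  from unit obtain sg c where sg: "\<And>k. k < n \<Longrightarrow> sg k \<noteq> 0 \<and> ((\<lambda>i. if i = k then sg k else 0), c k) \<in> R"
    by metis
  define B0 where "B0 k = ((\<lambda>i. if i = k then sg k else 0), c k :: int)" for k :: nat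
  have "upper_triangular (rowmat n B0)" by (auto simp: rowmat_def B0_def)
  from det_upper_triangular[OF this rowmat_carrier]
  have "det (rowmat n B0) \<noteq> 0"
    using sg by (auto simp: diag_mat_def rowmat_def B0_def prod_list_zero_iff)
  then have "\<exists>B x. (\<forall>i<n. B i \<in> R) \<and> det (rowmat n B) \<noteq> 0 \<and> (\<forall>r\<in>R. 0 \<le> slack n r x)
    \<and> (\<forall>i<n. slack n (B i) x < fact n * H ^ n)"
    by (intro vertex_descent[of R n H B0 x0]) (use H sg feas in \<open>auto simp: B0_def\<close>)
  then obtain B x where B: "\<forall>i<n. B i \<in> R" "det (rowmat n B) \<noteq> 0" "\<forall>r\<in>R. 0 \<le> slack n r x"
    "\<forall>i<n. slack n (B i) x < fact n * H ^ n" by blast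
  let ?d = "det (rowmat n B)"
  let ?D = "\<lambda>k i. sgn ?d * cofactor (rowmat n B) i k"
  have "\<bar>?d\<bar> * x k = (\<Sum>i<n. ?D k i * (snd (B i) - slack n (B i) x))" if "k < n" for k
  proof -
    have "\<bar>?d\<bar> * x k = sgn ?d * (?d * x k)" by (simp add: abs_sgn)
    also have "?d * x k = (\<Sum>i<n. cofactor (rowmat n B) i k * (snd (B i) - slack n (B i) x))"
      using that by (rule cofactor_solve)
    finally show ?thesis by (simp add: sum_distrib_left mult.assoc)
  qed
  moreover have "\<bar>?D k i\<bar> \<le> fact n * H ^ n" if "i < n" "k < n" for i k
  proof -
    have "\<bar>?D k i\<bar> = \<bar>cofactor (rowmat n B) i k\<bar>" using B(2) by (simp add: abs_mult abs_sgn_eq)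
    also have "\<dots> \<le> fact n * H ^ n"
      by (rule cofactor_abs_le[OF rowmat_carrier _ H1 that]) (use H B in \<open>auto simp: rowmat_def\<close>)
    finally show ?thesis .
  qed
  moreover have "\<bar>?d\<bar> \<le> fact n * H ^ n" by (rule rowmat_abs_le) (use H B in auto)
  moreover have "1 \<le> \<bar>?d\<bar>" using B(2) by linarith
  ultimately show ?thesis using B
    by (intro exI[of _ B] exI[of _ x] exI[of _ ?D] exI[of _ "\<bar>?d\<bar>"] exI[of _ "\<lambda>i. slack n (B i) x"])
      (auto simp: less_imp_le)
qed

subsection \<open>Programs over bounded registers\<close>

text \<open>The instructions are limited to what a single sweep from left to right over the tape can
  perform.\<close>

datatype op = ZeroOp nat | TopOp nat | IncOp nat | CopyOp nat nat | EmitOp bool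
datatype tst = IsBit nat | IsEq nat nat
datatype com = Op op | IfC tst "com list" "com list" | Until tst "com list"

type_synonym store = "(nat \<Rightarrow> nat) \<times> bool list"

fun exec_op :: "bool list \<Rightarrow> op \<Rightarrow> store \<Rightarrow> store" where
  "exec_op w (ZeroOp r) (s, out) = (s(r := 0), out)"
| "exec_op w (TopOp r) (s, out) = (s(r := length w), out)"
| "exec_op w (IncOp r) (s, out) = (s(r := if s r < length w then Suc (s r) else s r), out)"
| "exec_op w (CopyOp r q) (s, out) = (s(r := s q), out)"
| "exec_op w (EmitOp b) (s, out) = (s, out @ [b])"

fun holds :: "bool list \<Rightarrow> tst \<Rightarrow> (nat \<Rightarrow> nat) \<Rightarrow> bool" where
  "holds w (IsBit r) s = (s r < length w \<and> w ! s r)"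
| "holds w (IsEq r q) s = (s r = s q)"

text \<open>Control flow alone, with the outcome of the test passed in as \<open>b\<close>, so that
  the reachable continuations can be studied without a store.\<close>

fun next_prog :: "com list \<Rightarrow> bool \<Rightarrow> com list" where
  "next_prog [] b = []"
| "next_prog (Op p # K) b = K"
| "next_prog (IfC t xs ys # K) b = (if b then xs else ys) @ K"
| "next_prog (Until t xs # K) b = (if b then K else xs @ Until t xs # K)"

fun cstep :: "bool list \<Rightarrow> com list \<times> store \<Rightarrow> com list \<times> store" where
  "cstep w ([], st) = ([], st)"
| "cstep w (Op p # K, st) = (K, exec_op w p st)"
| "cstep w (IfC t xs ys # K, st) = (next_prog (IfC t xs ys # K) (holds w t (fst st)), st)"
| "cstep w (Until t xs # K, st) = (next_prog (Until t xs # K) (holds w t (fst st)), st)"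

text \<open>The continuations that can arise while \<open>c\<close> runs in front of
  \<open>K\<close>. They are finitely many, because a loop body is continued by the loop itself, and
  they become control states of the machine.\<close>

fun conts :: "com \<Rightarrow> com list \<Rightarrow> com list set" and conts_list :: "com list \<Rightarrow> com list \<Rightarrow> com list set" where
  "conts (Op p) K = {Op p # K}"
| "conts (IfC t xs ys) K = insert (IfC t xs ys # K) (conts_list xs K \<union> conts_list ys K)"
| "conts (Until t xs) K = insert (Until t xs # K) (conts_list xs (Until t xs # K))"
| "conts_list [] K = {K}"
| "conts_list (c # cs) K = conts c (cs @ K) \<union> conts_list cs K"

lemma finite_conts: "finite (conts c K)" "finite (conts_list cs K)"
  by (induction c K and cs K rule: conts_conts_list.induct) auto

lemma in_conts: "c # K \<in> conts c K"
  by (cases c) auto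

lemma in_conts_list: "cs @ K \<in> conts_list cs K"
  by (cases cs) (auto simp: in_conts)

lemma tail_in_conts_list: "K \<in> conts_list cs K"
  by (induction cs) auto

text \<open>The exit \<open>K\<close> belongs to the enclosing program, so closure is claimed only
  up to it; for \<open>K = []\<close> the exception disappears, as \<open>[]\<close> is its own
  successor.\<close>

lemma conts_closed:
  "X \<in> conts c K \<Longrightarrow> X = K \<or> next_prog X b \<in> insert K (conts c K)"
  "X \<in> conts_list cs K \<Longrightarrow> X = K \<or> next_prog X b \<in> conts_list cs K"
proof (induction c K and cs K rule: conts_conts_list.induct)
  case (2 t xs ys K)
  then show ?case using in_conts_list[of xs K] in_conts_list[of ys K] by auto
next
  case (3 t xs K)
  then show ?case using in_conts_list[of xs "Until t xs # K"] by auto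
next
  case (5 c cs K)
  then show ?case using in_conts_list[of cs K] tail_in_conts_list[of K cs] by auto
qed auto

lemma conts_list_closed: "X \<in> conts_list P [] \<Longrightarrow> next_prog X b \<in> conts_list P []"
  using conts_closed(2)[of X P "[]" b] tail_in_conts_list by fastforce

fun op_regs :: "op \<Rightarrow> nat set" where
  "op_regs (ZeroOp r) = {r}" | "op_regs (TopOp r) = {r}" | "op_regs (IncOp r) = {r}"
| "op_regs (CopyOp r q) = {r, q}" | "op_regs (EmitOp b) = {}"

fun tst_regs :: "tst \<Rightarrow> nat set" where
  "tst_regs (IsBit r) = {r}" | "tst_regs (IsEq r q) = {r, q}"

fun hd_regs :: "com list \<Rightarrow> nat set" where
  "hd_regs [] = {}"
| "hd_regs (Op p # K) = op_regs p"
| "hd_regs (IfC t xs ys # K) = tst_regs t"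
| "hd_regs (Until t xs # K) = tst_regs t"

definition prog_regs :: "com list \<Rightarrow> nat set" where
  "prog_regs P = (\<Union>X\<in>conts_list P []. hd_regs X)"

lemma finite_prog_regs: "finite (prog_regs P)"
proof -
  have "finite (op_regs p)" for p by (cases p) auto
  moreover have "finite (tst_regs t)" for t by (cases t) auto
  ultimately have "finite (hd_regs X)" for X by (cases X rule: hd_regs.cases) auto
  then show ?thesis by (simp add: prog_regs_def finite_conts)
qed

subsection \<open>Running programs on a Turing machine\<close>

text \<open>A tape symbol has four tracks: the marker of cell 0, the input letter, the set of
  registers whose value is this position, and the output letter. Register values reach
  \<open>N\<close>, so marks may also sit on the cell right behind the input.\<close>

datatype cell = Cell (cstart: bool) (clet: "bool option") (cmarks: "nat set") (cout: "bool option")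
text \<open>\<open>Go K f\<close> sweeps right, executing the head of \<open>K\<close> with one bit
  of memory \<open>f\<close>; \<open>Back K\<close> returns to cell 0 and resumes with
  \<open>K\<close>; \<open>Fin\<close> turns the output track into plain bits.\<close>

datatype ctl = Init | Halt | Go "com list" bool | Back "com list" | Fin

text \<open>The result says whether the sweep stops here, and gives the new cell and flag. Register
  operations stop at position \<open>N\<close>, the first cell without an input letter. An increment
  carries the mark to the next cell in the flag and leaves a mark at \<open>N\<close> in place. An
  emission stops at the first free cell of the output track.\<close>

fun sweep_op :: "op \<Rightarrow> bool \<Rightarrow> cell \<Rightarrow> bool \<times> cell \<times> bool" where
  "sweep_op (ZeroOp r) f (Cell s l m o') = (l = None, Cell s l (if s then insert r m else m - {r}) o', f)"
| "sweep_op (TopOp r) f (Cell s l m o') = (l = None, Cell s l (if l = None then insert r m else m - {r}) o', f)"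
| "sweep_op (IncOp r) f (Cell s l m o') =
    (l = None, Cell s l (if f \<or> r \<in> m \<and> l = None then insert r m else m - {r}) o', r \<in> m)"
| "sweep_op (CopyOp r q) f (Cell s l m o') = (l = None, Cell s l (if q \<in> m then insert r m else m - {r}) o', f)"
| "sweep_op (EmitOp b) f (Cell s l m o') = (o' = None, Cell s l m (if o' = None then Some b else o'), f)"

fun sweep_tst :: "tst \<Rightarrow> bool \<Rightarrow> cell \<Rightarrow> bool \<times> cell \<times> bool" where
  "sweep_tst (IsBit r) f (Cell s l m o') = (l = None, Cell s l m o', f \<or> r \<in> m \<and> l = Some True)"
| "sweep_tst (IsEq r q) f (Cell s l m o') = (l = None, Cell s l m o', f \<or> r \<in> m \<and> q \<in> m)"

fun sweep :: "com list \<Rightarrow> bool \<Rightarrow> cell \<Rightarrow> bool \<times> cell \<times> bool" where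
  "sweep [] f a = (True, a, f)"
| "sweep (Op p # K) f a = sweep_op p f a"
| "sweep (IfC t xs ys # K) f a = sweep_tst t f a"
| "sweep (Until t xs # K) f a = sweep_tst t f a"

text \<open>\<open>Init\<close> puts every mark on cell 0, so all registers start at 0.
  \<open>Fin\<close> blanks the cell behind the output, because remains of the input may stand
  there.\<close>

fun delta :: "com list \<Rightarrow> ctl \<Rightarrow> cell \<Rightarrow> ctl \<times> cell \<times> int" where
  "delta P Init a = (Back P, Cell True (clet a) (prog_regs P) (cout a), 0)"
| "delta P Halt a = (Halt, a, 0)"
| "delta P (Back K) a = (if cstart a then (if K = [] then Fin else Go K False, a, 0) else (Back K, a, -1))"
| "delta P (Go K f) a = (case sweep K f a of (stop, a', f') \<Rightarrow>
     if stop then (Back (next_prog K f'), a', 0) else (Go K f', a', 1))"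
| "delta P Fin a = (case cout a of None \<Rightarrow> (Halt, Cell False None {} None, 0)
     | Some b \<Rightarrow> (Fin, Cell False (Some b) {} None, 1))"

type_synonym aconf = "ctl \<times> (int \<Rightarrow> cell) \<times> int"

fun astep :: "com list \<Rightarrow> aconf \<Rightarrow> aconf" where
  "astep P (q, tp, h) = (case delta P q (tp h) of (q', a', d) \<Rightarrow> (q', tp(h := a'), h + d))"

definition cellof :: "nat set \<Rightarrow> bool list \<Rightarrow> store \<Rightarrow> int \<Rightarrow> cell" where
  "cellof U w st i = Cell (i = 0) (if 0 \<le> i \<and> i < int (length w) then Some (w ! nat i) else None)
     {r \<in> U. int (fst st r) = i} (if 0 \<le> i \<and> i < int (length (snd st)) then Some (snd st ! nat i) else None)"

definition istape :: "bool list \<Rightarrow> int \<Rightarrow> cell" where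
  "istape w i = Cell False (if 0 \<le> i \<and> i < int (length w) then Some (w ! nat i) else None) {} None"

abbreviation resume :: "com list \<Rightarrow> ctl" where
  "resume K \<equiv> (if K = [] then Fin else Go K False)"

lemma astep_run:
  assumes "\<And>i. i < e \<Longrightarrow> delta P (q i) (T (int i)) = (q (Suc i), T' (int i), 1)"
  shows "(astep P ^^ e) (q 0, T, 0) = (q e, (\<lambda>j. if 0 \<le> j \<and> j < int e then T' j else T j), int e)"
  using assms
proof (induction e)
  case (Suc e)
  have "(\<lambda>j. if 0 \<le> j \<and> j < int e then T' j else T j)(int e := T' (int e))
     = (\<lambda>j. if 0 \<le> j \<and> j < 1 + int e then T' j else T j)" by auto
  then show ?case using Suc by (simp add: add.commute)
next
  case 0
  have "(\<lambda>j. if 0 \<le> j \<and> j < 0 then T' j else T j) = T" by (rule ext) auto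
  then show ?case by simp
qed

text \<open>There are \<open>e\<close> moves to the left and one step in place on the marked cell,
  where the next command is dispatched.\<close>

lemma astep_back:
  assumes "\<And>j. 0 < j \<Longrightarrow> \<not> cstart (T j)" "cstart (T 0)"
  shows "(astep P ^^ Suc e) (Back K, T, int e) = (resume K, T, 0)"
proof (induction e)
  case (Suc e)
  have "astep P (Back K, T, int (Suc e)) = (Back K, T, int e)" using assms(1) by simp
  then have "(astep P ^^ Suc (Suc e)) (Back K, T, int (Suc e)) = (astep P ^^ Suc e) (Back K, T, int e)"
    by (simp only: funpow_Suc_right comp_apply)
  then show ?case using Suc by simp
qed (use assms in simp)

text \<open>\<open>F i\<close> is the flag on arrival at cell \<open>i\<close>. The way out and the
  way back take \<open>Suc e\<close> steps each, as each ends with a step in place.\<close>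

lemma astep_sweep:
  assumes run: "\<And>i. i < e \<Longrightarrow> sweep X (F i) (T (int i)) = (False, T' (int i), F (Suc i))"
    and stop: "sweep X (F e) (T (int e)) = (True, T' (int e), F (Suc e))"
    and out: "\<And>j. j < 0 \<or> int e < j \<Longrightarrow> T' j = T j"
    and start: "\<And>j. cstart (T' j) = (j = 0)"
  shows "(astep P ^^ (2 * e + 2)) (Go X (F 0), T, 0) = (resume (next_prog X (F (Suc e))), T', 0)"
proof -
  have "(\<lambda>j. if 0 \<le> j \<and> j < int e then T' j else T j)(int e := T' (int e)) = T'"
    using out by (fastforce simp: fun_eq_iff not_less)
  then have "(astep P ^^ Suc e) (Go X (F 0), T, 0) = (Back (next_prog X (F (Suc e))), T', int e)"
    using astep_run[where e = e and P = P and q = "\<lambda>i. Go X (F i)" and T = T and T' = T'] run stop by simp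
  moreover have "2 * e + 2 = Suc e + Suc e" by simp
  ultimately show ?thesis
    using astep_back[where T = T' and K = "next_prog X (F (Suc e))"] start
    by (simp only: funpow_add comp_apply)
qed

lemma cellof_simps:
  "cstart (cellof U w st j) = (j = 0)"
  by (simp add: cellof_def)

lemma sim_op:
  assumes "op_regs p \<subseteq> U" and s: "\<And>r. s r \<le> length w"
  shows "\<exists>m \<le> 2 * (length w + length out) + 2. (astep P ^^ m) (Go (Op p # K) False, cellof U w (s, out), 0)
    = (resume K, cellof U w (exec_op w p (s, out)), 0)"
proof -
  have step: ?thesis if "e \<le> length w + length out" "\<not> F 0"
    "\<And>i. i < e \<Longrightarrow> sweep_op p (F i) (cellof U w (s, out) (int i))
        = (False, cellof U w (exec_op w p (s, out)) (int i), F (Suc i))"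
    "sweep_op p (F e) (cellof U w (s, out) (int e)) = (True, cellof U w (exec_op w p (s, out)) (int e), F (Suc e))"
    "\<And>j. j < 0 \<or> int e < j \<Longrightarrow> cellof U w (exec_op w p (s, out)) j = cellof U w (s, out) j" for e F
  proof -
    have "(astep P ^^ (2 * e + 2)) (Go (Op p # K) (F 0), cellof U w (s, out), 0)
      = (resume (next_prog (Op p # K) (F (Suc e))), cellof U w (exec_op w p (s, out)), 0)"
      by (rule astep_sweep) (use that in \<open>simp_all add: cellof_simps\<close>)
    then show ?thesis using that(1,2) by (intro exI[of _ "2 * e + 2"]) simp
  qed
  have s': "\<not> length w < s r" "j \<noteq> int (s r)" if "int (length w) < j" for r j
    using s[of r] that by auto
  show ?thesis
  proof (cases p)
    case (ZeroOp r)
    show ?thesis by (rule step[of "length w" "\<lambda>_. False"]) (use assms ZeroOp in \<open>auto simp: cellof_def dest: s'\<close>)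
  next
    case (TopOp r)
    show ?thesis by (rule step[of "length w" "\<lambda>_. False"]) (use assms TopOp in \<open>auto simp: cellof_def dest: s'\<close>)
  next
    case (CopyOp r q)
    show ?thesis by (rule step[of "length w" "\<lambda>_. False"]) (use assms CopyOp in \<open>auto simp: cellof_def dest: s'\<close>)
  next
    \<comment> \<open>The flag is set exactly on arrival at the cell behind the old mark.\<close>
    case (IncOp r)
    show ?thesis
      by (rule step[of "length w" "\<lambda>i. Suc (s r) = i"]) (use assms IncOp in \<open>auto simp: cellof_def dest: s'\<close>)
  next
    case (EmitOp b)
    show ?thesis by (rule step[of "length out" "\<lambda>_. False"])
      (use assms EmitOp in \<open>auto simp: cellof_def nth_append dest: s'\<close>)
  qed
qed

text \<open>The flag becomes true once the sweep has passed a cell that witnesses the test, and then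
  stays true.\<close>

lemma sim_tst:
  assumes "tst_regs t \<subseteq> U" and s: "\<And>r. s r \<le> length w"
    and X: "\<And>f a. sweep X f a = sweep_tst t f a"
  shows "\<exists>m \<le> 2 * (length w + length out) + 2. (astep P ^^ m) (Go X False, cellof U w (s, out), 0)
    = (resume (next_prog X (holds w t s)), cellof U w (s, out), 0)"
proof -
  have step: ?thesis if "\<not> F 0" "F (Suc (length w)) = holds w t s"
    "\<And>i. i < length w \<Longrightarrow> sweep_tst t (F i) (cellof U w (s, out) (int i))
        = (False, cellof U w (s, out) (int i), F (Suc i))"
    "sweep_tst t (F (length w)) (cellof U w (s, out) (int (length w)))
        = (True, cellof U w (s, out) (int (length w)), F (Suc (length w)))" for F
  proof -
    have "(astep P ^^ (2 * length w + 2)) (Go X (F 0), cellof U w (s, out), 0)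
      = (resume (next_prog X (F (Suc (length w)))), cellof U w (s, out), 0)"
      by (rule astep_sweep) (use that X in \<open>simp_all add: cellof_simps\<close>)
    then show ?thesis using that(1,2) by (intro exI[of _ "2 * length w + 2"]) simp
  qed
  show ?thesis
  proof (cases t)
    case (IsBit r)
    show ?thesis by (rule step[of "\<lambda>i. s r < i \<and> s r < length w \<and> w ! s r"])
      (use assms IsBit in \<open>auto simp: cellof_def less_Suc_eq\<close>)
  next
    case (IsEq r q)
    show ?thesis by (rule step[of "\<lambda>i. s r < i \<and> s r = s q"])
      (use assms IsEq in \<open>auto simp: cellof_def less_Suc_eq le_imp_less_Suc intro: le_neq_implies_less\<close>)
  qed
qed

lemma sim_cstep:
  assumes U: "hd_regs X \<subseteq> U" and s: "\<And>r. s r \<le> length w" and X: "X \<noteq> []"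
    and step: "cstep w (X, s, out) = (Y, st)"
  shows "\<exists>m \<le> 2 * (length w + length out) + 2. (astep P ^^ m) (Go X False, cellof U w (s, out), 0)
    = (resume Y, cellof U w st, 0)"
proof (cases X rule: hd_regs.cases)
  case (2 p K)
  then have "K = Y" "exec_op w p (s, out) = st" using step by auto
  then show ?thesis using sim_op[of p U s w out P Y] U s 2 by simp
next
  case (3 t xs ys K)
  then have "next_prog X (holds w t s) = Y" "st = (s, out)" using step by auto
  moreover have "\<exists>m \<le> 2 * (length w + length out) + 2. (astep P ^^ m) (Go X False, cellof U w (s, out), 0)
      = (resume (next_prog X (holds w t s)), cellof U w (s, out), 0)"
    by (rule sim_tst) (use 3 U s in auto)
  ultimately show ?thesis by (simp only:)
next
  case (4 t xs K)
  then have "next_prog X (holds w t s) = Y" "st = (s, out)" using step by auto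
  moreover have "\<exists>m \<le> 2 * (length w + length out) + 2. (astep P ^^ m) (Go X False, cellof U w (s, out), 0)
      = (resume (next_prog X (holds w t s)), cellof U w (s, out), 0)"
    by (rule sim_tst) (use 4 U s in auto)
  ultimately show ?thesis by (simp only:)
qed (use X in simp)

lemma exec_op_bounds:
  assumes "\<And>r. s r \<le> length w" "exec_op w p (s, out) = (s', out')"
  shows "s' r \<le> length w" "length out' \<le> Suc (length out)"
  using assms by (cases p; auto split: if_splits)+

lemma cstep_bounds:
  assumes "\<And>r. s r \<le> length w" "cstep w (X, s, out) = (Y, s', out')"
  shows "s' r \<le> length w" "length out' \<le> Suc (length out)"
  using assms exec_op_bounds[of s w _ out s' out'] by (cases X rule: hd_regs.cases; force)+

lemma cstep_next_prog: "\<exists>b. fst (cstep w (X, st)) = next_prog X b"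
  by (cases X rule: hd_regs.cases) auto

text \<open>A command adds at most one output bit, so no sweep goes beyond cell
  \<open>length w + length out + n\<close>; this makes the total quadratic in \<open>n\<close>. The
  empty program costs no machine step.\<close>

lemma sim_run:
  assumes "X \<in> conts_list P []" "\<And>r. s r \<le> length w" "(cstep w ^^ n) (X, s, out) = ([], s', out')"
  shows "length out' \<le> length out + n \<and> (\<exists>m \<le> n * (2 * (length w + length out + n) + 2).
    (astep P ^^ m) (resume X, cellof (prog_regs P) w (s, out), 0) = (Fin, cellof (prog_regs P) w (s', out'), 0))"
  using assms
proof (induction n arbitrary: X s out)
  case (Suc n)
  obtain Y t o1 where step: "cstep w (X, s, out) = (Y, t, o1)" by (metis prod_cases3)
  have run: "(cstep w ^^ n) (Y, t, o1) = ([], s', out')"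
    using Suc.prems(3) step by (simp add: funpow_swap1)
  have Y: "Y \<in> conts_list P []"
    using cstep_next_prog[of w X "(s, out)"] conts_list_closed[OF Suc.prems(1)] step by auto
  have t: "t r \<le> length w" "length o1 \<le> Suc (length out)" for r
    using cstep_bounds[of s w X out Y t o1] Suc.prems(2) step by auto
  from Suc.IH[OF Y t(1) run] obtain m where IH: "length out' \<le> length o1 + n"
    "m \<le> n * (2 * (length w + length o1 + n) + 2)"
    "(astep P ^^ m) (resume Y, cellof (prog_regs P) w (t, o1), 0) = (Fin, cellof (prog_regs P) w (s', out'), 0)"
    by blast
  show ?case
  proof (cases "X = []")
    case True
    then show ?thesis using step IH
      by (auto intro!: exI[of _ m] elim!: le_trans simp: algebra_simps)
  next
    case False
    have "hd_regs X \<subseteq> prog_regs P" using Suc.prems(1) by (auto simp: prog_regs_def)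
    from sim_cstep[OF this Suc.prems(2) False step] obtain k where k: "k \<le> 2 * (length w + length out) + 2"
      "(astep P ^^ k) (Go X False, cellof (prog_regs P) w (s, out), 0) = (resume Y, cellof (prog_regs P) w (t, o1), 0)"
      by blast
    have "(astep P ^^ (m + k)) (resume X, cellof (prog_regs P) w (s, out), 0)
        = (Fin, cellof (prog_regs P) w (s', out'), 0)"
      using False k(2) IH(3) by (simp add: funpow_add del: astep.simps)
    moreover have "m + k \<le> Suc n * (2 * (length w + length out + Suc n) + 2)"
    proof -
      have "n * (2 * (length w + length o1 + n) + 2) \<le> n * (2 * (length w + length out + Suc n) + 2)"
        using t(2) by (intro mult_le_mono2) auto
      then show ?thesis using IH(2) k(1) by simp
    qed
    ultimately show ?thesis using IH(1) t(2) by (auto simp del: astep.simps)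
  qed
qed simp

lemma sim_fin:
  "\<exists>tp. (astep P ^^ Suc (length out)) (Fin, cellof U w (s, out), 0) = (Halt, tp, int (length out))
    \<and> (\<forall>i<length out. tp (int i) = Cell False (Some (out ! i)) {} None)
    \<and> tp (int (length out)) = Cell False None {} None"
proof -
  let ?T = "cellof U w (s, out)" and ?T' = "\<lambda>j. Cell False (Some (out ! nat j)) {} None"
  have "(astep P ^^ length out) (Fin, ?T, 0)
    = (Fin, (\<lambda>j. if 0 \<le> j \<and> j < int (length out) then ?T' j else ?T j), int (length out))"
    by (rule astep_run[where q = "\<lambda>_. Fin"]) (simp add: cellof_def)
  then show ?thesis by (simp add: cellof_def)
qed

text \<open>Starting takes two steps (\<open>Init\<close>, then \<open>Back\<close> on cell 0) and
  finishing takes \<open>Suc (length out)\<close> steps with \<open>length out \<le> n\<close>,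
  whence the summand \<open>n + 3\<close>.\<close>

lemma sim_program:
  assumes "(cstep w ^^ n) (P, (\<lambda>_. 0), []) = ([], s', out)"
  shows "\<exists>m tp h. m \<le> n * (2 * (length w + n) + 2) + n + 3 \<and> (astep P ^^ m) (Init, istape w, 0) = (Halt, tp, h)
    \<and> (\<forall>i<length out. tp (int i) = Cell False (Some (out ! i)) {} None)
    \<and> tp (int (length out)) = Cell False None {} None"
proof -
  let ?U = "prog_regs P"
  have "(istape w)(0 := Cell True (clet (istape w 0)) ?U (cout (istape w 0))) = cellof ?U w ((\<lambda>_. 0), [])"
    by (auto simp: istape_def cellof_def fun_eq_iff)
  then have "astep P (Init, istape w, 0) = (Back P, cellof ?U w ((\<lambda>_. 0), []), 0)" by simp
  moreover have "astep P (Back P, cellof ?U w ((\<lambda>_. 0), []), 0) = (resume P, cellof ?U w ((\<lambda>_. 0), []), 0)"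
    using astep_back[of "cellof ?U w ((\<lambda>_. 0), [])" 0 P P] by (simp add: cellof_simps)
  ultimately have start: "(astep P ^^ 2) (Init, istape w, 0) = (resume P, cellof ?U w ((\<lambda>_. 0), []), 0)"
    by (simp only: numeral_2_eq_2 funpow.simps comp_apply id_apply)
  have "P \<in> conts_list P []" using in_conts_list[of P "[]"] by simp
  from sim_run[OF this _ assms] obtain m where m: "length out \<le> n" "m \<le> n * (2 * (length w + n) + 2)"
    "(astep P ^^ m) (resume P, cellof ?U w ((\<lambda>_. 0), []), 0) = (Fin, cellof ?U w (s', out), 0)"
    by auto
  obtain tp where tp: "(astep P ^^ Suc (length out)) (Fin, cellof ?U w (s', out), 0) = (Halt, tp, int (length out))"
    "\<forall>i<length out. tp (int i) = Cell False (Some (out ! i)) {} None"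
    "tp (int (length out)) = Cell False None {} None"
    using sim_fin[where P = P and U = ?U and w = w and s = s' and out = out] by metis
  have "(astep P ^^ (Suc (length out) + (m + 2))) (Init, istape w, 0) = (Halt, tp, int (length out))"
    by (simp only: funpow_add comp_apply start m(3) tp(1))
  moreover have "Suc (length out) + (m + 2) \<le> n * (2 * (length w + n) + 2) + n + 3" using m by simp
  ultimately show ?thesis using tp by blast
qed

section \<open>Numbering the states and symbols of the abstract machine\<close>

lemma enumeration_extending:
  assumes "finite A" "distinct xs" "set xs \<subseteq> A"
  shows "\<exists>ys. distinct (xs @ ys) \<and> set (xs @ ys) = A"
proof -
  obtain ys where "distinct ys" "set ys = A - set xs" using finite_distinct_list[of "A - set xs"] assms(1) by auto
  then show ?thesis using assms by (intro exI[of _ ys]) auto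
qed

definition code :: "'a list \<Rightarrow> 'a \<Rightarrow> nat" where
  "code xs a = (THE i. i < length xs \<and> xs ! i = a)"

lemma code_nth: "distinct xs \<Longrightarrow> i < length xs \<Longrightarrow> code xs (xs ! i) = i"
  unfolding code_def by (rule the_equality) (auto simp: nth_eq_iff_index_eq)

lemma code_in: "distinct xs \<Longrightarrow> a \<in> set xs \<Longrightarrow> code xs a < length xs \<and> xs ! code xs a = a"
  by (metis code_nth in_set_conv_nth)

definition ctls :: "com list \<Rightarrow> ctl set" where
  "ctls P = {Init, Halt, Fin} \<union> Back ` conts_list P [] \<union> (\<lambda>(K, f). Go K f) ` (conts_list P [] \<times> UNIV)"

definition cells :: "nat set \<Rightarrow> cell set" where
  "cells U = (\<lambda>(s, l, m, ot). Cell s l m ot) ` (UNIV \<times> UNIV \<times> Pow U \<times> UNIV)"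

lemma finite_ctls: "finite (ctls P)"
  by (simp add: ctls_def finite_conts)

lemma finite_cells: "finite U \<Longrightarrow> finite (cells U)"
  by (simp add: cells_def)

lemma in_cells: "a \<in> cells U \<longleftrightarrow> cmarks a \<subseteq> U"
  by (cases a) (auto simp: cells_def image_iff)

lemma sweep_cells: "sweep X f a = (stop, a', f') \<Longrightarrow> hd_regs X \<subseteq> U \<Longrightarrow> cmarks a \<subseteq> U \<Longrightarrow> cmarks a' \<subseteq> U"
proof -
  have op: "sweep_op p f a = (stop, a', f') \<Longrightarrow> op_regs p \<subseteq> U \<Longrightarrow> cmarks a \<subseteq> U \<Longrightarrow> cmarks a' \<subseteq> U" for p
    by (cases p; cases a) (auto split: if_splits)
  have tst: "sweep_tst t f a = (stop, a', f') \<Longrightarrow> cmarks a \<subseteq> U \<Longrightarrow> cmarks a' \<subseteq> U" for t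
    by (cases t; cases a) (auto split: if_splits)
  show "sweep X f a = (stop, a', f') \<Longrightarrow> hd_regs X \<subseteq> U \<Longrightarrow> cmarks a \<subseteq> U \<Longrightarrow> cmarks a' \<subseteq> U"
    using op tst by (cases X rule: hd_regs.cases) auto
qed

lemma delta_closed:
  assumes "q \<in> ctls P" "a \<in> cells (prog_regs P)" "delta P q a = (q', a', d)"
  shows "q' \<in> ctls P" "a' \<in> cells (prog_regs P)" "d \<in> {-1, 0, 1}"
proof -
  have P: "P \<in> conts_list P []" using in_conts_list[of P "[]"] by simp
  have "q' \<in> ctls P \<and> a' \<in> cells (prog_regs P) \<and> d \<in> {-1, 0, 1}"
  proof (cases q)
    case (Go K f)
    then have K: "K \<in> conts_list P []" using assms(1) by (auto simp: ctls_def)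
    then have "hd_regs K \<subseteq> prog_regs P" by (auto simp: prog_regs_def)
    then show ?thesis using assms(2,3) Go K conts_list_closed[OF K] sweep_cells[of K f a]
      by (auto simp: in_cells ctls_def split: prod.splits if_splits)
  qed (use assms P in \<open>auto simp: in_cells ctls_def split: if_splits option.splits\<close>)
  then show "q' \<in> ctls P" "a' \<in> cells (prog_regs P)" "d \<in> {-1, 0, 1}" by auto
qed

text \<open>The enumerations \<open>qs\<close> and \<open>as\<close> begin with the items whose
  numbers are prescribed: start and halting state as 0 and 1, blank and the two bits as 0, 1 and 2.
  The abstract run is then transported along the numbering \<open>ec\<close>.\<close>

theorem tm_of_program:
  fixes P :: "com list"
  shows "\<exists>M. tm_wf M \<and> (\<forall>w n s' out. (cstep w ^^ n) (P, (\<lambda>_. 0), []) = ([], s', out) \<longrightarrow>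
    (\<exists>t \<le> n * (2 * (length w + n) + 2) + n + 3. tm_halts_with M w t out))"
proof -
  let ?U = "prog_regs P"
  let ?c0 = "[Cell False None {} None, Cell False (Some False) {} None, Cell False (Some True) {} None]"
  obtain qs' where qs': "distinct ([Init, Halt] @ qs')" "set ([Init, Halt] @ qs') = ctls P"
    using enumeration_extending[OF finite_ctls, of "[Init, Halt]" P] by (auto simp: ctls_def)
  obtain as' where as': "distinct (?c0 @ as')" "set (?c0 @ as') = cells ?U"
    using enumeration_extending[OF finite_cells[OF finite_prog_regs], of ?c0 P] by (auto simp: in_cells)
  define qs where "qs = [Init, Halt] @ qs'"
  define as where "as = ?c0 @ as'"
  note qs = qs'[folded qs_def] and as = as'[folded as_def]
  define M where "M = \<lparr>tm_states = length qs, tm_syms = length as, tm_delta = (\<lambda>q a.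
    case delta P (qs ! q) (as ! a) of (q', a', d) \<Rightarrow> (code qs q', code as a', d))\<rparr>"
  have code_q: "code qs Init = 0" "code qs Halt = 1"
    using code_nth[OF qs(1), of 0] code_nth[OF qs(1), of 1] by (auto simp: qs_def)
  have code_a: "code as (Cell False None {} None) = 0" "code as (Cell False (Some False) {} None) = 1"
    "code as (Cell False (Some True) {} None) = 2"
    using code_nth[OF as(1), of 0] code_nth[OF as(1), of 1] code_nth[OF as(1), of 2] by (auto simp: as_def)
  have in_q: "code qs q < length qs" "qs ! code qs q = q" if "q \<in> ctls P" for q
    using code_in[OF qs(1)] that qs(2) by auto
  have in_a: "code as a < length as" "as ! code as a = a" if "a \<in> cells ?U" for a
    using code_in[OF as(1)] that as(2) by auto
  have wf: "tm_wf M"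
  proof -
    have "code qs q' < length qs \<and> code as a' < length as \<and> d \<in> {-1, 0, 1}"
      if "i < length qs" "j < length as" "delta P (qs ! i) (as ! j) = (q', a', d)" for i j q' a' d
    proof -
      have "qs ! i \<in> ctls P" "as ! j \<in> cells ?U" using that(1,2) qs(2) as(2) nth_mem by blast+
      from delta_closed[OF this that(3)] show ?thesis using in_q(1) in_a(1) by blast
    qed
    then show ?thesis by (auto simp: tm_wf_def M_def qs_def as_def split: prod.splits)
  qed
  define ec :: "aconf \<Rightarrow> config" where "ec = (\<lambda>(q, tp, h). (code qs q, code as \<circ> tp, h))"
  have step: "tm_step M (ec c) = ec (astep P c) \<and> fst (astep P c) \<in> ctls P \<and> (\<forall>i. fst (snd (astep P c)) i \<in> cells ?U)"
    if "fst c \<in> ctls P" "\<forall>i. fst (snd c) i \<in> cells ?U" for c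
  proof -
    obtain q tp h where c: "c = (q, tp, h)" by (metis prod_cases3)
    obtain q' a' d where d: "delta P q (tp h) = (q', a', d)" by (metis prod_cases3)
    have q: "q \<in> ctls P" "tp h \<in> cells ?U" using that by (auto simp: c)
    \<comment> \<open>\<open>tm_step\<close> freezes state 1, whereas \<open>astep\<close> keeps
      applying \<open>delta\<close>, which is the identity on \<open>Halt\<close>; both agree
      because only \<open>Halt\<close> has number 1.\<close>
    have [simp]: "code qs q = Suc 0 \<longleftrightarrow> q = Halt"
      using in_q(2)[OF q(1)] code_q(2) by (auto simp: qs_def)
    have eq: "(code as \<circ> tp)(h := code as a') = code as \<circ> tp(h := a')" by auto
    show ?thesis using that delta_closed[OF q d] d in_q[OF q(1)] in_a[OF q(2)]
      by (auto simp: c ec_def tm_step_def M_def eq fun_upd_idem)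
  qed
  have run: "(tm_step M ^^ m) (ec c) = ec ((astep P ^^ m) c)"
    if "fst c \<in> ctls P" "\<forall>i. fst (snd c) i \<in> cells ?U" for m c
    using that
  proof (induction m arbitrary: c)
    case (Suc m)
    from step[OF Suc.prems] have "(tm_step M ^^ m) (ec (astep P c)) = ec ((astep P ^^ m) (astep P c))"
      by (intro Suc.IH) auto
    then show ?case using step[OF Suc.prems] by (simp only: funpow_Suc_right comp_apply)
  qed simp
  have init: "tm_init w = ec (Init, istape w, 0)" for w
    by (auto simp: tm_init_def ec_def code_q code_a istape_def sym_of_bit_def fun_eq_iff)
  have "\<exists>t \<le> n * (2 * (length w + n) + 2) + n + 3. tm_halts_with M w t out"
    if asm: "(cstep w ^^ n) (P, (\<lambda>_. 0), []) = ([], s', out)" for w n s' out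
  proof -
    obtain m tp h where m: "m \<le> n * (2 * (length w + n) + 2) + n + 3"
      "(astep P ^^ m) (Init, istape w, 0) = (Halt, tp, h)"
      "\<forall>i<length out. tp (int i) = Cell False (Some (out ! i)) {} None"
      "tp (int (length out)) = Cell False None {} None"
      using sim_program[OF asm] by blast
    have "tm_run M m w = ec (Halt, tp, h)"
      using run[of "(Init, istape w, 0)" m] m(2) by (simp add: tm_run_def init ctls_def in_cells istape_def)
    then have "tm_halts_with M w m out"
      using m(3,4) by (auto simp: tm_halts_with_def ec_def code_q code_a sym_of_bit_def)
    then show ?thesis using m(1) by blast
  qed
  then show ?thesis using wf by blast
qed

subsection \<open>Bounded primitive recursion and loop generators\<close>

text \<open>Numeric terms range over [0, N] for N the input length (successor saturates at N), so that every
  closed term is automatically computed in polynomial time. Variables are de Bruijn indices; the body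
  of \<open>Rec\<close> binds the loop index (0) and the accumulator (1).\<close>

datatype trm = V nat | Zr | Tp | Sc trm | Bt trm | Cond trm trm trm trm | Rec trm trm trm
datatype gen = E "bool list" | Sq gen gen | Gif trm trm gen gen | Gfor trm gen

definition sc :: "bool list \<Rightarrow> nat \<Rightarrow> nat" where
  "sc w x = (if x < length w then Suc x else x)"

definition bitat :: "bool list \<Rightarrow> nat \<Rightarrow> bool" where
  "bitat w x \<longleftrightarrow> x < length w \<and> w ! x"

primrec eval :: "bool list \<Rightarrow> trm \<Rightarrow> (nat \<Rightarrow> nat) \<Rightarrow> nat" where
  "eval w (V i) e = e i"
| "eval w Zr e = 0"
| "eval w Tp e = length w"
| "eval w (Sc t) e = sc w (eval w t e)"
| "eval w (Bt t) e = of_bool (bitat w (eval w t e))"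
| "eval w (Cond a b c d) e = (if eval w a e = eval w b e then eval w c e else eval w d e)"
| "eval w (Rec c b z) e = rec_nat (eval w z e) (\<lambda>i v. eval w b (case_nat i (case_nat v e))) (eval w c e)"

primrec geval :: "bool list \<Rightarrow> gen \<Rightarrow> (nat \<Rightarrow> nat) \<Rightarrow> bool list" where
  "geval w (E bs) e = bs"
| "geval w (Sq g h) e = geval w g e @ geval w h e"
| "geval w (Gif a b g h) e = (if eval w a e = eval w b e then geval w g e else geval w h e)"
| "geval w (Gfor c g) e = concat (map (\<lambda>i. geval w g (case_nat i e)) [0..<eval w c e])"

text \<open>\<open>\<eta>\<close> assigns registers to the variables; registers from \<open>n\<close> on are free and \<open>n\<close> receives the value.\<close>

primrec compile :: "trm \<Rightarrow> (nat \<Rightarrow> nat) \<Rightarrow> nat \<Rightarrow> com list" where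
  "compile (V i) \<eta> n = [Op (CopyOp n (\<eta> i))]"
| "compile Zr \<eta> n = [Op (ZeroOp n)]"
| "compile Tp \<eta> n = [Op (TopOp n)]"
| "compile (Sc t) \<eta> n = compile t \<eta> n @ [Op (IncOp n)]"
| "compile (Bt t) \<eta> n = compile t \<eta> n @ [IfC (IsBit n) [Op (ZeroOp n), Op (IncOp n)] [Op (ZeroOp n)]]"
| "compile (Cond a b c d) \<eta> n = compile a \<eta> n @ compile b \<eta> (Suc n) @ [IfC (IsEq n (Suc n)) (compile c \<eta> n) (compile d \<eta> n)]"
| "compile (Rec c b z) \<eta> n = compile z \<eta> n @ compile c \<eta> (Suc n) @ [Op (ZeroOp (n + 2)),
    Until (IsEq (n + 2) (Suc n)) (compile b (case_nat (n + 2) (case_nat n \<eta>)) (n + 3)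
      @ [Op (CopyOp n (n + 3)), Op (IncOp (n + 2))])]"

primrec gcompile :: "gen \<Rightarrow> (nat \<Rightarrow> nat) \<Rightarrow> nat \<Rightarrow> com list" where
  "gcompile (E bs) \<eta> n = map (\<lambda>b. Op (EmitOp b)) bs"
| "gcompile (Sq g h) \<eta> n = gcompile g \<eta> n @ gcompile h \<eta> n"
| "gcompile (Gif a b g h) \<eta> n = compile a \<eta> n @ compile b \<eta> (Suc n) @ [IfC (IsEq n (Suc n)) (gcompile g \<eta> n) (gcompile h \<eta> n)]"
| "gcompile (Gfor c g) \<eta> n = compile c \<eta> n @ [Op (ZeroOp (Suc n)),
    Until (IsEq (Suc n) n) (gcompile g (case_nat (Suc n) \<eta>) (n + 2) @ [Op (IncOp (Suc n))])]"

text \<open>Loop bounds are values in [0, N], so a loop is charged \<open>N\<close> rounds, and a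
  conditional is charged both branches. For a fixed term this is a polynomial in
  \<open>N\<close>.\<close>

primrec cost :: "nat \<Rightarrow> trm \<Rightarrow> nat" where
  "cost N (V i) = 1"
| "cost N Zr = 1"
| "cost N Tp = 1"
| "cost N (Sc t) = cost N t + 1"
| "cost N (Bt t) = cost N t + 4"
| "cost N (Cond a b c d) = cost N a + (cost N b + (1 + (cost N c + cost N d)))"
| "cost N (Rec c b z) = cost N z + (cost N c + (1 + (N * (1 + (cost N b + 2)) + 1)))"

primrec gcost :: "nat \<Rightarrow> gen \<Rightarrow> nat" where
  "gcost N (E bs) = length bs"
| "gcost N (Sq g h) = gcost N g + gcost N h"
| "gcost N (Gif a b g h) = cost N a + (cost N b + (1 + (gcost N g + gcost N h)))"
| "gcost N (Gfor c g) = cost N c + (1 + (N * (1 + (gcost N g + 1)) + 1))"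

section \<open>Execution within a step budget and correctness of the compilers\<close>

definition runs :: "bool list \<Rightarrow> nat \<Rightarrow> com list \<times> store \<Rightarrow> com list \<times> store \<Rightarrow> bool" where
  "runs w n c c' \<longleftrightarrow> (\<exists>m\<le>n. (cstep w ^^ m) c = c')"

lemma runs_trans:
  assumes "runs w m a b" "runs w n b c"
  shows "runs w (m + n) a c"
proof -
  obtain i j where "i \<le> m" "(cstep w ^^ i) a = b" "j \<le> n" "(cstep w ^^ j) b = c"
    using assms unfolding runs_def by blast
  then show ?thesis unfolding runs_def
    by (intro exI[of _ "j + i"]) (simp add: funpow_add)
qed

lemma runs_refl: "runs w n a a"
  unfolding runs_def by (rule exI[of _ 0]) simp

lemma runs_step: "cstep w a = b \<Longrightarrow> runs w 1 a b"
  unfolding runs_def by (rule exI[of _ 1]) simp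

lemma runs_Cons: "runs w n (cstep w a) b \<Longrightarrow> runs w (Suc n) a b"
  using runs_trans[OF runs_step[OF refl]] by (metis plus_1_eq_Suc)

lemma runs_mono: "runs w m a b \<Longrightarrow> m \<le> n \<Longrightarrow> runs w n a b"
  unfolding runs_def using le_trans by blast

text \<open>Quantifying over the continuation \<open>K\<close> and the output written so far makes the judgement compositional.\<close>

definition does :: "bool list \<Rightarrow> nat \<Rightarrow> com list \<Rightarrow> nat \<Rightarrow> (nat \<Rightarrow> nat) \<Rightarrow> ((nat \<Rightarrow> nat) \<Rightarrow> bool) \<Rightarrow> bool list \<Rightarrow> bool" where
  "does w m P n s R v \<longleftrightarrow> ((\<forall>r. s r \<le> length w) \<longrightarrow> (\<forall>K out. \<exists>s'. runs w m (P @ K, s, out) (K, s', out @ v)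
    \<and> R s' \<and> (\<forall>r<n. s' r = s r) \<and> (\<forall>r. s' r \<le> length w)))"

lemma doesD:
  assumes "does w m P n s R v" "\<forall>r. s r \<le> length w"
  shows "\<exists>s'. runs w m (P @ K, s, out) (K, s', out @ v) \<and> R s' \<and> (\<forall>r<n. s' r = s r) \<and> (\<forall>r. s' r \<le> length w)"
  using assms[unfolded does_def] by simp

lemma does_seq:
  assumes 1: "does w m P n s R v"
    and 2: "\<And>s1. R s1 \<Longrightarrow> \<forall>r<n. s1 r = s r \<Longrightarrow> \<forall>r. s1 r \<le> length w \<Longrightarrow> does w m' P' n s1 R' v'"
  shows "does w (m + m') (P @ P') n s R' (v @ v')"
  unfolding does_def
proof (intro impI allI)
  fix K out assume s: "\<forall>r. s r \<le> length w"
  obtain s1 where s1: "runs w m (P @ P' @ K, s, out) (P' @ K, s1, out @ v)" "R s1" "\<forall>r<n. s1 r = s r" "\<forall>r. s1 r \<le> length w"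
    using doesD[OF 1 s, of "P' @ K" out] by blast
  obtain s2 where s2: "runs w m' (P' @ K, s1, out @ v) (K, s2, (out @ v) @ v')" "R' s2" "\<forall>r<n. s2 r = s1 r"
    "\<forall>r. s2 r \<le> length w"
    using doesD[OF 2[OF s1(2-4)] s1(4), of K "out @ v"] by blast
  show "\<exists>s'. runs w (m + m') ((P @ P') @ K, s, out) (K, s', out @ v @ v') \<and> R' s' \<and> (\<forall>r<n. s' r = s r) \<and> (\<forall>r. s' r \<le> length w)"
    using runs_trans[OF s1(1) s2(1)] s1(3) s2(2-) by (intro exI[of _ s2]) simp
qed

lemmas does_seq0 = does_seq[where v = "[]", unfolded append_Nil]

lemma does_mono: "does w m P n s R v \<Longrightarrow> m \<le> m' \<Longrightarrow> does w m' P n s R v"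
  unfolding does_def using runs_mono by meson

lemma does_frame: "does w m P n' s R v \<Longrightarrow> n \<le> n' \<Longrightarrow> does w m P n s (\<lambda>s'. R s' \<and> (\<forall>r<n'. s' r = s r)) v"
  unfolding does_def by (meson less_le_trans)

lemma does_Nil: "R s \<Longrightarrow> does w m [] n s R []"
  unfolding does_def by (auto intro: runs_refl)

lemma does_op:
  assumes "\<And>out. exec_op w p (s, out) = (s(r := x), out)" "n \<le> r" "(\<forall>r. s r \<le> length w) \<Longrightarrow> x \<le> length w" "R (s(r := x))"
  shows "does w 1 [Op p] n s R []"
  unfolding does_def
proof (intro impI allI exI conjI)
  show "runs w 1 ([Op p] @ K, s, out) (K, s(r := x), out @ [])" for K out by (rule runs_step) (simp add: assms(1))
qed (use assms in auto)

lemma does_if: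
  assumes "holds w t s \<Longrightarrow> does w m P n s R v" "\<not> holds w t s \<Longrightarrow> does w m' P' n s R v"
  shows "does w (1 + (m + m')) [IfC t P P'] n s R v"
  unfolding does_def
proof (intro impI allI)
  fix K out assume s: "\<forall>r. s r \<le> length w"
  let ?P = "if holds w t s then P else P'"
  have "does w (m + m') ?P n s R v" using assms by (auto intro: does_mono)
  from doesD[OF this s, of K out] obtain s' where s': "runs w (m + m') (?P @ K, s, out) (K, s', out @ v)" "R s'"
    "\<forall>r<n. s' r = s r" "\<forall>r. s' r \<le> length w" by blast
  have "runs w 1 ([IfC t P P'] @ K, s, out) (?P @ K, s, out)" by (rule runs_step) simp
  from runs_trans[OF this s'(1)] s'(2-)
  show "\<exists>s'. runs w (1 + (m + m')) ([IfC t P P'] @ K, s, out) (K, s', out @ v) \<and> R s' \<and> (\<forall>r<n. s' r = s r) \<and> (\<forall>r. s' r \<le> length w)"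
    by blast
qed

lemma does_until:
  assumes "holds w t s \<Longrightarrow> R s \<and> v = []" "\<not> holds w t s \<Longrightarrow> does w m (P @ [Until t P]) n s R v"
  shows "does w (1 + m) [Until t P] n s R v"
  unfolding does_def
proof (intro impI allI)
  fix K out assume s: "\<forall>r. s r \<le> length w"
  let ?P = "if holds w t s then [] else P @ [Until t P]"
  have "does w m ?P n s R v" using assms by (auto intro: does_Nil)
  from doesD[OF this s, of K out] obtain s' where s': "runs w m (?P @ K, s, out) (K, s', out @ v)" "R s'"
    "\<forall>r<n. s' r = s r" "\<forall>r. s' r \<le> length w" by blast
  have "runs w 1 ([Until t P] @ K, s, out) (?P @ K, s, out)" by (rule runs_step) simp
  from runs_trans[OF this s'(1)] s'(2-)
  show "\<exists>s'. runs w (1 + m) ([Until t P] @ K, s, out) (K, s', out @ v) \<and> R s' \<and> (\<forall>r<n. s' r = s r) \<and> (\<forall>r. s' r \<le> length w)"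
    by blast
qed

lemma env_frame: "\<forall>i. \<eta> i < (n::nat) \<Longrightarrow> \<forall>r<n. s' r = s r \<Longrightarrow> (\<lambda>i. s' (\<eta> i)) = (\<lambda>i. s (\<eta> i))"
  by auto

text \<open>\<open>j\<close> counts the remaining rounds.\<close>

lemma does_loop:
  assumes body: "\<And>i s1. i < k \<Longrightarrow> I i s1 \<Longrightarrow> \<forall>r<n. s1 r = s r \<Longrightarrow> \<forall>r. s1 r \<le> length w \<Longrightarrow> s1 c = i \<Longrightarrow> s1 l = k \<Longrightarrow>
      does w m P n s1 (\<lambda>s2. I (Suc i) s2 \<and> s2 c = Suc i \<and> s2 l = k) (f i)"
    and s1: "j \<le> k" "I (k - j) s1" "s1 c = k - j" "s1 l = k" "\<forall>r<n. s1 r = s r" "\<forall>r. s1 r \<le> length w"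
  shows "does w (j * (1 + m) + 1) [Until (IsEq c l) P] n s1 (I k) (concat (map f [k - j..<k]))"
  using s1
proof (induction j arbitrary: s1)
  case 0
  then show ?case using does_until[of w "IsEq c l" s1 "I k" "[]" 0 P n] by simp
next
  case (Suc j)
  let ?i = "k - Suc j"
  have i: "?i < k" "Suc ?i = k - j" using Suc.prems(1) by auto
  have "does w (m + (j * (1 + m) + 1)) (P @ [Until (IsEq c l) P]) n s1 (I k) (f ?i @ concat (map f [k - j..<k]))"
  proof (rule does_seq[OF body[OF i(1) Suc.prems(2,5,6,3,4)]])
    fix s2 assume "I (Suc ?i) s2 \<and> s2 c = Suc ?i \<and> s2 l = k" "\<forall>r<n. s2 r = s1 r" "\<forall>r. s2 r \<le> length w"
    then show "does w (j * (1 + m) + 1) [Until (IsEq c l) P] n s2 (I k) (concat (map f [k - j..<k]))"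
      using Suc.prems(1,5) i(2) by (intro Suc.IH) auto
  qed
  moreover have "f ?i @ concat (map f [k - j..<k]) = concat (map f [?i..<k])"
    using i by (simp add: upt_conv_Cons)
  ultimately have "does w (1 + (m + (j * (1 + m) + 1))) [Until (IsEq c l) P] n s1 (I k) (concat (map f [?i..<k]))"
    using Suc.prems(3,4) i(1) by (intro does_until) auto
  then show ?case by (rule does_mono) simp
qed

text \<open>For \<open>Rec\<close>, register \<open>n\<close> holds the accumulator,
  \<open>Suc n\<close> the bound, \<open>n + 2\<close> the index and \<open>n + 3\<close> the value
  of the body. The index is incremented only below the bound, hence without saturation.\<close>

lemma compile_does:
  "\<forall>i. \<eta> i < n \<Longrightarrow> does w (cost (length w) t) (compile t \<eta> n) n s (\<lambda>s'. s' n = eval w t (\<lambda>i. s (\<eta> i))) []"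
proof (induction t arbitrary: \<eta> n s)
  case (V i)
  show ?case unfolding compile.simps cost.simps by (rule does_op[where r = n and x = "s (\<eta> i)"]) auto
next
  case Zr
  show ?case unfolding compile.simps cost.simps by (rule does_op[where r = n and x = 0]) auto
next
  case Tp
  show ?case unfolding compile.simps cost.simps by (rule does_op[where r = n and x = "length w"]) auto
next
  case (Sc t)
  show ?case unfolding compile.simps cost.simps
  proof (rule does_seq0[OF Sc.IH[OF Sc.prems]])
    fix s1 assume s1: "s1 n = eval w t (\<lambda>i. s (\<eta> i))" "\<forall>r. s1 r \<le> length w"
    have "sc w (s1 n) \<le> length w" using s1(2) by (auto simp: sc_def)
    then show "does w 1 [Op (IncOp n)] n s1 (\<lambda>s'. s' n = eval w (Sc t) (\<lambda>i. s (\<eta> i))) []"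
      using s1(1) by (intro does_op[where r = n and x = "sc w (s1 n)"]) (auto simp: sc_def)
  qed
next
  case (Bt t)
  show ?case unfolding compile.simps cost.simps
  proof (rule does_seq0[OF Bt.IH[OF Bt.prems]])
    fix s1 assume s1: "s1 n = eval w t (\<lambda>i. s (\<eta> i))"
    let ?R = "\<lambda>s'. s' n = eval w (Bt t) (\<lambda>i. s (\<eta> i))"
    have "does w (1 + ((1 + 1) + 1)) [IfC (IsBit n) ([Op (ZeroOp n)] @ [Op (IncOp n)]) [Op (ZeroOp n)]] n s1 ?R []"
    proof (rule does_if)
      assume h: "holds w (IsBit n) s1"
      show "does w (1 + 1) ([Op (ZeroOp n)] @ [Op (IncOp n)]) n s1 ?R []"
      proof (rule does_seq0[where R = "\<lambda>s2. s2 n = 0"])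
        show "does w 1 [Op (ZeroOp n)] n s1 (\<lambda>s2. s2 n = 0) []" by (rule does_op[where r = n and x = 0]) auto
        show "does w 1 [Op (IncOp n)] n s2 ?R []" if "s2 n = 0" for s2
          using that h s1 by (intro does_op[where r = n and x = 1]) (auto simp: bitat_def)
      qed
    next
      assume "\<not> holds w (IsBit n) s1"
      then show "does w 1 [Op (ZeroOp n)] n s1 ?R []"
        using s1 by (intro does_op[where r = n and x = 0]) (auto simp: bitat_def)
    qed
    then show "does w 4 [IfC (IsBit n) [Op (ZeroOp n), Op (IncOp n)] [Op (ZeroOp n)]] n s1 ?R []"
      unfolding append.simps by (rule does_mono) simp
  qed
next
  case (Cond a b c d)
  have \<eta>1: "\<forall>i. \<eta> i < Suc n" using Cond.prems less_SucI by blast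
  show ?case unfolding compile.simps cost.simps
  proof (rule does_seq0[OF Cond.IH(1)[OF Cond.prems]], rule does_seq0[OF does_frame[OF Cond.IH(2)[OF \<eta>1]]])
    fix s1 s2 assume s1: "s1 n = eval w a (\<lambda>i. s (\<eta> i))" "\<forall>r<n. s1 r = s r"
      and s2: "s2 (Suc n) = eval w b (\<lambda>i. s1 (\<eta> i)) \<and> (\<forall>r<Suc n. s2 r = s1 r)" "\<forall>r<n. s2 r = s1 r"
    have e: "(\<lambda>i. s1 (\<eta> i)) = (\<lambda>i. s (\<eta> i))" "(\<lambda>i. s2 (\<eta> i)) = (\<lambda>i. s1 (\<eta> i))"
      using env_frame[OF Cond.prems] s1(2) s2(2) by blast+
    have "s2 n = s1 n" using s2(1) by simp
    then show "does w (1 + (cost (length w) c + cost (length w) d)) [IfC (IsEq n (Suc n)) (compile c \<eta> n) (compile d \<eta> n)] n s2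
      (\<lambda>s'. s' n = eval w (Cond a b c d) (\<lambda>i. s (\<eta> i))) []"
      using s1(1) s2(1) Cond.IH(3,4)[OF Cond.prems, of s2] e by (intro does_if) auto
  qed simp
next
  case (Rec c b z)
  have \<eta>1: "\<forall>i. \<eta> i < Suc n" using Rec.prems less_SucI by blast
  let ?e = "\<lambda>i. s (\<eta> i)" and ?\<eta> = "case_nat (n + 2) (case_nat n \<eta>)"
  let ?P = "compile b ?\<eta> (n + 3) @ [Op (CopyOp n (n + 3)), Op (IncOp (n + 2))]"
  let ?f = "rec_nat (eval w z ?e) (\<lambda>i v. eval w b (case_nat i (case_nat v ?e)))"
  show ?case unfolding compile.simps cost.simps
  proof (rule does_seq0[OF Rec.IH(3)[OF Rec.prems]], rule does_seq0[OF does_frame[OF Rec.IH(1)[OF \<eta>1]]])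
    fix s1 s2 assume s1: "s1 n = eval w z ?e" "\<forall>r<n. s1 r = s r"
      and s2: "s2 (Suc n) = eval w c (\<lambda>i. s1 (\<eta> i)) \<and> (\<forall>r<Suc n. s2 r = s1 r)" "\<forall>r<n. s2 r = s1 r" "\<forall>r. s2 r \<le> length w"
    let ?k = "s2 (Suc n)"
    have e: "(\<lambda>i. s1 (\<eta> i)) = ?e" using env_frame[OF Rec.prems s1(2)] .
    let ?t = "s2(n + 2 := 0)"
    have k: "?k \<le> length w" using s2(3) by blast
    have "does w (?k * (1 + (cost (length w) b + (1 + 1))) + 1) [Until (IsEq (n + 2) (Suc n)) ?P] n ?t (\<lambda>s'. s' n = ?f ?k)
      (concat (map (\<lambda>_. []) [?k - ?k..<?k]))"
    proof (rule does_loop[where I = "\<lambda>i s'. s' n = ?f i" and s = s])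
      fix i s3 assume s3: "s3 n = ?f i" "\<forall>r<n. s3 r = s r" "s3 (n + 2) = i" "s3 (Suc n) = ?k" and i: "i < ?k"
      have \<eta>3: "\<forall>i. ?\<eta> i < n + 3" using Rec.prems by (auto split: nat.split intro: less_trans)
      have e3: "(\<lambda>j. s3 (?\<eta> j)) = case_nat i (case_nat (?f i) ?e)"
        using s3 Rec.prems by (auto simp: fun_eq_iff split: nat.split)
      have "does w (cost (length w) b + (1 + 1)) (compile b ?\<eta> (n + 3) @ [Op (CopyOp n (n + 3))] @ [Op (IncOp (n + 2))]) n s3
        (\<lambda>s2. s2 n = ?f (Suc i) \<and> s2 (n + 2) = Suc i \<and> s2 (Suc n) = ?k) []"
      proof (rule does_seq0[OF does_frame[OF Rec.IH(2)[OF \<eta>3]]])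
        fix s4 assume s4: "s4 (n + 3) = eval w b (\<lambda>j. s3 (?\<eta> j)) \<and> (\<forall>r<n + 3. s4 r = s3 r)" "\<forall>r. s4 r \<le> length w"
        show "does w (1 + 1) ([Op (CopyOp n (n + 3))] @ [Op (IncOp (n + 2))]) n s4
          (\<lambda>s2. s2 n = ?f (Suc i) \<and> s2 (n + 2) = Suc i \<and> s2 (Suc n) = ?k) []"
        proof (rule does_seq0[where R = "\<lambda>s5. s5 n = ?f (Suc i) \<and> s5 (n + 2) = i \<and> s5 (Suc n) = ?k"])
          show "does w 1 [Op (CopyOp n (n + 3))] n s4 (\<lambda>s5. s5 n = ?f (Suc i) \<and> s5 (n + 2) = i \<and> s5 (Suc n) = ?k) []"
            using s3 s4 e3 spec[OF s4(2), of "n + 3"] by (intro does_op[where r = n and x = "s4 (n + 3)"]) auto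
          show "does w 1 [Op (IncOp (n + 2))] n s5 (\<lambda>s2. s2 n = ?f (Suc i) \<and> s2 (n + 2) = Suc i \<and> s2 (Suc n) = ?k) []"
            if "s5 n = ?f (Suc i) \<and> s5 (n + 2) = i \<and> s5 (Suc n) = ?k" for s5
            using that i k by (intro does_op[where r = "n + 2" and x = "Suc i"]) auto
        qed
      qed simp
      then show "does w (cost (length w) b + (1 + 1)) ?P n s3
        (\<lambda>s2. s2 n = ?f (Suc i) \<and> s2 (n + 2) = Suc i \<and> s2 (Suc n) = ?k) []" by simp
    qed (use s1 s2 k in auto)
    then have loop: "does w (length w * (1 + (cost (length w) b + 2)) + 1) [Until (IsEq (n + 2) (Suc n)) ?P] n ?t (\<lambda>s'. s' n = ?f ?k) []"
      using mult_le_mono1[OF k, of "1 + (cost (length w) b + 2)"] by (auto simp: map_replicate_const elim!: does_mono)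
    have "does w (1 + (length w * (1 + (cost (length w) b + 2)) + 1))
      ([Op (ZeroOp (n + 2))] @ [Until (IsEq (n + 2) (Suc n)) ?P]) n s2 (\<lambda>s'. s' n = ?f ?k) []"
    proof (rule does_seq0[where R = "\<lambda>s'. s' = ?t"])
      show "does w 1 [Op (ZeroOp (n + 2))] n s2 (\<lambda>s'. s' = ?t) []" by (rule does_op[where r = "n + 2" and x = 0]) auto
    qed (use loop in simp)
    then show "does w (1 + (length w * (1 + (cost (length w) b + 2)) + 1)) [Op (ZeroOp (n + 2)), Until (IsEq (n + 2) (Suc n)) ?P] n s2
      (\<lambda>s'. s' n = eval w (Rec c b z) ?e) []" using s2(1) e by simp
  qed simp
qed

lemma does_emit: "does w (length bs) (map (\<lambda>b. Op (EmitOp b)) bs) n s (\<lambda>_. True) bs"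
proof -
  have "runs w (length bs) (map (\<lambda>b. Op (EmitOp b)) bs @ K, s, out) (K, s, out @ bs)" for K out
  proof (induction bs arbitrary: out)
    case (Cons b bs)
    have "runs w (Suc (length bs)) (Op (EmitOp b) # map (\<lambda>b. Op (EmitOp b)) bs @ K, s, out) (K, s, out @ b # bs)"
      by (rule runs_Cons) (use Cons.IH[of "out @ [b]"] in simp)
    then show ?case by simp
  qed (simp add: runs_refl)
  then show ?thesis unfolding does_def by blast
qed

lemma gcompile_does:
  "\<forall>i. \<eta> i < n \<Longrightarrow> does w (gcost (length w) g) (gcompile g \<eta> n) n s (\<lambda>_. True) (geval w g (\<lambda>i. s (\<eta> i)))"
proof (induction g arbitrary: \<eta> n s)
  case (E bs)
  show ?case by (simp add: does_emit)
next
  case (Sq g h)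
  show ?case unfolding gcompile.simps gcost.simps geval.simps
  proof (rule does_seq[OF Sq.IH(1)[OF Sq.prems]])
    fix s1 assume f: "\<forall>r<n. s1 r = s r"
    show "does w (gcost (length w) h) (gcompile h \<eta> n) n s1 (\<lambda>_. True) (geval w h (\<lambda>i. s (\<eta> i)))"
      using Sq.IH(2)[OF Sq.prems, of s1] unfolding env_frame[OF Sq.prems f] .
  qed
next
  case (Gif a b g h)
  have \<eta>1: "\<forall>i. \<eta> i < Suc n" using Gif.prems less_SucI by blast
  show ?case unfolding gcompile.simps gcost.simps
  proof (rule does_seq0[OF compile_does[OF Gif.prems]], rule does_seq0[OF does_frame[OF compile_does[OF \<eta>1]]])
    fix s1 s2 assume s1: "s1 n = eval w a (\<lambda>i. s (\<eta> i))" "\<forall>r<n. s1 r = s r"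
      and s2: "s2 (Suc n) = eval w b (\<lambda>i. s1 (\<eta> i)) \<and> (\<forall>r<Suc n. s2 r = s1 r)" "\<forall>r<n. s2 r = s1 r"
    have e: "(\<lambda>i. s1 (\<eta> i)) = (\<lambda>i. s (\<eta> i))" "(\<lambda>i. s2 (\<eta> i)) = (\<lambda>i. s1 (\<eta> i))"
      using env_frame[OF Gif.prems] s1(2) s2(2) by blast+
    have "s2 n = s1 n" using s2(1) by simp
    then show "does w (1 + (gcost (length w) g + gcost (length w) h)) [IfC (IsEq n (Suc n)) (gcompile g \<eta> n) (gcompile h \<eta> n)] n s2
      (\<lambda>_. True) (geval w (Gif a b g h) (\<lambda>i. s (\<eta> i)))"
      using s1(1) s2(1) Gif.IH[OF Gif.prems, of s2] e by (intro does_if) auto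
  qed simp
next
  case (Gfor c g)
  let ?e = "\<lambda>i. s (\<eta> i)" and ?\<eta> = "case_nat (Suc n) \<eta>"
  let ?P = "gcompile g ?\<eta> (n + 2) @ [Op (IncOp (Suc n))]"
  let ?f = "\<lambda>i. geval w g (case_nat i ?e)"
  show ?case unfolding gcompile.simps gcost.simps
  proof (rule does_seq0[OF compile_does[OF Gfor.prems]])
    fix s1 assume s1: "s1 n = eval w c ?e" "\<forall>r<n. s1 r = s r" "\<forall>r. s1 r \<le> length w"
    let ?k = "s1 n" and ?t = "s1(Suc n := 0)"
    have k: "?k \<le> length w" using s1(3) by blast
    have "does w (?k * (1 + (gcost (length w) g + 1)) + 1) [Until (IsEq (Suc n) n) ?P] n ?t (\<lambda>s'. True)
      (concat (map ?f [?k - ?k..<?k]))"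
    proof (rule does_loop[where I = "\<lambda>i s'. True" and s = s])
      fix i s3 assume s3: "\<forall>r<n. s3 r = s r" "s3 (Suc n) = i" "s3 n = ?k" and i: "i < ?k"
      have \<eta>2: "\<forall>i. ?\<eta> i < n + 2" using Gfor.prems by (auto split: nat.split intro: less_trans)
      have e3: "(\<lambda>j. s3 (?\<eta> j)) = case_nat i ?e" using s3 Gfor.prems by (auto simp: fun_eq_iff split: nat.split)
      have "does w (gcost (length w) g + 1) ?P n s3 (\<lambda>s2. True \<and> s2 (Suc n) = Suc i \<and> s2 n = ?k) (?f i @ [])"
      proof (rule does_seq[OF does_frame[OF Gfor.IH[OF \<eta>2, of s3, unfolded e3]]])
        fix s4 assume "True \<and> (\<forall>r<n + 2. s4 r = s3 r)"
        then show "does w 1 [Op (IncOp (Suc n))] n s4 (\<lambda>s2. True \<and> s2 (Suc n) = Suc i \<and> s2 n = ?k) []"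
          using s3 i k by (intro does_op[where r = "Suc n" and x = "Suc i"]) auto
      qed simp
      then show "does w (gcost (length w) g + 1) ?P n s3 (\<lambda>s2. True \<and> s2 (Suc n) = Suc i \<and> s2 n = ?k) (?f i)" by simp
    qed (use s1 k in auto)
    then have loop: "does w (length w * (1 + (gcost (length w) g + 1)) + 1) [Until (IsEq (Suc n) n) ?P] n ?t (\<lambda>s'. True)
      (geval w (Gfor c g) ?e)"
      using mult_le_mono1[OF k, of "1 + (gcost (length w) g + 1)"] s1(1) by (auto elim!: does_mono)
    have "does w (1 + (length w * (1 + (gcost (length w) g + 1)) + 1))
      ([Op (ZeroOp (Suc n))] @ [Until (IsEq (Suc n) n) ?P]) n s1 (\<lambda>s'. True) (geval w (Gfor c g) ?e)"
    proof (rule does_seq0[where R = "\<lambda>s'. s' = ?t"])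
      show "does w 1 [Op (ZeroOp (Suc n))] n s1 (\<lambda>s'. s' = ?t) []" by (rule does_op[where r = "Suc n" and x = 0]) auto
    qed (use loop in simp)
    then show "does w (1 + (length w * (1 + (gcost (length w) g + 1)) + 1)) [Op (ZeroOp (Suc n)), Until (IsEq (Suc n) n) ?P] n s1
      (\<lambda>_. True) (geval w (Gfor c g) ?e)" by simp
  qed
qed

section \<open>Polynomial time bounds\<close>

definition poly_bounded :: "(nat \<Rightarrow> nat) \<Rightarrow> bool" where
  "poly_bounded f \<longleftrightarrow> (\<exists>c k. \<forall>N. f N \<le> c * (N + 1) ^ k)"

lemma poly_bounded_const: "poly_bounded (\<lambda>_. a)"
  unfolding poly_bounded_def by (intro exI[of _ a] exI[of _ 0]) simp

lemma poly_bounded_id: "poly_bounded (\<lambda>N. N)"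
  unfolding poly_bounded_def by (intro exI[of _ 1]) simp

lemma poly_bounded_add:
  assumes "poly_bounded f" "poly_bounded g"
  shows "poly_bounded (\<lambda>N. f N + g N)"
proof -
  from assms obtain c k d l where *: "\<And>N. f N \<le> c * (N + 1) ^ k" "\<And>N. g N \<le> d * (N + 1) ^ l"
    unfolding poly_bounded_def by blast
  have "f N + g N \<le> (c + d) * (N + 1) ^ (k + l)" for N
  proof -
    have "(N + 1) ^ k \<le> (N + 1) ^ (k + l)" "(N + 1) ^ l \<le> (N + 1) ^ (k + l)"
      by (rule power_increasing; simp)+
    then have "c * (N + 1) ^ k + d * (N + 1) ^ l \<le> c * (N + 1) ^ (k + l) + d * (N + 1) ^ (k + l)"
      by (intro add_mono mult_le_mono2)
    then show ?thesis using *[of N] by (simp add: algebra_simps)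
  qed
  then show ?thesis unfolding poly_bounded_def by blast
qed

lemma poly_bounded_mult:
  assumes "poly_bounded f" "poly_bounded g"
  shows "poly_bounded (\<lambda>N. f N * g N)"
proof -
  from assms obtain c k d l where *: "\<And>N. f N \<le> c * (N + 1) ^ k" "\<And>N. g N \<le> d * (N + 1) ^ l"
    unfolding poly_bounded_def by blast
  have "f N * g N \<le> (c * d) * (N + 1) ^ (k + l)" for N
    using mult_le_mono[OF *[of N]] by (simp add: power_add algebra_simps)
  then show ?thesis unfolding poly_bounded_def by blast
qed

lemmas poly_bounded_intros = poly_bounded_const poly_bounded_id poly_bounded_add poly_bounded_mult

lemma poly_bounded_cost: "poly_bounded (\<lambda>N. cost N t)"
  by (induction t; simp only: cost.simps; intro poly_bounded_intros; assumption?)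

lemma poly_bounded_gcost: "poly_bounded (\<lambda>N. gcost N g)"
  by (induction g; simp only: gcost.simps; intro poly_bounded_intros poly_bounded_cost; assumption?)

theorem tm_of_gen:
  "\<exists>M c k. tm_wf M \<and> (\<forall>w. \<exists>t \<le> c * (length w + 1) ^ k. tm_halts_with M w t (geval w G (\<lambda>_. 0)))"
proof -
  obtain M where M: "tm_wf M" "\<And>w n s' out. (cstep w ^^ n) (gcompile G (\<lambda>_. 0) 1, (\<lambda>_. 0), []) = ([], s', out) \<Longrightarrow>
    \<exists>t \<le> n * (2 * (length w + n) + 2) + n + 3. tm_halts_with M w t out"
    using tm_of_program[of "gcompile G (\<lambda>_. 0) 1"] by blast
  let ?b = "\<lambda>N. gcost N G * (2 * (N + gcost N G) + 2) + gcost N G + 3"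
  have "poly_bounded ?b" by (intro poly_bounded_intros poly_bounded_gcost)
  then obtain c k where ck: "\<And>N. ?b N \<le> c * (N + 1) ^ k" unfolding poly_bounded_def by blast
  have "\<exists>t \<le> c * (length w + 1) ^ k. tm_halts_with M w t (geval w G (\<lambda>_. 0))" for w
  proof -
    obtain s' n where n: "n \<le> gcost (length w) G"
      "(cstep w ^^ n) (gcompile G (\<lambda>_. 0) 1, (\<lambda>_. 0), []) = ([], s', geval w G (\<lambda>_. 0))"
      using doesD[OF gcompile_does[of "\<lambda>_. 0" 1 w G "\<lambda>_. 0"], of "[]" "[]"] by (auto simp: runs_def)
    obtain t where t: "t \<le> n * (2 * (length w + n) + 2) + n + 3" "tm_halts_with M w t (geval w G (\<lambda>_. 0))"
      using M(2)[OF n(2)] by blast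
    have "n * (2 * (length w + n) + 2) + n + 3 \<le> ?b (length w)"
      using n(1) by (intro add_mono mult_le_mono) auto
    then show ?thesis using t ck[of "length w"] by (meson le_trans)
  qed
  then show ?thesis using M(1) by blast
qed

subsection \<open>Closure properties\<close>

primrec ren :: "(nat \<Rightarrow> nat) \<Rightarrow> trm \<Rightarrow> trm" where
  "ren \<sigma> (V i) = V (\<sigma> i)"
| "ren \<sigma> Zr = Zr"
| "ren \<sigma> Tp = Tp"
| "ren \<sigma> (Sc t) = Sc (ren \<sigma> t)"
| "ren \<sigma> (Bt t) = Bt (ren \<sigma> t)"
| "ren \<sigma> (Cond a b c d) = Cond (ren \<sigma> a) (ren \<sigma> b) (ren \<sigma> c) (ren \<sigma> d)"
| "ren \<sigma> (Rec c b z) = Rec (ren \<sigma> c) (ren (case_nat 0 (case_nat (Suc 0) (\<lambda>i. Suc (Suc (\<sigma> i))))) b) (ren \<sigma> z)"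

lemma eval_ren: "eval w (ren \<sigma> t) e = eval w t (\<lambda>i. e (\<sigma> i))"
proof (induction t arbitrary: \<sigma> e)
  case (Rec c b z)
  have "(\<lambda>j. case_nat i (case_nat v e) (case_nat 0 (case_nat (Suc 0) (\<lambda>i. Suc (Suc (\<sigma> i)))) j))
      = case_nat i (case_nat v (\<lambda>i. e (\<sigma> i)))" for i v
    by (auto simp: fun_eq_iff split: nat.split)
  then show ?case using Rec by simp
qed simp_all

definition shift1 :: "(nat \<Rightarrow> trm) \<Rightarrow> nat \<Rightarrow> trm" where
  "shift1 \<sigma> = case_nat (V 0) (\<lambda>i. ren Suc (\<sigma> i))"

lemma eval_shift1: "(\<lambda>i. eval w (shift1 \<sigma> i) (case_nat x e)) = case_nat x (\<lambda>i. eval w (\<sigma> i) e)"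
  by (auto simp: fun_eq_iff shift1_def eval_ren split: nat.split)

primrec subst_trm :: "(nat \<Rightarrow> trm) \<Rightarrow> trm \<Rightarrow> trm" where
  "subst_trm \<sigma> (V i) = \<sigma> i"
| "subst_trm \<sigma> Zr = Zr"
| "subst_trm \<sigma> Tp = Tp"
| "subst_trm \<sigma> (Sc t) = Sc (subst_trm \<sigma> t)"
| "subst_trm \<sigma> (Bt t) = Bt (subst_trm \<sigma> t)"
| "subst_trm \<sigma> (Cond a b c d) = Cond (subst_trm \<sigma> a) (subst_trm \<sigma> b) (subst_trm \<sigma> c) (subst_trm \<sigma> d)"
| "subst_trm \<sigma> (Rec c b z) = Rec (subst_trm \<sigma> c) (subst_trm (shift1 (shift1 \<sigma>)) b) (subst_trm \<sigma> z)"

lemma eval_subst_trm: "eval w (subst_trm \<sigma> t) e = eval w t (\<lambda>i. eval w (\<sigma> i) e)"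
  by (induction t arbitrary: \<sigma> e) (simp_all add: eval_shift1)

primrec gsubst :: "(nat \<Rightarrow> trm) \<Rightarrow> gen \<Rightarrow> gen" where
  "gsubst \<sigma> (E bs) = E bs"
| "gsubst \<sigma> (Sq g h) = Sq (gsubst \<sigma> g) (gsubst \<sigma> h)"
| "gsubst \<sigma> (Gif a b g h) = Gif (subst_trm \<sigma> a) (subst_trm \<sigma> b) (gsubst \<sigma> g) (gsubst \<sigma> h)"
| "gsubst \<sigma> (Gfor c g) = Gfor (subst_trm \<sigma> c) (gsubst (shift1 \<sigma>) g)"

lemma geval_gsubst: "geval w (gsubst \<sigma> g) e = geval w g (\<lambda>i. eval w (\<sigma> i) e)"
  by (induction g arbitrary: \<sigma> e) (simp_all add: eval_shift1 eval_subst_trm)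

text \<open>The empty word is excluded because 1 is not representable when N = 0.\<close>

definition cn :: "(bool list \<Rightarrow> (nat \<Rightarrow> nat) \<Rightarrow> nat) \<Rightarrow> bool" where
  "cn f \<longleftrightarrow> (\<exists>t. \<forall>w e. w \<noteq> [] \<longrightarrow> eval w t e = f w e)"

definition tn :: "(bool list \<Rightarrow> (nat \<Rightarrow> nat) \<Rightarrow> bool) \<Rightarrow> bool" where
  "tn P \<longleftrightarrow> cn (\<lambda>w e. of_bool (P w e))"

definition gn :: "(bool list \<Rightarrow> (nat \<Rightarrow> nat) \<Rightarrow> bool list) \<Rightarrow> bool" where
  "gn f \<longleftrightarrow> (\<exists>g. \<forall>w e. w \<noteq> [] \<longrightarrow> geval w g e = f w e)"

lemma cnE:
  assumes "cn f"
  obtains t where "\<And>w e. w \<noteq> [] \<Longrightarrow> eval w t e = f w e"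
  using assms unfolding cn_def by blast

lemma gnE:
  assumes "gn f"
  obtains t where "\<And>w e. w \<noteq> [] \<Longrightarrow> geval w t e = f w e"
  using assms unfolding gn_def by blast

lemma cn_subst:
  assumes "cn F" "\<And>i. cn (a i)"
  shows "cn (\<lambda>w e. F w (\<lambda>i. a i w e))"
proof -
  obtain t where t: "\<And>w e. w \<noteq> [] \<Longrightarrow> eval w t e = F w e" using assms(1) by (rule cnE) blast
  have "\<exists>\<sigma>. \<forall>i w e. w \<noteq> [] \<longrightarrow> eval w (\<sigma> i) e = a i w e"
    using assms(2) unfolding cn_def by (intro choice allI)
  then obtain \<sigma> where "\<And>i w e. w \<noteq> [] \<Longrightarrow> eval w (\<sigma> i) e = a i w e" by blast
  then show ?thesis unfolding cn_def by (intro exI[of _ "subst_trm \<sigma> t"]) (simp add: eval_subst_trm t)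
qed

lemma gn_subst:
  assumes "gn F" "\<And>i. cn (a i)"
  shows "gn (\<lambda>w e. F w (\<lambda>i. a i w e))"
proof -
  obtain t where t: "\<And>w e. w \<noteq> [] \<Longrightarrow> geval w t e = F w e" using assms(1) by (rule gnE) blast
  have "\<exists>\<sigma>. \<forall>i w e. w \<noteq> [] \<longrightarrow> eval w (\<sigma> i) e = a i w e"
    using assms(2) unfolding cn_def by (intro choice allI)
  then obtain \<sigma> where "\<And>i w e. w \<noteq> [] \<Longrightarrow> eval w (\<sigma> i) e = a i w e" by blast
  then show ?thesis unfolding gn_def by (intro exI[of _ "gsubst \<sigma> t"]) (simp add: geval_gsubst t)
qed

named_theorems cn_intros

lemma cn_var [cn_intros]: "cn (\<lambda>w e. e i)"
  unfolding cn_def by (intro exI[of _ "V i"]) simp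

lemma cn_zero [cn_intros]: "cn (\<lambda>w e. 0)"
  unfolding cn_def by (intro exI[of _ Zr]) simp

lemma cn_top [cn_intros]: "cn (\<lambda>w e. length w)"
  unfolding cn_def by (intro exI[of _ Tp]) simp

lemma cn_sc [cn_intros]:
  assumes "cn a"
  shows "cn (\<lambda>w e. sc w (a w e))"
proof -
  obtain t where "\<And>w e. w \<noteq> [] \<Longrightarrow> eval w t e = a w e" using assms by (rule cnE) blast
  then show ?thesis unfolding cn_def by (intro exI[of _ "Sc t"]) simp
qed

lemma tn_bitat [cn_intros]:
  assumes "cn a"
  shows "tn (\<lambda>w e. bitat w (a w e))"
proof -
  obtain t where "\<And>w e. w \<noteq> [] \<Longrightarrow> eval w t e = a w e" using assms by (rule cnE) blast
  then show ?thesis unfolding tn_def cn_def by (intro exI[of _ "Bt t"]) simp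
qed

lemma cn_one: "cn (\<lambda>w e. Suc 0)"
  unfolding cn_def by (intro exI[of _ "Sc Zr"]) (auto simp: sc_def)

lemma cn_cond:
  assumes "cn a" "cn b" "cn c" "cn d"
  shows "cn (\<lambda>w e. if a w e = b w e then c w e else d w e)"
proof -
  obtain ta where ta: "\<And>w e. w \<noteq> [] \<Longrightarrow> eval w ta e = a w e" using assms(1) by (rule cnE) blast
  obtain tb where tb: "\<And>w e. w \<noteq> [] \<Longrightarrow> eval w tb e = b w e" using assms(2) by (rule cnE) blast
  obtain tc where tc: "\<And>w e. w \<noteq> [] \<Longrightarrow> eval w tc e = c w e" using assms(3) by (rule cnE) blast
  obtain td where td: "\<And>w e. w \<noteq> [] \<Longrightarrow> eval w td e = d w e" using assms(4) by (rule cnE) blast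
  show ?thesis unfolding cn_def by (intro exI[of _ "Cond ta tb tc td"]) (simp add: ta tb tc td)
qed

lemma tn_eq [cn_intros]: "cn a \<Longrightarrow> cn b \<Longrightarrow> tn (\<lambda>w e. a w e = b w e)"
  unfolding tn_def of_bool_def One_nat_def by (intro cn_cond cn_one cn_zero)

lemma cn_if [cn_intros]:
  assumes "tn P" "cn a" "cn b"
  shows "cn (\<lambda>w e. if P w e then a w e else b w e)"
proof -
  have eq: "(of_bool Q = Suc 0) = Q" for Q by (cases Q) auto
  show ?thesis using cn_cond[OF assms(1)[unfolded tn_def] cn_one assms(2,3)] by (simp only: eq)
qed

lemma tn_not [cn_intros]:
  assumes "tn P"
  shows "tn (\<lambda>w e. \<not> P w e)"
proof -
  have "(\<lambda>w e. of_bool (\<not> P w e)) = (\<lambda>w e. if P w e then 0 else Suc 0)"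
    by (auto simp: fun_eq_iff)
  then show ?thesis unfolding tn_def using cn_if[OF assms cn_zero cn_one] by simp
qed

lemma tn_conj [cn_intros]:
  assumes "tn P" "tn Q"
  shows "tn (\<lambda>w e. P w e \<and> Q w e)"
proof -
  have "(\<lambda>w e. of_bool (P w e \<and> Q w e)) = (\<lambda>w e. if P w e then of_bool (Q w e) else (0::nat))"
    by (auto simp: fun_eq_iff)
  then show ?thesis unfolding tn_def using cn_if[OF assms(1) assms(2)[unfolded tn_def] cn_zero] by simp
qed

lemma tn_disj [cn_intros]:
  assumes "tn P" "tn Q"
  shows "tn (\<lambda>w e. P w e \<or> Q w e)"
  using tn_not[OF tn_conj[OF tn_not[OF assms(1)] tn_not[OF assms(2)]]] by simp

text \<open>The second premise presents the body as a function of a single environment (index,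
  accumulator, then the outer variables), so that the same introduction rules apply under nested
  binders.\<close>

lemma cn_rec:
  assumes "cn c" "cn (\<lambda>w e. b w (\<lambda>i. e (Suc (Suc i))) (e 0) (e (Suc 0)))" "cn z"
  shows "cn (\<lambda>w e. rec_nat (z w e) (b w e) (c w e))"
proof -
  obtain tc where tc: "\<And>w e. w \<noteq> [] \<Longrightarrow> eval w tc e = c w e" using assms(1) by (rule cnE) blast
  obtain tb where tb: "\<And>w e. w \<noteq> [] \<Longrightarrow> eval w tb e = b w (\<lambda>i. e (Suc (Suc i))) (e 0) (e (Suc 0))" using assms(2) by (rule cnE) blast
  obtain tz where tz: "\<And>w e. w \<noteq> [] \<Longrightarrow> eval w tz e = z w e" using assms(3) by (rule cnE) blast
  show ?thesis unfolding cn_def by (intro exI[of _ "Rec tc tb tz"]) (simp add: tc tb tz)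
qed

lemma cn_funpow [cn_intros]:
  assumes "cn k" "cn (\<lambda>w e. f w (\<lambda>i. e (Suc (Suc i))) (e (Suc 0)))" "cn x"
  shows "cn (\<lambda>w e. (f w e ^^ k w e) (x w e))"
proof -
  have "rec_nat z (\<lambda>i. g) n = (g ^^ n) z" for z :: nat and g n by (induction n) auto
  then show ?thesis using cn_rec[OF assms(1) _ assms(3), of "\<lambda>w e i. f w e"] assms(2) by simp
qed

lemma tn_ex [cn_intros]:
  assumes "cn c" "tn (\<lambda>w e. P w (\<lambda>i. e (Suc (Suc i))) (e 0))"
  shows "tn (\<lambda>w e. \<exists>i<c w e. P w e i)"
proof -
  have "rec_nat 0 (\<lambda>i v. if Q i then Suc 0 else v) n = of_bool (\<exists>i<n. Q i)" for Q n
    by (induction n) (auto simp: less_Suc_eq)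
  moreover have "cn (\<lambda>w e. rec_nat 0 (\<lambda>i v. if P w e i then Suc 0 else v) (c w e))"
    by (rule cn_rec) (intro cn_intros cn_one assms)+
  ultimately show ?thesis unfolding tn_def by simp
qed

definition bleast :: "nat \<Rightarrow> (nat \<Rightarrow> bool) \<Rightarrow> nat" where
  "bleast n Q = (if \<exists>i<n. Q i then LEAST i. Q i else n)"

text \<open>The accumulator starts at \<open>N\<close>, which is no index of the search and so
  doubles as "nothing found yet"; the first index that satisfies the predicate replaces it.\<close>

lemma cn_bleast [cn_intros]:
  assumes "tn (\<lambda>w e. P w (\<lambda>i. e (Suc (Suc i))) (e 0))"
  shows "cn (\<lambda>w e. bleast (length w) (P w e))"
proof -
  have *: "rec_nat N (\<lambda>i v. if v = N \<and> Q i then i else v) n = (if \<exists>i<n. Q i then LEAST i. Q i else N)"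
    if "n \<le> N" for Q n N
    using that
  proof (induction n)
    case (Suc n)
    show ?case
    proof (cases "\<exists>i<n. Q i")
      case True
      then have "(LEAST i. Q i) < n" by (meson Least_le le_less_trans)
      then show ?thesis using True Suc by (auto simp: less_Suc_eq)
    next
      case False
      then have "Q n \<Longrightarrow> (LEAST i. Q i) = n" by (intro Least_equality) (auto simp: not_less[symmetric])
      then show ?thesis using False Suc by (auto simp: less_Suc_eq)
    qed
  qed simp
  have "cn (\<lambda>w e. rec_nat (length w) (\<lambda>i v. if v = length w \<and> P w e i then i else v) (length w))"
    by (rule cn_rec) (intro cn_intros assms)+
  then show ?thesis unfolding bleast_def by (simp add: *)
qed

text \<open>Unfolding a definition tends to put its argument below a binder, where an arbitrary
  \<open>a\<close> would have to be shifted. It suffices to treat a variable as the argument and to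
  substitute afterwards.\<close>

lemma cn_app1:
  assumes "cn (\<lambda>w e. f w (e 0))" "cn a"
  shows "cn (\<lambda>w e. f w (a w e))"
  using cn_subst[OF assms(1), of "\<lambda>_. a"] assms(2) by simp

lemma cn_app2:
  assumes "cn (\<lambda>w e. f w (e 0) (e (Suc 0)))" "cn a" "cn b"
  shows "cn (\<lambda>w e. f w (a w e) (b w e))"
  using cn_subst[OF assms(1), of "\<lambda>i. case i of 0 \<Rightarrow> a | Suc _ \<Rightarrow> b"] assms(2,3) by (simp split: nat.split)

lemma tn_app1:
  assumes "tn (\<lambda>w e. f w (e 0))" "cn a"
  shows "tn (\<lambda>w e. f w (a w e))"
  using assms unfolding tn_def by (rule cn_app1)

lemma tn_app2:
  assumes "tn (\<lambda>w e. f w (e 0) (e (Suc 0)))" "cn a" "cn b"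
  shows "tn (\<lambda>w e. f w (a w e) (b w e))"
  using assms unfolding tn_def by (rule cn_app2)

lemma gn_app1:
  assumes "gn (\<lambda>w e. f w (e 0))" "cn a"
  shows "gn (\<lambda>w e. f w (a w e))"
  using gn_subst[OF assms(1), of "\<lambda>_. a"] assms(2) by simp

lemma gn_app2:
  assumes "gn (\<lambda>w e. f w (e 0) (e (Suc 0)))" "cn a" "cn b"
  shows "gn (\<lambda>w e. f w (a w e) (b w e))"
  using gn_subst[OF assms(1), of "\<lambda>i. case i of 0 \<Rightarrow> a | Suc _ \<Rightarrow> b"] assms(2,3) by (simp split: nat.split)

lemma gn_const [cn_intros]: "gn (\<lambda>w e. bs)"
  unfolding gn_def by (intro exI[of _ "E bs"]) simp

lemma gn_append [cn_intros]:
  assumes "gn f" "gn g"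
  shows "gn (\<lambda>w e. f w e @ g w e)"
proof -
  obtain a where a: "\<And>w e. w \<noteq> [] \<Longrightarrow> geval w a e = f w e" using assms(1) by (rule gnE) blast
  obtain b where b: "\<And>w e. w \<noteq> [] \<Longrightarrow> geval w b e = g w e" using assms(2) by (rule gnE) blast
  show ?thesis unfolding gn_def by (intro exI[of _ "Sq a b"]) (simp add: a b)
qed

lemma gn_Cons [cn_intros]: "gn f \<Longrightarrow> gn (\<lambda>w e. b # f w e)"
  using gn_append[OF gn_const[of "[b]"], of f] by simp

lemma gn_if [cn_intros]:
  assumes "tn P" "gn f" "gn g"
  shows "gn (\<lambda>w e. if P w e then f w e else g w e)"
proof -
  obtain t where t: "\<And>w e. w \<noteq> [] \<Longrightarrow> eval w t e = of_bool (P w e)" using assms(1)[unfolded tn_def] by (rule cnE) blast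
  obtain a where a: "\<And>w e. w \<noteq> [] \<Longrightarrow> geval w a e = f w e" using assms(2) by (rule gnE) blast
  obtain b where b: "\<And>w e. w \<noteq> [] \<Longrightarrow> geval w b e = g w e" using assms(3) by (rule gnE) blast
  show ?thesis unfolding gn_def by (intro exI[of _ "Gif t Zr b a"]) (simp add: t a b)
qed

lemma gn_for [cn_intros]:
  assumes "cn c" "gn (\<lambda>w e. g w (\<lambda>i. e (Suc i)) (e 0))"
  shows "gn (\<lambda>w e. concat (map (g w e) [0..<c w e]))"
proof -
  obtain t where t: "\<And>w e. w \<noteq> [] \<Longrightarrow> eval w t e = c w e" using assms(1) by (rule cnE) blast
  obtain a where a: "\<And>w e. w \<noteq> [] \<Longrightarrow> geval w a e = g w (\<lambda>i. e (Suc i)) (e 0)" using assms(2) by (rule gnE) blast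
  show ?thesis unfolding gn_def by (intro exI[of _ "Gfor t a"]) (simp add: t a)
qed

theorem tm_of_gn:
  assumes "gn (\<lambda>w e. f w)"
  shows "\<exists>M c k. tm_wf M \<and> (\<forall>w. w \<noteq> [] \<longrightarrow> (\<exists>t \<le> c * (length w + 1) ^ k. tm_halts_with M w t (f w)))"
proof -
  obtain G where G: "\<And>w e. w \<noteq> [] \<Longrightarrow> geval w G e = f w" using assms by (rule gnE) blast
  obtain M c k where M: "tm_wf M" "\<And>w. \<exists>t \<le> c * (length w + 1) ^ k. tm_halts_with M w t (geval w G (\<lambda>_. 0))"
    using tm_of_gen[of G] by blast
  have "\<exists>t \<le> c * (length w + 1) ^ k. tm_halts_with M w t (f w)" if "w \<noteq> []" for w
    using M(2)[of w] G[OF that] by simp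
  then show ?thesis using M(1) by blast
qed

declare enc_nat.simps [simp del]

subsection \<open>Reading the encoded formula\<close>

definition occurs_at :: "bool list \<Rightarrow> nat \<Rightarrow> bool list \<Rightarrow> bool" where
  "occurs_at w p u \<longleftrightarrow> (\<exists>a b. w = a @ u @ b \<and> length a = p)"

lemma at_append: "occurs_at w p (u @ v) \<longleftrightarrow> occurs_at w p u \<and> occurs_at w (p + length u) v"
proof
  assume "occurs_at w p (u @ v)"
  then obtain a b where "w = a @ (u @ v) @ b" "length a = p" unfolding occurs_at_def by blast
  then have "w = a @ u @ (v @ b)" "w = (a @ u) @ v @ b" "length (a @ u) = p + length u" by auto
  then show "occurs_at w p u \<and> occurs_at w (p + length u) v" unfolding occurs_at_def using \<open>length a = p\<close> by blast
next
  assume "occurs_at w p u \<and> occurs_at w (p + length u) v"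
  then obtain a b c d where *: "w = a @ u @ b" "length a = p" "w = c @ v @ d" "length c = p + length u"
    unfolding occurs_at_def by blast
  then have "c = a @ u" by (metis append.assoc append_eq_append_conv length_append)
  then show "occurs_at w p (u @ v)" using * unfolding occurs_at_def by (intro exI[of _ a] exI[of _ d]) simp
qed

lemma at_Nil [simp]: "occurs_at w p [] \<longleftrightarrow> p \<le> length w"
  unfolding occurs_at_def by (metis append_Nil append_take_drop_id le_add1 length_append length_take min.absorb2)

lemma at_le: "occurs_at w p u \<Longrightarrow> p + length u \<le> length w"
  unfolding occurs_at_def by auto

lemma at_nth: "occurs_at w p u \<Longrightarrow> i < length u \<Longrightarrow> w ! (p + i) = u ! i"
  unfolding occurs_at_def by (auto simp: nth_append)

lemma at_Cons: "occurs_at w p (b # u) \<longleftrightarrow> p < length w \<and> w ! p = b \<and> occurs_at w (Suc p) u"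
proof -
  have "occurs_at w p [b] \<longleftrightarrow> p < length w \<and> w ! p = b"
  proof
    assume "occurs_at w p [b]"
    then show "p < length w \<and> w ! p = b" using at_le[of w p "[b]"] at_nth[of w p "[b]" 0] by simp
  next
    assume "p < length w \<and> w ! p = b"
    then show "occurs_at w p [b]" unfolding occurs_at_def
      using id_take_nth_drop[of p w] by (intro exI[of _ "take p w"] exI[of _ "drop (Suc p) w"]) auto
  qed
  then show ?thesis using at_append[of w p "[b]" u] by simp
qed

lemma at_self: "occurs_at w 0 w"
  unfolding occurs_at_def by (intro exI[of _ "[]"]) simp

lemma bitat_at: "occurs_at w p (b # u) \<Longrightarrow> bitat w p = b"
  by (simp add: at_Cons bitat_def)

lemma sc_at: "occurs_at w p (b # u) \<Longrightarrow> sc w p = Suc p"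
  by (simp add: at_Cons sc_def)

lemma enc_nat_0: "enc_nat 0 = [False]"
  by (subst enc_nat.simps) simp

lemma enc_nat_pos: "0 < n \<Longrightarrow> enc_nat n = True # odd n # enc_nat (n div 2)"
  by (subst enc_nat.simps) simp

lemma enc_nat_tags:
  "enc_nat (Suc 0) = [True, True, False]" "enc_nat 1 = [True, True, False]" "enc_nat 2 = [True, False, True, True, False]"
  "enc_nat 3 = [True, True, True, True, False]" "enc_nat 4 = [True, False, True, False, True, True, False]"
  "enc_nat 5 = [True, True, True, False, True, True, False]"
  by (simp_all add: enc_nat_pos enc_nat_0)

lemma funpow_fix: "f y = y \<Longrightarrow> (f ^^ n) y = y"
  by (induction n) auto

text \<open>The programs iterate \<open>N\<close> times instead of the exact number of rounds; once
  a fixed point is reached, the surplus rounds do no harm.\<close>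

lemma funpow_reach: "(f ^^ j) x = y \<Longrightarrow> f y = y \<Longrightarrow> j \<le> n \<Longrightarrow> (f ^^ n) x = y"
  using funpow_add[of "n - j" j f] funpow_fix[of f y "n - j"] by simp

lemma funpow_loop_Cons:
  "concat (map (\<lambda>k. G ((s ^^ k) p)) [0..<Suc M]) = G p @ concat (map (\<lambda>k. G ((s ^^ k) (s p))) [0..<M])"
  by (simp add: upt_conv_Cons map_Suc_upt[symmetric] comp_def funpow_swap1 del: upt_Suc)

text \<open>Skips an encoded number: each round jumps over one pair of bits until the terminating
  \<open>False\<close>, where the iteration rests; the outer \<open>sc\<close> steps over
  it.\<close>

definition snat :: "bool list \<Rightarrow> nat \<Rightarrow> nat" where
  "snat w p = sc w (((\<lambda>x. if bitat w x then sc w (sc w x) else x) ^^ length w) p)"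

definition sint :: "bool list \<Rightarrow> nat \<Rightarrow> nat" where
  "sint w p = snat w (sc w p)"

lemma snat_at:
  assumes "occurs_at w p (enc_nat n)"
  shows "snat w p = p + length (enc_nat n)"
proof -
  let ?f = "\<lambda>x. if bitat w x then sc w (sc w x) else x"
  have "\<exists>j \<le> length (enc_nat n). (?f ^^ j) p + 1 = p + length (enc_nat n)
      \<and> occurs_at w ((?f ^^ j) p) [False]"
    using assms
  proof (induction n arbitrary: p rule: less_induct)
    case (less n)
    show ?case
    proof (cases "n = 0")
      case True
      then show ?thesis using less.prems by (intro exI[of _ 0]) (simp add: enc_nat_0)
    next
      case False
      then have e: "enc_nat n = True # odd n # enc_nat (n div 2)" by (simp add: enc_nat_pos)
      have a: "occurs_at w (Suc (Suc p)) (enc_nat (n div 2))" using less.prems by (simp add: e at_Cons)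
      have f: "?f p = Suc (Suc p)" using less.prems by (auto simp: e at_Cons bitat_def sc_def)
      have "n div 2 < n" using False by simp
      from less.IH[OF this a] obtain j where j: "j \<le> length (enc_nat (n div 2))"
        "(?f ^^ j) (Suc (Suc p)) + 1 = Suc (Suc p) + length (enc_nat (n div 2))"
        "occurs_at w ((?f ^^ j) (Suc (Suc p))) [False]" by blast
      have "(?f ^^ Suc j) p = (?f ^^ j) (Suc (Suc p))" by (simp only: funpow_Suc_right comp_apply f)
      then show ?thesis using j by (intro exI[of _ "Suc j"]) (simp only: e list.size, simp)
    qed
  qed
  then obtain j where j: "j \<le> length (enc_nat n)" "(?f ^^ j) p + 1 = p + length (enc_nat n)"
    "occurs_at w ((?f ^^ j) p) [False]" by blast
  have "(?f ^^ length w) p = (?f ^^ j) p"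
    by (rule funpow_reach[where j = j]) (use j at_le[OF assms] bitat_at[OF j(3)] in auto)
  then show ?thesis using j(2) sc_at[OF j(3)] by (simp add: snat_def)
qed

lemma sint_at: "occurs_at w p (enc_int i) \<Longrightarrow> sint w p = p + length (enc_int i)"
  by (auto simp: sint_def enc_int_def at_Cons sc_def snat_at)

text \<open>A move from one item marker of an encoded list to the next, with \<open>s\<close>
  skipping the content; the terminator is a fixed point.\<close>

definition lnext :: "bool list \<Rightarrow> (nat \<Rightarrow> nat) \<Rightarrow> nat \<Rightarrow> nat" where
  "lnext w s x = (if bitat w x then s (sc w x) else x)"

primrec itempos :: "('a \<Rightarrow> bool list) \<Rightarrow> nat \<Rightarrow> 'a list \<Rightarrow> (nat \<times> 'a) list" where
  "itempos f p [] = []"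
| "itempos f p (x # xs) = (Suc p, x) # itempos f (Suc p + length (f x)) xs"

lemma map_snd_itempos: "map snd (itempos f p xs) = xs"
  by (induction xs arbitrary: p) auto

lemma enc_list_simps: "enc_list f [] = [False]" "enc_list f (x # xs) = True # f x @ enc_list f xs"
  by (simp_all add: enc_list_def)

lemma length_le_enc_list: "length xs < length (enc_list f xs)"
  by (induction xs) (auto simp: enc_list_simps)

lemma itempos_at: "occurs_at w p (enc_list f xs) \<Longrightarrow> (q, x) \<in> set (itempos f p xs) \<Longrightarrow> occurs_at w q (f x) \<and> x \<in> set xs"
  by (induction xs arbitrary: p) (auto simp: enc_list_simps at_Cons at_append)

lemma itempos_gt: "(q, x) \<in> set (itempos f p xs) \<Longrightarrow> p < q"
  by (induction xs arbitrary: p) fastforce+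

lemma list_end:
  assumes "occurs_at w p (enc_list f xs)" "\<And>q x. x \<in> set xs \<Longrightarrow> occurs_at w q (f x) \<Longrightarrow> s q = q + length (f x)"
  shows "sc w ((lnext w s ^^ length w) p) = p + length (enc_list f xs)"
proof -
  have "sc w ((lnext w s ^^ N) p) = p + length (enc_list f xs)" if "length xs \<le> N" for N
    using that assms
  proof (induction xs arbitrary: p N)
    case Nil
    then have "lnext w s p = p" "sc w p = Suc p"
      by (auto simp: enc_list_simps lnext_def bitat_at sc_at)
    then show ?case by (simp add: funpow_fix enc_list_simps)
  next
    case (Cons x xs)
    obtain M where N: "N = Suc M" "length xs \<le> M" using Cons.prems(1) by (cases N) auto
    have a: "occurs_at w p [True]" "occurs_at w (Suc p) (f x)" "occurs_at w (Suc p + length (f x)) (enc_list f xs)"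
      using Cons.prems(2) by (auto simp: enc_list_simps at_Cons at_append)
    have "lnext w s p = Suc p + length (f x)"
      using Cons.prems(3)[OF _ a(2)] by (simp add: lnext_def bitat_at[OF a(1)] sc_at[OF a(1)])
    then have "(lnext w s ^^ N) p = (lnext w s ^^ M) (Suc p + length (f x))"
      by (simp only: N funpow_Suc_right comp_apply)
    then show ?case using Cons.IH[OF N(2) a(3)] Cons.prems(3) by (simp add: enc_list_simps)
  qed
  then show ?thesis using at_le[OF assms(1)] length_le_enc_list[of xs f] by simp
qed

text \<open>A list has fewer items than its encoding has bits, so \<open>N\<close> rounds visit them
  all; the surplus rounds sit on the terminator and produce nothing.\<close>

lemma list_loop:
  assumes "occurs_at w p (enc_list f xs)" "\<And>q x. x \<in> set xs \<Longrightarrow> occurs_at w q (f x) \<Longrightarrow> s q = q + length (f x)"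
  shows "concat (map (\<lambda>k. if bitat w ((lnext w s ^^ k) p) then g (sc w ((lnext w s ^^ k) p)) else []) [0..<length w])
    = concat (map (\<lambda>(q, x). g q) (itempos f p xs))"
proof -
  let ?h = "\<lambda>x. if bitat w x then g (sc w x) else []"
  have "concat (map (\<lambda>k. ?h ((lnext w s ^^ k) p)) [0..<N]) = concat (map (\<lambda>(q, x). g q) (itempos f p xs))"
    if "length xs \<le> N" for N
    using that assms
  proof (induction xs arbitrary: p N)
    case Nil
    then have "lnext w s p = p" "\<not> bitat w p"
      by (auto simp: enc_list_simps lnext_def bitat_at)
    then show ?case by (simp add: funpow_fix)
  next
    case (Cons x xs)
    obtain M where N: "N = Suc M" "length xs \<le> M" using Cons.prems(1) by (cases N) auto
    have a: "occurs_at w p [True]" "occurs_at w (Suc p) (f x)" "occurs_at w (Suc p + length (f x)) (enc_list f xs)"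
      using Cons.prems(2) by (auto simp: enc_list_simps at_Cons at_append)
    have l: "lnext w s p = Suc p + length (f x)"
      using Cons.prems(3)[OF _ a(2)] by (simp add: lnext_def bitat_at[OF a(1)] sc_at[OF a(1)])
    have "concat (map (\<lambda>k. ?h ((lnext w s ^^ k) p)) [0..<N])
      = g (Suc p) @ concat (map (\<lambda>k. ?h ((lnext w s ^^ k) (Suc p + length (f x)))) [0..<M])"
      unfolding N funpow_loop_Cons[where G = ?h] by (simp only: l bitat_at[OF a(1)] sc_at[OF a(1)] if_True)
    also have "\<dots> = g (Suc p) @ concat (map (\<lambda>(q, x). g q) (itempos f (Suc p + length (f x)) xs))"
      by (subst Cons.IH[OF N(2) a(3)]) (use Cons.prems(3) in auto)
    finally show ?case by simp
  qed
  then show ?thesis using at_le[OF assms(1)] length_le_enc_list[of xs f] by simp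
qed

lemma list_ex:
  assumes "occurs_at w p (enc_list f xs)" "\<And>q x. x \<in> set xs \<Longrightarrow> occurs_at w q (f x) \<Longrightarrow> s q = q + length (f x)"
  shows "(\<exists>k<length w. bitat w ((lnext w s ^^ k) p) \<and> R (sc w ((lnext w s ^^ k) p)))
    \<longleftrightarrow> (\<exists>(q, x)\<in>set (itempos f p xs). R q)"
  \<comment> \<open>Search is read off from the generating loop: every item produces its truth
    value, and the question is whether \<open>True\<close> occurs in the output.\<close>
  using arg_cong[OF list_loop[OF assms, where g = "\<lambda>q. [R q]"], of "\<lambda>l. True \<in> set l"]
  by (auto split: if_splits prod.splits simp: Bex_def)

subsection \<open>The nodes of the formula\<close>

text \<open>Subformulas in preorder with the positions of their encodings. Because of the prefix
  notation, the encoding of a formula is the concatenation of its heads in this order.\<close>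

primrec nodes :: "('a \<Rightarrow> bool list) \<Rightarrow> nat \<Rightarrow> 'a bform \<Rightarrow> (nat \<times> 'a bform) list" where
  "nodes f p BTrue = [(p, BTrue)]"
| "nodes f p BFalse = [(p, BFalse)]"
| "nodes f p (BAtom a) = [(p, BAtom a)]"
| "nodes f p (BNot g) = (p, BNot g) # nodes f (p + length (enc_nat 3)) g"
| "nodes f p (BAnd g h) = (p, BAnd g h) # nodes f (p + length (enc_nat 4)) g
    @ nodes f (p + length (enc_nat 4) + length (enc_bform f g)) h"
| "nodes f p (BOr g h) = (p, BOr g h) # nodes f (p + length (enc_nat 5)) g
    @ nodes f (p + length (enc_nat 5) + length (enc_bform f g)) h"

fun head_enc :: "('a \<Rightarrow> bool list) \<Rightarrow> 'a bform \<Rightarrow> bool list" where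
  "head_enc f BTrue = enc_nat 0"
| "head_enc f BFalse = enc_nat 1"
| "head_enc f (BAtom a) = enc_nat 2 @ f a"
| "head_enc f (BNot g) = enc_nat 3"
| "head_enc f (BAnd g h) = enc_nat 4"
| "head_enc f (BOr g h) = enc_nat 5"

text \<open>A map on atoms keeps the shape of the formula, so translating head by head in preorder
  yields the encoding of the translated formula.\<close>

lemma concat_head_enc: "concat (map (\<lambda>(x, \<psi>). head_enc (\<lambda>a. f (tr a)) \<psi>) (nodes e p \<phi>)) = enc_bform f (map_bform tr \<phi>)"
  by (induction \<phi> arbitrary: p) auto

lemma nodes_at: "occurs_at w p (enc_bform f \<phi>) \<Longrightarrow> (x, \<psi>) \<in> set (nodes f p \<phi>) \<Longrightarrow> occurs_at w x (head_enc f \<psi>)"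
  by (induction \<phi> arbitrary: p) (auto simp: at_append)

lemma nodes_atoms: "BAtom a \<in> snd ` set (nodes f p \<phi>) \<longleftrightarrow> a \<in> set (batoms \<phi>)"
  by (induction \<phi> arbitrary: p) (auto simp: image_Un)

lemma enc_nat_nonempty: "Suc 0 \<le> length (enc_nat n)"
  by (cases "n = 0") (auto simp: enc_nat_0 enc_nat_pos)

lemma length_nodes: "length (nodes f p \<phi>) \<le> length (enc_bform f \<phi>)"
proof (induction \<phi> arbitrary: p)
  case (BNot g)
  then show ?case using BNot[of "p + length (enc_nat 3)"] enc_nat_nonempty[of 3]
    unfolding nodes.simps enc_bform.simps list.size length_append by linarith
next
  case (BAnd g h)
  then show ?case using BAnd(1)[of "p + length (enc_nat 4)"] BAnd(2)[of "p + length (enc_nat 4) + length (enc_bform f g)"]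
      enc_nat_nonempty[of 4]
    unfolding nodes.simps enc_bform.simps list.size length_append by linarith
next
  case (BOr g h)
  then show ?case using BOr(1)[of "p + length (enc_nat 5)"] BOr(2)[of "p + length (enc_nat 5) + length (enc_bform f g)"]
      enc_nat_nonempty[of 5]
    unfolding nodes.simps enc_bform.simps list.size length_append by linarith
qed (use enc_nat_nonempty in \<open>simp_all add: add_increasing2\<close>)

text \<open>The additional \<open>M\<close> rounds, which continue behind the formula, carry the
  induction: rounds left over by the first subformula are spent on the second.\<close>

lemma nodes_loop_add:
  assumes "occurs_at w p (enc_bform f \<phi>)"
    and "\<And>x \<psi>. (x, \<psi>) \<in> set (nodes f p \<phi>) \<Longrightarrow> s x = x + length (head_enc f \<psi>)"
  shows "concat (map (\<lambda>k. G ((s ^^ k) p)) [0..<length (nodes f p \<phi>) + M])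
    = concat (map (\<lambda>(x, \<psi>). G x) (nodes f p \<phi>))
      @ concat (map (\<lambda>k. G ((s ^^ k) (p + length (enc_bform f \<phi>)))) [0..<M])"
  using assms
proof (induction \<phi> arbitrary: p M)
  case (BNot g)
  have "s p = p + length (enc_nat 3)" using BNot.prems(2)[of p "BNot g"] by simp
  then show ?case using BNot.IH[of "p + length (enc_nat 3)" M] BNot.prems
    by (simp add: funpow_loop_Cons at_append add.assoc del: upt_Suc funpow.simps)
next
  case (BAnd g h)
  have "s p = p + length (enc_nat 4)" using BAnd.prems(2)[of p "BAnd g h"] by simp
  then show ?case using BAnd.IH(1)[of "p + length (enc_nat 4)"]
      BAnd.IH(2)[of "p + length (enc_nat 4) + length (enc_bform f g)" M] BAnd.prems
    by (simp add: funpow_loop_Cons at_append add.assoc del: upt_Suc funpow.simps)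
next
  case (BOr g h)
  have "s p = p + length (enc_nat 5)" using BOr.prems(2)[of p "BOr g h"] by simp
  then show ?case using BOr.IH(1)[of "p + length (enc_nat 5)"]
      BOr.IH(2)[of "p + length (enc_nat 5) + length (enc_bform f g)" M] BOr.prems
    by (simp add: funpow_loop_Cons at_append add.assoc del: upt_Suc funpow.simps)
qed (simp_all add: funpow_loop_Cons del: upt_Suc funpow.simps)

lemma nodes_loop:
  assumes "occurs_at w p (enc_bform f \<phi>)" "p + length (enc_bform f \<phi>) = length w"
    and "\<And>x \<psi>. (x, \<psi>) \<in> set (nodes f p \<phi>) \<Longrightarrow> s x = x + length (head_enc f \<psi>)"
    and "s (length w) = length w" "G (length w) = []"
  shows "concat (map (\<lambda>k. G ((s ^^ k) p)) [0..<length w]) = concat (map (\<lambda>(x, \<psi>). G x) (nodes f p \<phi>))"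
proof -
  obtain M where "length w = length (nodes f p \<phi>) + M"
    using length_nodes[of f p \<phi>] assms(2) le_Suc_ex by (metis le_add2 le_trans)
  then show ?thesis using nodes_loop_add[where M = M and G = G, OF assms(1,3)] assms(2,4,5)
    by (simp add: funpow_fix map_replicate_const)
qed

lemma nodes_ex:
  assumes "occurs_at w p (enc_bform f \<phi>)" "p + length (enc_bform f \<phi>) = length w"
    and "\<And>x \<psi>. (x, \<psi>) \<in> set (nodes f p \<phi>) \<Longrightarrow> s x = x + length (head_enc f \<psi>)"
    and "s (length w) = length w" "\<not> R (length w)"
  shows "(\<exists>k<length w. R ((s ^^ k) p)) \<longleftrightarrow> (\<exists>(x, \<psi>)\<in>set (nodes f p \<phi>). R x)"
proof -
  have "concat (map (\<lambda>k. if R ((s ^^ k) p) then [()] else []) [0..<length w])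
      = concat (map (\<lambda>(x, \<psi>). if R x then [()] else []) (nodes f p \<phi>))"
    using nodes_loop[where G = "\<lambda>x. if R x then [()] else []", OF assms(1-4)] assms(5) by simp
  from arg_cong[OF this, of "\<lambda>l. () \<in> set l"] show ?thesis
    by (auto split: if_splits prod.splits simp: Bex_def)
qed

text \<open>Tests for the first four bits of \<open>enc_nat 2\<close>, the tag of an atom; no other
  tag starts with them.\<close>

definition isatom :: "bool list \<Rightarrow> nat \<Rightarrow> bool" where
  "isatom w x \<longleftrightarrow> bitat w x \<and> \<not> bitat w (sc w x) \<and> bitat w (sc w (sc w x)) \<and> bitat w (sc w (sc w (sc w x)))"

definition slin :: "bool list \<Rightarrow> nat \<Rightarrow> nat" where
  "slin w p = sc w ((lnext w (\<lambda>q. snat w (sint w q)) ^^ length w) p)"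

text \<open>The step to the next node in preorder. Only an atom has content behind its tag; the
  first bit of the inner tag tells congruences, which carry two integers, from inequalities.\<close>

definition nnext :: "bool list \<Rightarrow> nat \<Rightarrow> nat" where
  "nnext w x = (if isatom w x then (if bitat w (snat w x) then sint w (sint w (slin w (snat w (snat w x))))
    else sint w (slin w (snat w (snat w x)))) else snat w x)"

fun atom_lin :: "pa_atom \<Rightarrow> lin" where
  "atom_lin (LinLe t b) = t" | "atom_lin (LinCong t b m) = t"

fun atom_tag :: "pa_atom \<Rightarrow> nat" where
  "atom_tag (LinLe t b) = 0" | "atom_tag (LinCong t b m) = 1"

lemma pa_atom_vars_lin: "pa_atom_vars a = set (map snd (atom_lin a))"
  by (cases a) auto

lemma item_skip: "occurs_at w q (enc_pair enc_int enc_nat (c, v)) \<Longrightarrow>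
    sint w q = q + length (enc_int c) \<and> occurs_at w (q + length (enc_int c)) (enc_nat v)
    \<and> snat w (sint w q) = q + length (enc_pair enc_int enc_nat (c, v))"
  using sint_at[of w q c] snat_at[of w "q + length (enc_int c)" v] by (simp add: enc_pair_def at_append)

lemma item_skip': "occurs_at w q (enc_pair enc_int enc_nat x) \<Longrightarrow>
    snat w (sint w q) = q + length (enc_pair enc_int enc_nat x)"
  using item_skip by (cases x) blast

lemma slin_at: "occurs_at w p (enc_lin t) \<Longrightarrow> slin w p = p + length (enc_lin t)"
  unfolding slin_def enc_lin_def by (rule list_end) (simp_all add: item_skip')

lemma isatom_at: "occurs_at w x (head_enc f \<psi>) \<Longrightarrow> isatom w x \<longleftrightarrow> (\<exists>a. \<psi> = BAtom a)"
  by (cases \<psi>) (auto simp: enc_nat_tags enc_nat_0 at_Cons isatom_def bitat_def sc_def)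

lemma nnext_at:
  assumes "occurs_at w x (head_enc enc_pa_atom \<psi>)"
  shows "nnext w x = x + length (head_enc enc_pa_atom \<psi>)"
proof (cases "\<exists>a. \<psi> = BAtom a")
  case True
  then obtain a where a: "\<psi> = BAtom a" by blast
  have 1: "snat w x = x + length (enc_nat 2)" using assms by (simp add: a at_append snat_at)
  define y where "y = x + length (enc_nat 2)"
  have 2: "occurs_at w y (enc_pa_atom a)" using assms by (simp add: a at_append y_def)
  have occurs_at: "isatom w x" using isatom_at[OF assms] a by blast
  show ?thesis
  proof (cases a)
    case (LinLe t b)
    have "occurs_at w y (enc_nat 0)" "occurs_at w (y + length (enc_nat 0)) (enc_lin t)"
      "occurs_at w (y + length (enc_nat 0) + length (enc_lin t)) (enc_int b)"
      using 2 by (auto simp: LinLe at_append)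
    note * = this snat_at[OF this(1)] slin_at[OF this(2)] sint_at[OF this(3)]
    have "\<not> bitat w y" using *(1) by (simp add: enc_nat_0 bitat_at)
    then show ?thesis using *(4-) occurs_at by (simp add: nnext_def 1 y_def[symmetric] a LinLe; simp add: y_def)
  next
    case (LinCong t b m)
    have "occurs_at w y (enc_nat 1)" "occurs_at w (y + length (enc_nat 1)) (enc_lin t)"
      "occurs_at w (y + length (enc_nat 1) + length (enc_lin t)) (enc_int b)"
      "occurs_at w (y + length (enc_nat 1) + length (enc_lin t) + length (enc_int b)) (enc_int m)"
      using 2 by (auto simp: LinCong at_append)
    note * = this snat_at[OF this(1)] slin_at[OF this(2)] sint_at[OF this(3)] sint_at[OF this(4)]
    have "bitat w y" using *(1) by (simp add: enc_nat_tags bitat_at)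
    then show ?thesis using *(5-) occurs_at by (simp add: nnext_def 1 y_def[symmetric] a LinCong; simp add: y_def)
  qed
next
  case False
  then show ?thesis using assms isatom_at[OF assms] by (cases \<psi>) (auto simp: nnext_def snat_at)
qed

lemma snat_top: "snat w (length w) = length w"
  by (simp add: snat_def bitat_def sc_def funpow_fix)

lemma nnext_top: "nnext w (length w) = length w"
  by (simp add: nnext_def isatom_def bitat_def snat_top)

section \<open>Occurrences of variable names and their canonical positions\<close>

definition body :: "bool list \<Rightarrow> nat" where
  "body w = sc w ((lnext w (snat w) ^^ length w) 0)"

definition occB :: "bool list \<Rightarrow> nat \<Rightarrow> bool" where
  "occB w p \<longleftrightarrow> (\<exists>k<length w. bitat w ((lnext w (snat w) ^^ k) 0) \<and> sc w ((lnext w (snat w) ^^ k) 0) = p)"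

definition lstep :: "bool list \<Rightarrow> nat \<Rightarrow> nat" where
  "lstep w = lnext w (\<lambda>q. snat w (sint w q))"

definition occA :: "bool list \<Rightarrow> nat \<Rightarrow> bool" where
  "occA w p \<longleftrightarrow> (\<exists>k<length w. isatom w ((nnext w ^^ k) (body w)) \<and>
    (\<exists>j<length w. bitat w ((lstep w ^^ j) (snat w (snat w ((nnext w ^^ k) (body w)))))
      \<and> sint w (sc w ((lstep w ^^ j) (snat w (snat w ((nnext w ^^ k) (body w)))))) = p))"

definition occ :: "bool list \<Rightarrow> nat \<Rightarrow> bool" where
  "occ w p \<longleftrightarrow> occA w p \<or> occB w p"

definition addp :: "bool list \<Rightarrow> nat \<Rightarrow> nat \<Rightarrow> nat" where
  "addp w p i = (sc w ^^ i) p"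

text \<open>Names may be far larger than \<open>N\<close> and then fit no register, so they are
  compared bit by bit. The extent of the name at \<open>p\<close> suffices because the encoding of
  numbers is prefix-free.\<close>

definition same :: "bool list \<Rightarrow> nat \<Rightarrow> nat \<Rightarrow> bool" where
  "same w p q \<longleftrightarrow> \<not> (\<exists>i<length w. addp w p i < snat w p \<and>
    (bitat w (addp w p i) \<and> \<not> bitat w (addp w q i) \<or> \<not> bitat w (addp w p i) \<and> bitat w (addp w q i)))"

text \<open>The first occurrence represents the name, which turns names into numbers below
  \<open>N\<close>.\<close>

definition can :: "bool list \<Rightarrow> nat \<Rightarrow> nat" where
  "can w p = bleast (length w) (\<lambda>q. occ w q \<and> same w p q)"

definition bd :: "bool list \<Rightarrow> nat \<Rightarrow> bool" where
  "bd w p \<longleftrightarrow> (\<exists>q<length w. occB w q \<and> same w p q)"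

definition fc :: "bool list \<Rightarrow> nat \<Rightarrow> bool" where
  "fc w q \<longleftrightarrow> occA w q \<and> can w q = q \<and> \<not> bd w q"

definition bc :: "bool list \<Rightarrow> nat \<Rightarrow> bool" where
  "bc w q \<longleftrightarrow> occ w q \<and> can w q = q \<and> bd w q"

lemma addp_eq: "p \<le> length w \<Longrightarrow> addp w p i = min (p + i) (length w)"
  unfolding addp_def by (induction i) (auto simp: sc_def)

text \<open>Prefix-freeness, by induction over the pairs of bits: the continuation markers agree, so
  both numbers end at the same place.\<close>

lemma enc_nat_prefix:
  "(\<And>i. i < length (enc_nat n) \<Longrightarrow> i < length B \<Longrightarrow> enc_nat n ! i = B ! i) \<Longrightarrow>
    length (enc_nat n) \<le> length B \<Longrightarrow> B = enc_nat m @ v \<Longrightarrow> n = m"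
proof (induction n arbitrary: m B rule: less_induct)
  case (less n)
  show ?case
  proof (cases "n = 0")
    case True
    then have "B ! 0 = False" using less.prems by (force simp: enc_nat_0)
    then show ?thesis using True less.prems(3) by (cases "m = 0") (auto simp: enc_nat_pos)
  next
    case False
    then have e: "enc_nat n = True # odd n # enc_nat (n div 2)" by (simp add: enc_nat_pos)
    then have "B ! 0" using less.prems(1)[of 0] less.prems(2) by (cases B) auto
    then have m: "0 < m" using less.prems(3) by (cases "m = 0") (auto simp: enc_nat_0)
    then have B: "B = True # odd m # enc_nat (m div 2) @ v" using less.prems(3) by (simp add: enc_nat_pos)
    have o: "odd n = odd m" using less.prems(1)[of 1] less.prems(2) by (simp add: e B)
    have "n div 2 = m div 2"
    proof (rule less.IH)
      show "n div 2 < n" using False by simp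
      show "enc_nat (n div 2) ! i = (enc_nat (m div 2) @ v) ! i"
        if "i < length (enc_nat (n div 2))" "i < length (enc_nat (m div 2) @ v)" for i
        using less.prems(1)[of "Suc (Suc i)"] that by (simp add: e B)
      show "length (enc_nat (n div 2)) \<le> length (enc_nat (m div 2) @ v)" using less.prems(2) by (simp add: e B)
    qed simp
    then show ?thesis using o by (metis div_mult_mod_eq odd_iff_mod_2_eq_one even_iff_mod_2_eq_zero)
  qed
qed

lemma same_iff:
  assumes n: "occurs_at w p (enc_nat n)" and m: "occurs_at w q (enc_nat m)"
  shows "same w p q \<longleftrightarrow> n = m"
proof
  have le: "p \<le> length w" "q \<le> length w" "p + length (enc_nat n) \<le> length w" using at_le[OF n] at_le[OF m] by auto
  {
    assume eq: "n = m"
    have "bitat w (addp w p i) = bitat w (addp w q i)" if "i < length (enc_nat n)" for i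
      using at_nth[OF n that] at_nth[OF m, of i] at_le[OF m] le that eq by (simp add: addp_eq bitat_def)
    moreover have "i < length (enc_nat n)" if "addp w p i < snat w p" for i
      using that le by (simp add: addp_eq snat_at[OF n])
    ultimately show "same w p q" unfolding same_def by blast
  }
  assume same: "same w p q"
  obtain a b where ab: "w = a @ enc_nat m @ b" "length a = q" using m unfolding occurs_at_def by blast
  have *: "bitat w (p + i) = bitat w (min (q + i) (length w))" if "i < length (enc_nat n)" for i
  proof -
    have c: "i < length w" "addp w p i < snat w p" "addp w p i = p + i" "addp w q i = min (q + i) (length w)"
      using that le by (auto simp: addp_eq snat_at[OF n])
    have "\<not> (addp w p i < snat w p \<and> (bitat w (addp w p i) \<and> \<not> bitat w (addp w q i)
        \<or> \<not> bitat w (addp w p i) \<and> bitat w (addp w q i)))"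
      using same c(1) unfolding same_def by blast
    then show ?thesis using c(2) unfolding c(3,4) by blast
  qed
  \<comment> \<open>What is read from \<open>q\<close> on: the encoding of \<open>m\<close>, the
    rest of the input, and then only \<open>False\<close>, because positions saturate at
    \<open>N\<close>, where no bit is set.\<close>
  let ?B = "enc_nat m @ b @ replicate (length (enc_nat n)) False"
  have eq: "enc_nat n ! i = ?B ! i" if "i < length (enc_nat n)" for i
  proof -
    have "enc_nat n ! i = bitat w (p + i)" using at_nth[OF n that] le that by (simp add: bitat_def)
    also have "\<dots> = bitat w (min (q + i) (length w))" by (rule *[OF that])
    also have "\<dots> = ?B ! i"
    proof (cases "q + i < length w")
      case True
      then have "i < length (enc_nat m @ b)" using ab by simp
      then have "?B ! i = (enc_nat m @ b) ! i" by (metis append.assoc nth_append)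
      also have "\<dots> = w ! (q + i)" using nth_append_length_plus[of a "enc_nat m @ b" i] ab by simp
      finally show ?thesis using True by (simp add: bitat_def)
    next
      case False
      then have "length (enc_nat m @ b) \<le> i" using ab by simp
      then have "?B ! i = replicate (length (enc_nat n)) False ! (i - length (enc_nat m @ b))"
        by (metis append.assoc leD nth_append)
      also have "\<dots> = False" using that by simp
      finally show ?thesis using False by (simp add: bitat_def)
    qed
    finally show ?thesis .
  qed
  show "n = m" by (rule enc_nat_prefix[OF eq]) auto
qed

definition nmof :: "bool list \<Rightarrow> nat \<Rightarrow> nat" where
  "nmof w p = (THE v. occurs_at w p (enc_nat v))"

text \<open>The counterpart of \<open>can\<close> on the side of the specification, as a function of
  the name instead of an occurrence; meaningful only for names that occur.\<close>

definition cpos :: "bool list \<Rightarrow> nat \<Rightarrow> nat" where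
  "cpos w v = (LEAST q. occ w q \<and> occurs_at w q (enc_nat v))"

lemma at_enc_nat_unique: "occurs_at w p (enc_nat n) \<Longrightarrow> occurs_at w p (enc_nat m) \<Longrightarrow> n = m"
  using same_iff[of w p n p n] same_iff[of w p n p m] by simp

lemma nmof_eq: "occurs_at w p (enc_nat v) \<Longrightarrow> nmof w p = v"
  unfolding nmof_def by (rule the_equality) (auto dest: at_enc_nat_unique)

locale encoded_input =
  fixes xs :: "nat list" and \<phi> :: "pa_atom bform" and w :: "bool list"
  assumes w: "w = enc_epa (EPA xs \<phi>)"
begin

abbreviation p0 :: nat where "p0 \<equiv> length (enc_list enc_nat xs)"
abbreviation nds :: "(nat \<times> pa_atom bform) list" where "nds \<equiv> nodes enc_pa_atom p0 \<phi>"

lemma at_prefix: "occurs_at w 0 (enc_list enc_nat xs)" and at_body: "occurs_at w p0 (enc_bform enc_pa_atom \<phi>)"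
  and body_length: "p0 + length (enc_bform enc_pa_atom \<phi>) = length w"
  using at_self[of w] by (simp_all add: w at_append)

lemma body_eq: "body w = p0"
  using list_end[OF at_prefix, of "snat w"] by (simp add: body_def snat_at)

lemma nds_at: "(x, \<psi>) \<in> set nds \<Longrightarrow> occurs_at w x (head_enc enc_pa_atom \<psi>)"
  using nodes_at[OF at_body] .

lemma occB_iff: "occB w p \<longleftrightarrow> p \<in> fst ` set (itempos enc_nat 0 xs)"
  unfolding occB_def using list_ex[OF at_prefix, of "snat w" "\<lambda>q. q = p"] by (force simp: snat_at)

lemma occB_name:
  assumes "occB w p"
  shows "\<exists>v\<in>set xs. occurs_at w p (enc_nat v) \<and> 0 < p"
proof -
  obtain v where v: "(p, v) \<in> set (itempos enc_nat 0 xs)" using assms occB_iff by auto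
  then show ?thesis using itempos_at[OF at_prefix v] itempos_gt[OF v] by auto
qed

lemma occB_ex:
  assumes "v \<in> set xs"
  shows "\<exists>p. occB w p \<and> occurs_at w p (enc_nat v)"
proof -
  have "v \<in> snd ` set (itempos enc_nat 0 xs)" using assms by (simp flip: set_map add: map_snd_itempos)
  then obtain p where "(p, v) \<in> set (itempos enc_nat 0 xs)" by auto
  then show ?thesis using itempos_at[OF at_prefix] occB_iff by force
qed

definition lpos :: "nat \<Rightarrow> pa_atom \<Rightarrow> nat" where
  "lpos x a = x + length (enc_nat 2) + length (enc_nat (atom_tag a))"

lemma atom_at:
  assumes "(x, BAtom a) \<in> set nds"
  shows "occurs_at w (x + length (enc_nat 2)) (enc_pa_atom a)" "snat w x = x + length (enc_nat 2)"
    "snat w (snat w x) = lpos x a" "occurs_at w (lpos x a) (enc_lin (atom_lin a))"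
proof -
  have a: "occurs_at w x (enc_nat 2 @ enc_pa_atom a)" using nds_at[OF assms] by simp
  then show 1: "occurs_at w (x + length (enc_nat 2)) (enc_pa_atom a)" "snat w x = x + length (enc_nat 2)"
    by (auto simp: at_append snat_at)
  then show "snat w (snat w x) = lpos x a" "occurs_at w (lpos x a) (enc_lin (atom_lin a))"
    by (cases a; auto simp: lpos_def at_append snat_at)+
qed

abbreviation litems :: "nat \<Rightarrow> lin \<Rightarrow> (nat \<times> int \<times> nat) list" where
  "litems u t \<equiv> itempos (enc_pair enc_int enc_nat) u t"

lemma litems_at:
  assumes "occurs_at w u (enc_lin t)" "(c, a, z) \<in> set (litems u t)"
  shows "occurs_at w c (enc_int a)" "sint w c = c + length (enc_int a)" "occurs_at w (sint w c) (enc_nat z)" "(a, z) \<in> set t"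
    and "u < c"
proof -
  have "occurs_at w c (enc_pair enc_int enc_nat (a, z)) \<and> (a, z) \<in> set t"
    using itempos_at[of w u "enc_pair enc_int enc_nat" t c "(a, z)"] assms unfolding enc_lin_def by blast
  then show "occurs_at w c (enc_int a)" "sint w c = c + length (enc_int a)" "occurs_at w (sint w c) (enc_nat z)" "(a, z) \<in> set t"
    by (auto simp: enc_pair_def at_append sint_at)
  show "u < c" using itempos_gt[OF assms(2)] .
qed

lemma occA_iff: "occA w p \<longleftrightarrow> (\<exists>x a c b z. (x, BAtom a) \<in> set nds \<and> (c, b, z) \<in> set (litems (lpos x a) (atom_lin a))
  \<and> sint w c = p)"
proof -
  let ?R = "\<lambda>x. isatom w x \<and> (\<exists>j<length w. bitat w ((lstep w ^^ j) (snat w (snat w x)))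
      \<and> sint w (sc w ((lstep w ^^ j) (snat w (snat w x)))) = p)"
  have "occA w p \<longleftrightarrow> (\<exists>(x, \<psi>)\<in>set nds. ?R x)"
    unfolding occA_def body_eq
    by (rule nodes_ex[OF at_body body_length]) (auto simp: nnext_at nds_at nnext_top isatom_def bitat_def)
  moreover have "?R x \<longleftrightarrow> (\<exists>a c b z. \<psi> = BAtom a \<and> (c, b, z) \<in> set (litems (lpos x a) (atom_lin a)) \<and> sint w c = p)"
    if "(x, \<psi>) \<in> set nds" for x \<psi>
  proof (cases "\<exists>a. \<psi> = BAtom a")
    case True
    then obtain a where a: "\<psi> = BAtom a" by blast
    note occurs_at = atom_at[OF that[unfolded a]]
    have "(\<exists>j<length w. bitat w ((lstep w ^^ j) (lpos x a)) \<and> sint w (sc w ((lstep w ^^ j) (lpos x a))) = p)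
      \<longleftrightarrow> (\<exists>(c, bz)\<in>set (litems (lpos x a) (atom_lin a)). sint w c = p)"
      unfolding lstep_def by (rule list_ex) (use occurs_at(4) in \<open>auto simp: enc_lin_def item_skip'\<close>)
    then show ?thesis using isatom_at[OF nds_at[OF that]] occurs_at(3) a by auto
  qed (use isatom_at[OF nds_at[OF that]] in auto)
  ultimately show ?thesis by blast
qed

lemma occA_name:
  assumes "occA w p"
  shows "\<exists>a\<in>set (batoms \<phi>). \<exists>v\<in>pa_atom_vars a. occurs_at w p (enc_nat v) \<and> 0 < p"
proof -
  obtain x a c b z where x: "(x, BAtom a) \<in> set nds" "(c, b, z) \<in> set (litems (lpos x a) (atom_lin a))" "sint w c = p"
    using assms occA_iff by blast
  note occurs_at = litems_at[OF atom_at(4)[OF x(1)] x(2)]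
  have "a \<in> set (batoms \<phi>)" using x(1) nodes_atoms[of a enc_pa_atom p0 \<phi>] by force
  moreover have "z \<in> pa_atom_vars a" using occurs_at(4) by (force simp: pa_atom_vars_lin)
  ultimately show ?thesis using occurs_at(2,3,5) x(3) by (intro bexI[of _ a] bexI[of _ z]) auto
qed

lemma occA_ex:
  assumes "a \<in> set (batoms \<phi>)" "v \<in> pa_atom_vars a"
  shows "\<exists>p. occA w p \<and> occurs_at w p (enc_nat v)"
proof -
  obtain x where x: "(x, BAtom a) \<in> set nds" using assms(1) nodes_atoms[of a enc_pa_atom p0 \<phi>] by force
  obtain b where "(b, v) \<in> set (atom_lin a)" using assms(2) by (auto simp: pa_atom_vars_lin)
  then have "(b, v) \<in> snd ` set (litems (lpos x a) (atom_lin a))" by (simp flip: set_map add: map_snd_itempos)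
  then obtain c where c: "(c, b, v) \<in> set (litems (lpos x a) (atom_lin a))" by auto
  then show ?thesis using litems_at(3)[OF atom_at(4)[OF x] c] occA_iff x by blast
qed

lemma occ_name: "occ w p \<Longrightarrow> \<exists>v. occurs_at w p (enc_nat v) \<and> 0 < p"
  unfolding occ_def using occA_name occB_name by blast

lemma cpos_props:
  assumes "occ w p" "occurs_at w p (enc_nat v)"
  shows "occ w (cpos w v)" "occurs_at w (cpos w v) (enc_nat v)" "0 < cpos w v" "cpos w v < length w" "can w p = cpos w v"
proof -
  have *: "occ w (cpos w v) \<and> occurs_at w (cpos w v) (enc_nat v)"
    using LeastI[of "\<lambda>q. occ w q \<and> occurs_at w q (enc_nat v)", OF conjI[OF assms]] unfolding cpos_def .
  then show "occ w (cpos w v)" "occurs_at w (cpos w v) (enc_nat v)" by auto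
  then show "0 < cpos w v" using occ_name by blast
  show lt: "cpos w v < length w" using at_le[of w "cpos w v" "enc_nat v"] * enc_nat_nonempty[of v] by simp
  have eq: "(\<lambda>q. occ w q \<and> same w p q) = (\<lambda>q. occ w q \<and> occurs_at w q (enc_nat v))"
    using same_iff[OF assms(2)] occ_name by blast
  show "can w p = cpos w v" unfolding can_def bleast_def eq using lt * by (auto simp: cpos_def)
qed

lemma bd_iff:
  assumes "occurs_at w p (enc_nat v)"
  shows "bd w p \<longleftrightarrow> v \<in> set xs"
proof
  assume "bd w p"
  then show "v \<in> set xs" unfolding bd_def using same_iff[OF assms] occB_name by blast
next
  assume "v \<in> set xs"
  then obtain q where q: "occB w q" "occurs_at w q (enc_nat v)" using occB_ex by blast
  then have "q < length w" using at_le[of w q "enc_nat v"] enc_nat_nonempty[of v] by simp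
  then show "bd w p" unfolding bd_def using q same_iff[OF assms q(2)] by blast
qed

abbreviation Q :: "nat list" where "Q \<equiv> filter (fc w) [0..<length w]"
abbreviation B :: "nat list" where "B \<equiv> filter (bc w) [0..<length w]"

lemma occ_canonical:
  assumes "occ w q" "can w q = q"
  shows "occurs_at w q (enc_nat (nmof w q))" "cpos w (nmof w q) = q" "0 < q"
proof -
  obtain v where v: "occurs_at w q (enc_nat v)" "0 < q" using occ_name[OF assms(1)] by blast
  then show "occurs_at w q (enc_nat (nmof w q))" "cpos w (nmof w q) = q" "0 < q"
    using nmof_eq[OF v(1)] cpos_props(5)[OF assms(1) v(1)] assms(2) by auto
qed

lemma Q_props:
  assumes "q \<in> set Q"
  shows "occurs_at w q (enc_nat (nmof w q))" "cpos w (nmof w q) = q" "0 < q" "q < length w"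
  using occ_canonical[of q] assms by (auto simp: fc_def occ_def)

lemma B_props:
  assumes "q \<in> set B"
  shows "occurs_at w q (enc_nat (nmof w q))" "cpos w (nmof w q) = q" "0 < q" "q < length w"
  using occ_canonical[of q] assms by (auto simp: bc_def occ_def)

lemma names_Q: "nmof w ` set Q = epa_fv (EPA xs \<phi>)"
proof (intro equalityI subsetI)
  fix v assume "v \<in> nmof w ` set Q"
  then obtain q where q: "occA w q" "can w q = q" "\<not> bd w q" "v = nmof w q" by (auto simp: fc_def)
  then obtain a where "a \<in> set (batoms \<phi>)" "v \<in> pa_atom_vars a" "occurs_at w q (enc_nat v)"
    using occA_name[OF q(1)] nmof_eq by blast
  then show "v \<in> epa_fv (EPA xs \<phi>)" using bd_iff q(3) by auto
next
  fix v assume v: "v \<in> epa_fv (EPA xs \<phi>)"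
  then obtain a where a: "a \<in> set (batoms \<phi>)" "v \<in> pa_atom_vars a" and nx: "v \<notin> set xs" by auto
  then obtain p where p: "occA w p" "occurs_at w p (enc_nat v)" using occA_ex by blast
  then have o: "occ w p" by (simp add: occ_def)
  note c = cpos_props[OF o p(2)]
  have "\<not> bd w (cpos w v)" using bd_iff[OF c(2)] nx by simp
  moreover have "\<not> occB w (cpos w v)" using occB_name nx c(2) nmof_eq by metis
  ultimately have "cpos w v \<in> set Q" using c cpos_props(5)[OF c(1,2)] by (auto simp: fc_def occ_def)
  then show "v \<in> nmof w ` set Q" using nmof_eq[OF c(2)] by force
qed

lemma names_B: "nmof w ` set B = set xs"
proof (intro equalityI subsetI)
  fix v assume "v \<in> nmof w ` set B"
  then obtain q where q: "occ w q" "can w q = q" "bd w q" "v = nmof w q" by (auto simp: bc_def)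
  then show "v \<in> set xs" using occ_canonical(1)[OF q(1,2)] bd_iff by simp
next
  fix v assume v: "v \<in> set xs"
  then obtain p where p: "occB w p" "occurs_at w p (enc_nat v)" using occB_ex by blast
  then have o: "occ w p" by (simp add: occ_def)
  note c = cpos_props[OF o p(2)]
  have "cpos w v \<in> set B" using c cpos_props(5)[OF c(1,2)] bd_iff[OF c(2)] v by (auto simp: bc_def)
  then show "v \<in> nmof w ` set B" using nmof_eq[OF c(2)] by force
qed

lemma distinct_names_Q: "distinct (map (nmof w) Q)"
proof -
  have "inj_on (nmof w) (set Q)"
    by (rule inj_on_inverseI[of _ "cpos w"]) (rule Q_props(2))
  then show ?thesis by (simp add: distinct_map)
qed

end

subsection \<open>Writing the output\<close>

text \<open>Exponents of the single variable with index \<open>p * N + q\<close>; exponents behind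
  the last listed one count as 0. Index 0, with exponents \<open>[1]\<close>, is the denominator
  \<open>e\<close>; \<open>p * N + q\<close> is the coefficient of the free name at \<open>q\<close>
  in the bound name at \<open>p\<close>; \<open>p * N\<close> is the offset of the latter. Names sit
  at positive positions below \<open>N\<close>, so these never collide.\<close>

definition pexp :: "nat \<Rightarrow> nat \<Rightarrow> nat \<Rightarrow> nat list" where
  "pexp N p q = replicate (p * N + q) 0 @ [1]"

text \<open>Contribution of an item \<open>a * z\<close> to the coefficient of the parameter at
  \<open>q\<close> after multiplication by \<open>e\<close>: a bound \<open>z\<close> contributes
  \<open>a * P z y\<close>, a free one \<open>a * e\<close> at its own parameter only. The offsets
  \<open>r z\<close> move to the right-hand side through \<open>rmono\<close>.\<close>

definition bmono :: "nat set \<Rightarrow> (nat \<Rightarrow> nat) \<Rightarrow> nat \<Rightarrow> nat \<Rightarrow> int \<times> nat \<Rightarrow> mpoly" where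
  "bmono X cp N q az = (if snd az \<in> X then [(fst az, pexp N (cp (snd az)) q)]
    else if cp (snd az) = q then [(fst az, [1])] else [])"

definition rmono :: "nat set \<Rightarrow> (nat \<Rightarrow> nat) \<Rightarrow> nat \<Rightarrow> int \<times> nat \<Rightarrow> mpoly" where
  "rmono X cp N az = (if snd az \<in> X then [(fst az, pexp N (cp (snd az)) 0)] else [])"

definition coef :: "nat set \<Rightarrow> (nat \<Rightarrow> nat) \<Rightarrow> nat \<Rightarrow> lin \<Rightarrow> nat \<Rightarrow> mpoly" where
  "coef X cp N t q = concat (map (bmono X cp N q) t)"

definition rhs :: "nat set \<Rightarrow> (nat \<Rightarrow> nat) \<Rightarrow> nat \<Rightarrow> lin \<Rightarrow> int \<Rightarrow> mpoly" where
  "rhs X cp N t b = (b, [1]) # concat (map (rmono X cp N) t)"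

fun batom :: "nat set \<Rightarrow> (nat \<Rightarrow> nat) \<Rightarrow> nat \<Rightarrow> nat list \<Rightarrow> pa_atom \<Rightarrow> bpa_atom" where
  "batom X cp N Q (LinLe t b) = PolyLe (map (coef X cp N t) Q) (rhs X cp N t b)"
| "batom X cp N Q (LinCong t b m) = PolyCong (map (coef X cp N t) Q) (rhs X cp N t b) [(m, [1])]"

definition integrality :: "nat \<Rightarrow> nat list \<Rightarrow> nat \<Rightarrow> bpa_atom" where
  "integrality N Q p = PolyCong (map (\<lambda>q. [(1, pexp N p q)]) Q) [(1, pexp N p 0)] [(1, [1])]"

text \<open>\<open>(-1, [])\<close> is the constant monomial -1, so the atom says
  \<open>0 \<le> e - 1\<close>. The zero polynomials on the left provide the required arity.\<close>

definition positivity :: "nat list \<Rightarrow> bpa_atom" where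
  "positivity Q = PolyLe (map (\<lambda>_. []) Q) [(1, [1]), (-1, [])]"

definition bounded_form :: "nat set \<Rightarrow> (nat \<Rightarrow> nat) \<Rightarrow> nat \<Rightarrow> nat list \<Rightarrow> nat list \<Rightarrow> var list \<Rightarrow> pa_atom bform \<Rightarrow> bpa" where
  "bounded_form X cp N Q B ys \<phi> = BPA (replicate (N * N) (2 ^ (N ^ 6) - 1)) ys
    (BAnd (BAtom (positivity Q)) (foldr (\<lambda>p. BAnd (BAtom (integrality N Q p))) B (map_bform (batom X cp N Q) \<phi>)))"

definition copy :: "bool list \<Rightarrow> nat \<Rightarrow> nat \<Rightarrow> bool list" where
  "copy w x y = concat (map (\<lambda>i. if \<not> i < x \<and> i < y then if bitat w i then [True] else [False] else []) [0..<length w])"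

text \<open>The loops spell out \<open>p * N + q\<close> zero exponents; the last five bits are the
  exponent 1 and the end of the list.\<close>

definition gexp :: "bool list \<Rightarrow> nat \<Rightarrow> nat \<Rightarrow> bool list" where
  "gexp w p q = concat (map (\<lambda>_. concat (map (\<lambda>_. [True, False]) [0..<length w])) [0..<p])
    @ concat (map (\<lambda>_. [True, False]) [0..<q]) @ [True, True, True, False, False]"

definition gmono :: "bool list \<Rightarrow> nat \<Rightarrow> nat \<Rightarrow> bool list" where
  "gmono w q c = (if bd w (sint w c) then True # copy w c (sint w c) @ gexp w (can w (sint w c)) q
    else if can w (sint w c) = q then True # copy w c (sint w c) @ [True, True, True, False, False] else [])"

definition grmono :: "bool list \<Rightarrow> nat \<Rightarrow> bool list" where
  "grmono w c = (if bd w (sint w c) then True # copy w c (sint w c) @ gexp w (can w (sint w c)) 0 else [])"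

definition gcoef :: "bool list \<Rightarrow> nat \<Rightarrow> nat \<Rightarrow> bool list" where
  "gcoef w u q = concat (map (\<lambda>k. if bitat w ((lstep w ^^ k) u) then gmono w q (sc w ((lstep w ^^ k) u)) else [])
    [0..<length w]) @ [False]"

definition grhs :: "bool list \<Rightarrow> nat \<Rightarrow> nat \<Rightarrow> bool list" where
  "grhs w u b = True # copy w b (sint w b) @ [True, True, True, False, False] @
    concat (map (\<lambda>k. if bitat w ((lstep w ^^ k) u) then grmono w (sc w ((lstep w ^^ k) u)) else [])
    [0..<length w]) @ [False]"

definition gatom :: "bool list \<Rightarrow> nat \<Rightarrow> bool list" where
  "gatom w y = copy w y (snat w y) @
    concat (map (\<lambda>q. if fc w q then True # gcoef w (snat w y) q else []) [0..<length w]) @ [False] @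
    grhs w (snat w y) (slin w (snat w y)) @
    (if bitat w y then True # copy w (sint w (slin w (snat w y))) (sint w (sint w (slin w (snat w y))))
      @ [True, True, True, False, False, False] else [])"

definition gbody :: "bool list \<Rightarrow> bool list" where
  "gbody w = concat (map (\<lambda>k. if (nnext w ^^ k) (body w) \<noteq> length w then
      copy w ((nnext w ^^ k) (body w)) (snat w ((nnext w ^^ k) (body w))) @
      (if isatom w ((nnext w ^^ k) (body w)) then gatom w (snat w ((nnext w ^^ k) (body w))) else []) else [])
    [0..<length w])"

text \<open>The leading \<open>enc_nat 4\<close> is a conjunction whose second argument is whatever
  is written next; in prefix notation nothing has to be closed.\<close>

definition gpositivity :: "bool list \<Rightarrow> bool list" where
  "gpositivity w = enc_nat 4 @ enc_nat 2 @ enc_nat 0 @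
    concat (map (\<lambda>q. if fc w q then [True, False] else []) [0..<length w]) @ [False] @
    enc_mpoly [(1, [1]), (-1, [])]"

definition gintegrality :: "bool list \<Rightarrow> nat \<Rightarrow> bool list" where
  "gintegrality w p = enc_nat 4 @ enc_nat 2 @ enc_nat 1 @
    concat (map (\<lambda>q. if fc w q then True # True # enc_int 1 @ gexp w p q @ [False] else []) [0..<length w]) @ [False] @
    (True # enc_int 1 @ gexp w p 0 @ [False]) @ enc_mpoly [(1, [1])]"

text \<open>The encoding of \<open>2 ^ k - 1\<close> consists of \<open>k\<close> such pairs and a
  terminator; \<open>d\<close> nested loops write \<open>N ^ d\<close> pairs.\<close>

primrec ones :: "bool list \<Rightarrow> nat \<Rightarrow> bool list" where
  "ones w 0 = [True, True]"
| "ones w (Suc d) = concat (map (\<lambda>_. ones w d) [0..<length w])"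

definition write_bpa :: "bool list \<Rightarrow> bool list" where
  "write_bpa w = concat (map (\<lambda>_. concat (map (\<lambda>_. True # ones w 6 @ [False]) [0..<length w])) [0..<length w]) @ [False] @
    concat (map (\<lambda>q. if fc w q then True # copy w q (snat w q) else []) [0..<length w]) @ [False] @
    gpositivity w @ concat (map (\<lambda>p. if bc w p then gintegrality w p else []) [0..<length w]) @ gbody w"

section \<open>Definability of the reading functions and generators\<close>

lemma tn_less [cn_intros]:
  assumes "cn a" "cn b"
  shows "tn (\<lambda>w e. a w e < b w e)"
proof -
  have "tn (\<lambda>w e. \<exists>i<e 1. i = e 0)" by (intro cn_intros)
  then have "tn (\<lambda>w e. e 0 < e (Suc 0))" by simp
  from tn_app2[where f = "\<lambda>w a b. a < b", OF this assms] show ?thesis .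
qed

lemma cn_snat [cn_intros]: "cn a \<Longrightarrow> cn (\<lambda>w e. snat w (a w e))"
  by (rule cn_app1[where f = snat]) (unfold snat_def, intro cn_intros)

lemma cn_sint [cn_intros]: "cn a \<Longrightarrow> cn (\<lambda>w e. sint w (a w e))"
  unfolding sint_def by (intro cn_intros)

lemma cn_lstep [cn_intros]: "cn a \<Longrightarrow> cn (\<lambda>w e. lstep w (a w e))"
  by (rule cn_app1[where f = lstep]) (unfold lstep_def lnext_def, intro cn_intros)

lemma cn_slin [cn_intros]: "cn a \<Longrightarrow> cn (\<lambda>w e. slin w (a w e))"
  unfolding slin_def lstep_def[symmetric] by (intro cn_intros)

lemma tn_isatom [cn_intros]: "cn a \<Longrightarrow> tn (\<lambda>w e. isatom w (a w e))"
  unfolding isatom_def by (intro cn_intros)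

lemma cn_nnext [cn_intros]: "cn a \<Longrightarrow> cn (\<lambda>w e. nnext w (a w e))"
  unfolding nnext_def by (intro cn_intros)

lemma cn_lnext_snat [cn_intros]: "cn a \<Longrightarrow> cn (\<lambda>w e. lnext w (snat w) (a w e))"
  unfolding lnext_def by (intro cn_intros)

lemma cn_body [cn_intros]: "cn (\<lambda>w e. body w)"
  unfolding body_def by (intro cn_intros)

lemma tn_occB [cn_intros]: "cn a \<Longrightarrow> tn (\<lambda>w e. occB w (a w e))"
  by (rule tn_app1[where f = occB]) (unfold occB_def, intro cn_intros)

lemma tn_occA [cn_intros]: "cn a \<Longrightarrow> tn (\<lambda>w e. occA w (a w e))"
  by (rule tn_app1[where f = occA]) (unfold occA_def, intro cn_intros)

lemma tn_occ [cn_intros]: "cn a \<Longrightarrow> tn (\<lambda>w e. occ w (a w e))"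
  unfolding occ_def by (intro cn_intros)

lemma cn_addp [cn_intros]: "cn a \<Longrightarrow> cn b \<Longrightarrow> cn (\<lambda>w e. addp w (a w e) (b w e))"
  unfolding addp_def by (intro cn_intros)

lemma tn_same [cn_intros]: "cn a \<Longrightarrow> cn b \<Longrightarrow> tn (\<lambda>w e. same w (a w e) (b w e))"
  by (rule tn_app2[where f = same]) (unfold same_def, intro cn_intros)

lemma cn_can [cn_intros]: "cn a \<Longrightarrow> cn (\<lambda>w e. can w (a w e))"
  by (rule cn_app1[where f = can]) (unfold can_def, intro cn_intros)

lemma tn_bd [cn_intros]: "cn a \<Longrightarrow> tn (\<lambda>w e. bd w (a w e))"
  by (rule tn_app1[where f = bd]) (unfold bd_def, intro cn_intros)

lemma tn_fc [cn_intros]: "cn a \<Longrightarrow> tn (\<lambda>w e. fc w (a w e))"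
  unfolding fc_def by (intro cn_intros)

lemma tn_bc [cn_intros]: "cn a \<Longrightarrow> tn (\<lambda>w e. bc w (a w e))"
  unfolding bc_def by (intro cn_intros)

lemma gn_copy [cn_intros]: "cn a \<Longrightarrow> cn b \<Longrightarrow> gn (\<lambda>w e. copy w (a w e) (b w e))"
  by (rule gn_app2[where f = copy]) (unfold copy_def, intro cn_intros)

lemma gn_gexp [cn_intros]: "cn a \<Longrightarrow> cn b \<Longrightarrow> gn (\<lambda>w e. gexp w (a w e) (b w e))"
  by (rule gn_app2[where f = gexp]) (unfold gexp_def, intro cn_intros)

lemma gn_gmono [cn_intros]: "cn a \<Longrightarrow> cn b \<Longrightarrow> gn (\<lambda>w e. gmono w (a w e) (b w e))"
  unfolding gmono_def by (intro cn_intros)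

lemma gn_grmono [cn_intros]: "cn a \<Longrightarrow> gn (\<lambda>w e. grmono w (a w e))"
  unfolding grmono_def by (intro cn_intros)

lemma gn_gcoef [cn_intros]: "cn a \<Longrightarrow> cn b \<Longrightarrow> gn (\<lambda>w e. gcoef w (a w e) (b w e))"
  by (rule gn_app2[where f = gcoef]) (unfold gcoef_def, intro cn_intros)

lemma gn_grhs [cn_intros]: "cn a \<Longrightarrow> cn b \<Longrightarrow> gn (\<lambda>w e. grhs w (a w e) (b w e))"
  by (rule gn_app2[where f = grhs]) (unfold grhs_def, intro cn_intros)

lemma gn_gatom [cn_intros]: "cn a \<Longrightarrow> gn (\<lambda>w e. gatom w (a w e))"
  by (rule gn_app1[where f = gatom]) (unfold gatom_def, intro cn_intros)

lemma gn_gbody [cn_intros]: "gn (\<lambda>w e. gbody w)"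
  unfolding gbody_def by (intro cn_intros)

lemma gn_gintegrality [cn_intros]: "cn a \<Longrightarrow> gn (\<lambda>w e. gintegrality w (a w e))"
  by (rule gn_app1[where f = gintegrality]) (unfold gintegrality_def, intro cn_intros)

lemma gn_gpositivity [cn_intros]: "gn (\<lambda>w e. gpositivity w)"
  unfolding gpositivity_def by (intro cn_intros)

lemma gn_ones [cn_intros]: "gn (\<lambda>w e. ones w d)"
  by (induction d) (auto intro!: cn_intros)

lemma gn_write_bpa: "gn (\<lambda>w e. write_bpa w)"
  unfolding write_bpa_def by (intro cn_intros)

section \<open>Agreement of the generators with the encoding of the bounded formula\<close>

lemma copy_at:
  assumes "occurs_at w x u"
  shows "copy w x (x + length u) = u"
proof -
  obtain a b where w: "w = a @ u @ b" "length a = x" using assms unfolding occurs_at_def by blast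
  let ?f = "\<lambda>i. if \<not> i < x \<and> i < x + length u then if bitat w i then [True] else [False] else []"
  have split: "[0..<length w] = [0..<x] @ [x..<x + length u] @ [x + length u..<length w]"
    using w by (metis (no_types, lifting) add.assoc le_add1 length_append upt_add_eq_append zero_le)
  have 1: "concat (map ?f [0..<x]) = []" "concat (map ?f [x + length u..<length w]) = []"
    by (auto simp: concat_eq_Nil_conv)
  have 2: "concat (map ?f [x..<x + length u]) = u"
  proof -
    have "map ?f [x..<x + length u] = map (\<lambda>b. [b]) u"
      using at_nth[OF assms] at_le[OF assms] by (intro nth_equalityI) (auto simp: bitat_def)
    then show ?thesis by simp
  qed
  show ?thesis unfolding copy_def split map_append concat_append 1 2 by simp
qed

lemma concat_const_upt: "concat (map (\<lambda>_. xs) [0..<n]) = concat (replicate n xs)"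
  by (simp add: map_replicate_const)

lemma gexp_eq: "gexp w p q = enc_list enc_nat (pexp (length w) p q)"
proof -
  have 1: "enc_list enc_nat (replicate n 0 @ [1]) = concat (replicate n [True, False]) @ [True, True, True, False, False]" for n
    by (induction n) (auto simp: enc_list_simps enc_nat_0 enc_nat_tags)
  have 2: "concat (replicate p (concat (replicate n [True, False]))) = concat (replicate (p * n) [True, False])" for p n
    by (induction p) (auto simp: replicate_add)
  show ?thesis unfolding pexp_def 1 by (simp add: gexp_def concat_const_upt replicate_add 2)
qed

lemma enc_list_filter:
  "concat (map (\<lambda>q. if P q then True # f (g q) else []) qs) @ [False] = enc_list f (map g (filter P qs))"
  by (induction qs) (auto simp: enc_list_simps)

lemma enc_list_concat:
  "enc_list f (concat (map g qs)) = concat (map (\<lambda>q. butlast (enc_list f (g q))) qs) @ [False]"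
  by (induction qs) (auto simp: enc_list_def)

lemma ones_eq: "ones w d = concat (replicate (length w ^ d) [True, True])"
proof (induction d)
  case (Suc d)
  have "concat (replicate p (concat (replicate n [True, True]))) = concat (replicate (p * n) [True, True])" for p n
    by (induction p) (auto simp: replicate_add)
  then show ?case by (simp add: Suc concat_const_upt)
qed simp

lemma enc_nat_mersenne: "enc_nat (2 ^ k - 1) = concat (replicate k [True, True]) @ [False]"
proof (induction k)
  case (Suc k)
  obtain m where m: "(2::nat) ^ k = Suc m" by (cases "(2::nat) ^ k") auto
  then show ?case using Suc by (simp add: enc_nat_pos)
qed (simp add: enc_nat_0)

context encoded_input
begin

abbreviation "N \<equiv> length w"
abbreviation "tr \<equiv> batom (set xs) (cpos w) N Q"

lemma enc_item: "butlast (enc_list (enc_pair enc_int (enc_list enc_nat)) [(c, es)]) = True # enc_int c @ enc_list enc_nat es"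
  by (simp add: enc_list_simps enc_pair_def butlast_append)

lemma enc_unit_exp: "enc_list enc_nat [1] = [True, True, True, False, False]"
  by (simp add: enc_list_simps enc_nat_tags)

lemma litem_at:
  assumes "(x, BAtom a) \<in> set nds" "(c, b, z) \<in> set (litems (lpos x a) (atom_lin a))"
  shows "copy w c (sint w c) = enc_int b" "bd w (sint w c) \<longleftrightarrow> z \<in> set xs" "can w (sint w c) = cpos w z"
proof -
  note occurs_at = litems_at[OF atom_at(4)[OF assms(1)] assms(2)]
  show "copy w c (sint w c) = enc_int b" using copy_at[OF occurs_at(1)] occurs_at(2) by simp
  show "bd w (sint w c) \<longleftrightarrow> z \<in> set xs" by (rule bd_iff[OF occurs_at(3)])
  have "occ w (sint w c)" using assms occA_iff unfolding occ_def by blast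
  then show "can w (sint w c) = cpos w z" using cpos_props(5) occurs_at(3) by blast
qed

lemma lin_loop:
  assumes "(x, BAtom a) \<in> set nds"
    and "\<And>c b z. (c, b, z) \<in> set (litems (lpos x a) (atom_lin a)) \<Longrightarrow> g c = h (b, z)"
  shows "concat (map (\<lambda>k. if bitat w ((lstep w ^^ k) (lpos x a)) then g (sc w ((lstep w ^^ k) (lpos x a))) else []) [0..<N])
    = concat (map h (atom_lin a))"
proof -
  have "concat (map (\<lambda>k. if bitat w ((lstep w ^^ k) (lpos x a)) then g (sc w ((lstep w ^^ k) (lpos x a))) else []) [0..<N])
    = concat (map (\<lambda>(q, x). g q) (litems (lpos x a) (atom_lin a)))"
    unfolding lstep_def by (rule list_loop) (use atom_at(4)[OF assms(1)] item_skip' in \<open>auto simp: enc_lin_def\<close>)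
  also have "\<dots> = concat (map (h \<circ> snd) (litems (lpos x a) (atom_lin a)))"
    using assms(2) by (intro arg_cong[where f = concat] map_cong) auto
  also have "\<dots> = concat (map h (atom_lin a))" by (simp only: map_map[symmetric] map_snd_itempos)
  finally show ?thesis .
qed

lemma gcoef_eq:
  assumes "(x, BAtom a) \<in> set nds"
  shows "gcoef w (lpos x a) q = enc_mpoly (coef (set xs) (cpos w) N (atom_lin a) q)"
  unfolding gcoef_def coef_def enc_mpoly_def enc_list_concat
  by (subst lin_loop[OF assms, where h = "\<lambda>q'. butlast (enc_list (enc_pair enc_int (enc_list enc_nat)) (bmono (set xs) (cpos w) N q q'))"])
    (auto simp: gmono_def bmono_def litem_at[OF assms] gexp_eq enc_item enc_unit_exp enc_list_simps(1) enc_pair_def simp del: One_nat_def)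

lemma grhs_eq:
  assumes "(x, BAtom a) \<in> set nds" "occurs_at w v (enc_int b)"
  shows "grhs w (lpos x a) v = enc_mpoly (rhs (set xs) (cpos w) N (atom_lin a) b)"
proof -
  have "copy w v (sint w v) = enc_int b" using copy_at[OF assms(2)] sint_at[OF assms(2)] by simp
  then show ?thesis
    unfolding grhs_def rhs_def enc_mpoly_def enc_list_simps(2) enc_list_concat
    by (subst lin_loop[OF assms(1), where h = "\<lambda>q'. butlast (enc_list (enc_pair enc_int (enc_list enc_nat)) (rmono (set xs) (cpos w) N q'))"])
      (auto simp: grmono_def rmono_def litem_at[OF assms(1)] gexp_eq enc_item enc_unit_exp enc_list_simps(1) enc_pair_def simp del: One_nat_def)
qed

lemma gatom_eq:
  assumes x: "(x, BAtom a) \<in> set nds"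
  shows "gatom w (snat w x) = enc_bpa_atom (tr a)"
proof -
  define y where "y = snat w x"
  note occurs_at = atom_at[OF x, folded y_def]
  have y: "occurs_at w y (enc_pa_atom a)" using occurs_at(1,2) by simp
  have q: "concat (map (\<lambda>q. if fc w q then True # gcoef w (snat w y) q else []) [0..<length w]) @ [False]
      = enc_list enc_mpoly (map (coef (set xs) (cpos w) N (atom_lin a)) Q)"
    unfolding occurs_at(3) gcoef_eq[OF x] by (rule enc_list_filter)
  have b: "slin w (snat w y) = lpos x a + length (enc_lin (atom_lin a))"
    unfolding occurs_at(3) by (rule slin_at[OF occurs_at(4)])
  have l: "lpos x a = y + length (enc_nat (atom_tag a))" using occurs_at(2) by (simp add: lpos_def)
  have q': "concat (map (\<lambda>q. if fc w q then True # gcoef w (snat w y) q else []) [0..<length w]) @ [False] @ r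
      = enc_list enc_mpoly (map (coef (set xs) (cpos w) N (atom_lin a)) Q) @ r" for r
    by (simp only: append_assoc[symmetric] q)
  show ?thesis
  proof (cases a)
    case (LinLe t c)
    have 1: "occurs_at w y (enc_nat 0)" "occurs_at w (slin w (snat w y)) (enc_int c)"
      using y b l by (auto simp: LinLe at_append add.assoc)
    have "\<not> bitat w y" using 1(1) by (simp add: enc_nat_0 bitat_at)
    moreover have "copy w y (snat w y) = enc_nat 0" using copy_at[OF 1(1)] snat_at[OF 1(1)] by simp
    moreover have "grhs w (snat w y) (slin w (snat w y)) = enc_mpoly (rhs (set xs) (cpos w) N t c)"
      using grhs_eq[OF x 1(2)] occurs_at(3) by (simp add: LinLe)
    ultimately show ?thesis unfolding gatom_def y_def[symmetric] q' by (simp add: LinLe)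
  next
    case (LinCong t c m)
    have 1: "occurs_at w y (enc_nat 1)" "occurs_at w (slin w (snat w y)) (enc_int c)" "occurs_at w (slin w (snat w y) + length (enc_int c)) (enc_int m)"
      using y b l by (auto simp: LinCong at_append add.assoc)
    have "bitat w y" using 1(1) by (simp add: enc_nat_tags bitat_at)
    moreover have "copy w y (snat w y) = enc_nat 1" using copy_at[OF 1(1)] snat_at[OF 1(1)] by simp
    moreover have "copy w (sint w (slin w (snat w y))) (sint w (sint w (slin w (snat w y)))) = enc_int m"
      using copy_at[OF 1(3)] sint_at[OF 1(2)] sint_at[OF 1(3)] by simp
    moreover have "grhs w (snat w y) (slin w (snat w y)) = enc_mpoly (rhs (set xs) (cpos w) N t c)"
      using grhs_eq[OF x 1(2)] occurs_at(3) by (simp add: LinCong)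
    ultimately show ?thesis unfolding gatom_def y_def[symmetric] q'
      by (simp add: LinCong) (simp add: enc_mpoly_def enc_list_simps enc_pair_def enc_nat_tags)
  qed
qed

lemma gbody_eq: "gbody w = enc_bform enc_bpa_atom (map_bform tr \<phi>)"
proof -
  let ?G = "\<lambda>x. if x \<noteq> length w then copy w x (snat w x) @ (if isatom w x then gatom w (snat w x) else []) else []"
  have "gbody w = concat (map (\<lambda>(x, \<psi>). ?G x) nds)"
    unfolding gbody_def body_eq
    by (rule nodes_loop[where G = ?G, OF at_body body_length]) (auto simp: nnext_at nds_at nnext_top)
  also have "\<dots> = concat (map (\<lambda>(x, \<psi>). head_enc (\<lambda>a. enc_bpa_atom (tr a)) \<psi>) nds)"
  proof (intro arg_cong[where f = concat] map_cong refl, clarify)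
    fix x \<psi> assume m: "(x, \<psi>) \<in> set nds"
    note h = nds_at[OF m]
    have "head_enc enc_pa_atom \<psi> \<noteq> []" using enc_nat_nonempty by (cases \<psi>) (auto simp: Suc_le_eq)
    then have ne: "x \<noteq> length w" using at_le[OF h] by auto
    show "?G x = head_enc (\<lambda>a. enc_bpa_atom (tr a)) \<psi>"
    proof (cases "\<exists>a. \<psi> = BAtom a")
      case True
      then obtain a where a: "\<psi> = BAtom a" by blast
      have "occurs_at w x (enc_nat 2)" using h by (simp add: a at_append)
      then have "copy w x (snat w x) = enc_nat 2" by (simp add: snat_at copy_at)
      then show ?thesis using ne isatom_at[OF h] gatom_eq[OF m[unfolded a]] a by simp
    next
      case False
      then have "copy w x (snat w x) = head_enc (\<lambda>a. enc_bpa_atom (tr a)) \<psi>"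
        using h by (cases \<psi>) (auto simp: snat_at copy_at)
      then show ?thesis using ne isatom_at[OF h] False by simp
    qed
  qed
  also have "\<dots> = enc_bform enc_bpa_atom (map_bform tr \<phi>)" by (rule concat_head_enc)
  finally show ?thesis .
qed

lemma gintegrality_eq:
  "gintegrality w p = enc_nat 4 @ enc_bform enc_bpa_atom (BAtom (integrality N Q p))"
proof -
  have "concat (map (\<lambda>q. if fc w q then True # True # enc_int 1 @ gexp w p q @ [False] else []) [0..<length w]) @ [False]
    = enc_list enc_mpoly (map (\<lambda>q. [(1, pexp N p q)]) Q)"
    unfolding enc_list_filter[symmetric] gexp_eq by (simp add: enc_mpoly_def enc_list_simps enc_pair_def cong: if_cong)
  then show ?thesis
    by (simp add: gintegrality_def integrality_def gexp_eq) (simp add: enc_mpoly_def enc_list_simps enc_pair_def)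
qed

lemma gpositivity_eq: "gpositivity w = enc_nat 4 @ enc_bform enc_bpa_atom (BAtom (positivity Q))"
proof -
  have "concat (map (\<lambda>q. if fc w q then [True, False] else []) [0..<length w]) @ [False]
    = enc_list enc_mpoly (map (\<lambda>_. []) Q)"
    unfolding enc_list_filter[symmetric] by (simp add: enc_mpoly_def enc_list_simps cong: if_cong)
  then show ?thesis by (simp add: gpositivity_def positivity_def)
qed

lemma write_bpa_eq: "write_bpa w = enc_bpa (bounded_form (set xs) (cpos w) N Q B (map (nmof w) Q) \<phi>)"
proof -
  have ks: "concat (map (\<lambda>_. concat (map (\<lambda>_. True # ones w 6 @ [False]) [0..<N])) [0..<N]) @ [False]
    = enc_list enc_nat (replicate (N * N) (2 ^ (N ^ 6) - 1))"
  proof -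
    have "concat (replicate p (concat (replicate n (us::bool list)))) = concat (replicate (p * n) us)" for p n us
      by (induction p) (auto simp: replicate_add)
    moreover have "enc_list enc_nat (replicate k v) = concat (replicate k (True # enc_nat v)) @ [False]" for k v
      by (induction k) (auto simp: enc_list_simps)
    ultimately show ?thesis by (simp add: concat_const_upt enc_nat_mersenne[unfolded One_nat_def] ones_eq)
  qed
  have "copy w q (snat w q) = enc_nat (nmof w q)" if "q \<in> set Q" for q
    using Q_props(1)[OF that] by (simp add: snat_at copy_at)
  then have ys: "concat (map (\<lambda>q. if fc w q then True # copy w q (snat w q) else []) [0..<N]) @ [False]
    = enc_list enc_nat (map (nmof w) Q)"
    unfolding enc_list_filter[symmetric] by (intro arg_cong2[where f = append] arg_cong[where f = concat] map_cong) auto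
  have fold: "concat (map (\<lambda>p. if P p then gintegrality w p else []) ps) @ enc_bform enc_bpa_atom \<psi>
    = enc_bform enc_bpa_atom (foldr (\<lambda>p. BAnd (BAtom (integrality N Q p))) (filter P ps) \<psi>)" for P ps \<psi>
    by (induction ps) (auto simp: gintegrality_eq)
  show ?thesis
    unfolding write_bpa_def bounded_form_def enc_bpa.simps enc_bform.simps(5) gpositivity_eq gbody_eq
      ks[symmetric] ys[symmetric] fold[symmetric] by simp
qed

end

subsection \<open>A small model property\<close>

text \<open>A variable may occur several times in a term, so its coefficient is a sum.\<close>

definition lcoef :: "lin \<Rightarrow> nat \<Rightarrow> int" where
  "lcoef t z = (\<Sum>(a, y)\<leftarrow>t. if y = z then a else 0)"

definition lnorm :: "lin \<Rightarrow> int" where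
  "lnorm t = (\<Sum>(a, y)\<leftarrow>t. \<bar>a\<bar>)"

lemma lin_eval_lcoef:
  assumes "finite S" "set (map snd t) \<subseteq> S"
  shows "lin_eval \<mu> t = (\<Sum>z\<in>S. lcoef t z * \<mu> z)"
  using assms(2)
proof (induction t)
  case (Cons ay t)
  obtain a y where ay: "ay = (a, y)" by (cases ay)
  have "(\<Sum>z\<in>S. lcoef (ay # t) z * \<mu> z) = (\<Sum>z\<in>S. (if y = z then a * \<mu> y else 0) + lcoef t z * \<mu> z)"
    by (intro sum.cong) (auto simp: lcoef_def ay algebra_simps)
  also have "\<dots> = a * \<mu> y + (\<Sum>z\<in>S. lcoef t z * \<mu> z)"
    using Cons.prems assms(1) by (simp add: sum.distrib ay)
  finally show ?case using Cons by (simp add: ay)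
qed (simp add: lcoef_def)

lemma sum_lcoef_le: "finite S \<Longrightarrow> (\<Sum>z\<in>S. \<bar>lcoef t z\<bar>) \<le> lnorm t"
proof (induction t)
  case (Cons ay t)
  obtain a y where ay: "ay = (a, y)" by (cases ay)
  have "(\<Sum>z\<in>S. \<bar>lcoef (ay # t) z\<bar>) \<le> (\<Sum>z\<in>S. (if y = z then \<bar>a\<bar> else 0) + \<bar>lcoef t z\<bar>)"
    by (intro sum_mono) (auto simp: lcoef_def ay)
  also have "\<dots> \<le> \<bar>a\<bar> + (\<Sum>z\<in>S. \<bar>lcoef t z\<bar>)" using Cons.prems by (simp add: sum.distrib)
  finally show ?case using Cons by (simp add: ay lnorm_def)
qed (simp add: lcoef_def lnorm_def)

lemma lcoef_le: "\<bar>lcoef t z\<bar> \<le> lnorm t"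
  using sum_lcoef_le[of "{z}" t] by simp

lemma lnorm_nonneg: "0 \<le> lnorm t"
  using lcoef_le[of t 0] by linarith

text \<open>The constant 2 pays for shifted right-hand sides: the negation of
  \<open>t \<le> b\<close> has \<open>- b - 1\<close>, and an equation (a congruence modulo 0) needs
  the same for \<open>b - 1\<close> in place of \<open>b\<close>.\<close>

fun atom_norm :: "pa_atom \<Rightarrow> int" where
  "atom_norm (LinLe t b) = lnorm t + \<bar>b\<bar> + 2"
| "atom_norm (LinCong t b m) = lnorm t + \<bar>b\<bar> + 2"

text \<open>A congruence modulo 0 is an equation; it is preserved through inequalities and not
  through residues, hence the factor 1.\<close>

fun atom_mod :: "pa_atom \<Rightarrow> int" where
  "atom_mod (LinLe t b) = 1"
| "atom_mod (LinCong t b m) = (if m = 0 then 1 else \<bar>m\<bar>)"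

lemma atom_mod_ge: "1 \<le> atom_mod a"
  by (cases a) auto

lemma exists_prefix_iff:
  "exists_prefix xs P \<nu> \<longleftrightarrow> (\<exists>\<mu>. (\<forall>z. z \<notin> set xs \<longrightarrow> \<mu> z = \<nu> z) \<and> P \<mu>)"
proof (induction xs arbitrary: \<nu>)
  case Nil
  show ?case by (auto simp flip: fun_eq_iff)
next
  case (Cons x xs)
  show ?case unfolding exists_prefix.simps Cons
  proof safe
    fix v \<mu> assume "\<forall>z. z \<notin> set xs \<longrightarrow> \<mu> z = (\<nu>(x := v)) z" "P \<mu>"
    then show "\<exists>\<mu>. (\<forall>z. z \<notin> set (x # xs) \<longrightarrow> \<mu> z = \<nu> z) \<and> P \<mu>" by (intro exI[of _ \<mu>]) auto
  next
    fix \<mu> assume "\<forall>z. z \<notin> set (x # xs) \<longrightarrow> \<mu> z = \<nu> z" "P \<mu>"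
    then show "\<exists>v \<mu>. (\<forall>z. z \<notin> set xs \<longrightarrow> \<mu> z = (\<nu>(x := v)) z) \<and> P \<mu>"
      by (intro exI[of _ "\<mu> x"] exI[of _ \<mu>]) auto
  qed
qed

lemma beval_cong: "(\<And>a. a \<in> set (batoms \<phi>) \<Longrightarrow> I a = J a) \<Longrightarrow> beval I \<phi> = beval J \<phi>"
  by (induction \<phi>) auto

lemma beval_map: "beval I (map_bform f \<phi>) = beval (\<lambda>a. I (f a)) \<phi>"
  by (induction \<phi>) auto

lemma batoms_map: "batoms (map_bform f \<phi>) = map f (batoms \<phi>)"
  by (induction \<phi>) auto

text \<open>Writing every bound variable as \<open>M u + \<rho>\<close>, for \<open>M\<close> a common multiple of the moduli, freezes all
  congruences. All linear inequalities with small coefficients that hold at \<open>u\<close> are kept.\<close>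
lemma small_model:
  fixes \<mu> :: "nat \<Rightarrow> int" and H M :: int
  assumes fin: "finite X" "finite Y" "X \<inter> Y = {}"
    and vars: "\<And>a. a \<in> set (batoms \<phi>) \<Longrightarrow> pa_atom_vars a \<subseteq> X \<union> Y"
    and M: "1 \<le> M" "\<And>a. a \<in> set (batoms \<phi>) \<Longrightarrow> atom_mod a dvd M"
    and H: "\<And>a. a \<in> set (batoms \<phi>) \<Longrightarrow> M * atom_norm a + atom_norm a \<le> H" "1 \<le> H"
    and F: "F = fact (card X) * H ^ card X"
  obtains e P r where "1 \<le> e" "e \<le> F" "\<And>z y. \<bar>P z y\<bar> \<le> M * (int (card X) * (F * H))"
    "\<And>z. \<bar>r z\<bar> \<le> M * (int (card X) * (F * (H + F))) + F * M"
    "\<And>z. z \<in> X \<Longrightarrow> e dvd (\<Sum>y\<in>Y. P z y * \<mu> y) - r z"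
    "beval (pa_atom_sat (\<lambda>z. if z \<in> X then ((\<Sum>y\<in>Y. P z y * \<mu> y) - r z) div e else \<mu> z)) \<phi>
      = beval (pa_atom_sat \<mu>) \<phi>"
proof -
  define n where "n = card X"
  obtain h where h: "bij_betw h {..<n} X" using ex_bij_betw_nat_finite[OF fin(1)] by (auto simp: n_def lessThan_atLeast0)
  define g where "g = inv_into {..<n} h"
  have g: "g z < n" "h (g z) = z" if "z \<in> X" for z
    using that h unfolding g_def
    by (metis bij_betw_def inv_into_into lessThan_iff, metis bij_betw_inv_into_right)
  have hX: "h k \<in> X" if "k < n" for k using h that by (auto simp: bij_betw_def)
  define x0 where "x0 k = \<mu> (h k) div M" for k
  define \<rho> where "\<rho> z = \<mu> z mod M" for z
  have \<rho>: "0 \<le> \<rho> z" "\<rho> z \<le> M" for z using M(1) by (auto simp: \<rho>_def less_imp_le)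
  \<comment> \<open>All inequalities with small coefficients, and right-hand sides affine in the
    parameters, that hold at \<open>x0\<close>. This covers the true atoms and the negations of the
    false ones without consulting the formula.\<close>
  define R where "R = {(A, \<beta>). (\<exists>c \<gamma>. \<beta> = c + (\<Sum>y\<in>Y. \<gamma> y * \<mu> y) \<and> \<bar>c\<bar> \<le> H \<and> (\<forall>y. \<bar>\<gamma> y\<bar> \<le> H))
    \<and> (\<forall>k<n. \<bar>A k\<bar> \<le> H) \<and> 0 \<le> slack n (A, \<beta>) x0}"
  have unit: "\<exists>s c. s \<noteq> 0 \<and> ((\<lambda>i. if i = k then s else 0), c) \<in> R" if "k < n" for k
  proof -
    \<comment> \<open>Whichever of \<open>0 \<le> x k\<close> and \<open>x k \<le> 0\<close> holds
      at \<open>x0\<close> lies in \<open>R\<close>; these rows form the starting basis.\<close>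
    define s :: int where "s = (if x0 k \<ge> 0 then -1 else 1)"
    have "(\<Sum>i<n. (if i = k then s else 0) * x0 i) = s * x0 k"
      using that by (simp add: if_distrib[of "\<lambda>t. t * _"] cong: if_cong)
    then have "((\<lambda>i. if i = k then s else 0), 0) \<in> R"
      using H(2) unfolding R_def by (auto intro!: exI[of _ 0] exI[of _ "\<lambda>_. 0"] simp: slack_def s_def)
    then show ?thesis by (intro exI[of _ s] exI[of _ 0]) (auto simp: s_def)
  qed
  have bnd: "\<bar>fst r k\<bar> \<le> H" if "r \<in> R" "k < n" for r k using that by (auto simp: R_def)
  have feas0: "\<forall>r\<in>R. 0 \<le> slack n r x0" by (auto simp: R_def)
  have Fn: "F = fact n * H ^ n" by (simp add: F n_def)
  have "\<exists>B x D e s. (\<forall>i<n. B i \<in> R) \<and> (\<forall>r\<in>R. 0 \<le> slack n r x)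
    \<and> 1 \<le> e \<and> e \<le> F \<and> (\<forall>i<n. \<forall>k<n. \<bar>D k i\<bar> \<le> F) \<and> (\<forall>i<n. 0 \<le> s i \<and> s i \<le> F)
    \<and> (\<forall>k<n. e * x k = (\<Sum>i<n. D k i * (snd (B i) - s i)))"
    unfolding Fn by (rule near_vertex_solution[OF bnd H(2) unit feas0]; assumption)
  then obtain B x D e s where B: "\<forall>i<n. B i \<in> R" and feas: "\<forall>r\<in>R. 0 \<le> slack n r x"
    and e: "1 \<le> e" "e \<le> F" and D: "\<forall>i<n. \<forall>k<n. \<bar>D k i\<bar> \<le> F" and s: "\<forall>i<n. 0 \<le> s i \<and> s i \<le> F"
    and sol: "\<forall>k<n. e * x k = (\<Sum>i<n. D k i * (snd (B i) - s i))"
  proof (elim exE conjE, goal_cases)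
    case (1 B x D e s)
    show ?case by (rule 1(1)[OF 1(2-)])
  qed
  have F0: "0 \<le> F" using e by linarith
  have "\<exists>p. i < n \<longrightarrow> snd (B i) = fst p + (\<Sum>y\<in>Y. snd p y * \<mu> y) \<and> \<bar>fst p\<bar> \<le> H \<and> (\<forall>y. \<bar>snd p y\<bar> \<le> H)" for i
  proof (cases "i < n")
    case True
    obtain A \<beta> where Bi: "B i = (A, \<beta>)" by (cases "B i")
    then have "(A, \<beta>) \<in> R" using B True by metis
    then obtain c \<gamma> where "\<beta> = c + (\<Sum>y\<in>Y. \<gamma> y * \<mu> y)" "\<bar>c\<bar> \<le> H" "\<forall>y. \<bar>\<gamma> y\<bar> \<le> H"
      unfolding R_def mem_Collect_eq case_prod_conv
    proof (elim exE conjE, goal_cases)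
      case (1 c \<gamma>)
      show ?case by (rule 1(1)[OF 1(4-6)])
    qed
    then show ?thesis using Bi by (intro exI[of _ "(c, \<gamma>)"]) simp
  qed simp
  then have "\<forall>i. \<exists>p. i < n \<longrightarrow> snd (B i) = fst p + (\<Sum>y\<in>Y. snd p y * \<mu> y) \<and> \<bar>fst p\<bar> \<le> H \<and> (\<forall>y. \<bar>snd p y\<bar> \<le> H)"
    by (rule allI)
  from choice[OF this] obtain p where p: "\<forall>i. i < n \<longrightarrow> snd (B i) = fst (p i) + (\<Sum>y\<in>Y. snd (p i) y * \<mu> y)
      \<and> \<bar>fst (p i)\<bar> \<le> H \<and> (\<forall>y. \<bar>snd (p i) y\<bar> \<le> H)"
  proof (elim exE, goal_cases)
    case (1 p)
    show ?case by (rule 1(1)[OF 1(2)])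
  qed
  define c where "c i = fst (p i)" for i
  define \<gamma> where "\<gamma> i = snd (p i)" for i
  have c: "\<And>i. i < n \<Longrightarrow> snd (B i) = c i + (\<Sum>y\<in>Y. \<gamma> i y * \<mu> y)" "\<And>i. i < n \<Longrightarrow> \<bar>c i\<bar> \<le> H"
    "\<And>i y. i < n \<Longrightarrow> \<bar>\<gamma> i y\<bar> \<le> H" using p by (simp_all add: c_def \<gamma>_def)
  define \<mu>' where "\<mu>' z = (if z \<in> X then M * x (g z) + \<rho> z else \<mu> z)" for z
  \<comment> \<open>Obtained by inserting the affine form of \<open>snd (B i)\<close> into Cramer's
    rule and multiplying by \<open>M\<close>; the residue enters \<open>r\<close> as
    \<open>e * \<rho> z\<close>. Outside \<open>X\<close> both are 0, so the bounds hold for all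
    arguments.\<close>
  define P where "P z y = (if z \<in> X then M * (\<Sum>i<n. D (g z) i * \<gamma> i y) else 0)" for z y
  define r where "r z = (if z \<in> X then - (M * (\<Sum>i<n. D (g z) i * (c i - s i))) - e * \<rho> z else 0)" for z
  have key: "(\<Sum>y\<in>Y. P z y * \<mu> y) - r z = e * \<mu>' z" if z: "z \<in> X" for z
  proof -
    have "e * x (g z) = (\<Sum>i<n. D (g z) i * ((\<Sum>y\<in>Y. \<gamma> i y * \<mu> y) + (c i - s i)))"
      using sol g(1)[OF z] c(1) by (simp add: algebra_simps)
    also have "\<dots> = (\<Sum>y\<in>Y. (\<Sum>i<n. D (g z) i * \<gamma> i y) * \<mu> y) + (\<Sum>i<n. D (g z) i * (c i - s i))"
      by (subst sum_distrib_right, subst sum.swap) (simp add: distrib_left sum.distrib sum_distrib_left mult.assoc)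
    finally have "e * x (g z) = (\<Sum>y\<in>Y. (\<Sum>i<n. D (g z) i * \<gamma> i y) * \<mu> y) + (\<Sum>i<n. D (g z) i * (c i - s i))" .
    moreover have "(\<Sum>y\<in>Y. P z y * \<mu> y) = M * (\<Sum>y\<in>Y. (\<Sum>i<n. D (g z) i * \<gamma> i y) * \<mu> y)"
      using z by (simp add: P_def mult.assoc flip: sum_distrib_left)
    ultimately have "M * (e * x (g z)) = (\<Sum>y\<in>Y. P z y * \<mu> y) + M * (\<Sum>i<n. D (g z) i * (c i - s i))"
      by (simp only: distrib_left)
    then show ?thesis using z by (simp add: r_def \<mu>'_def algebra_simps)
  qed
  have sum_bound: "\<bar>\<Sum>i<n. D k i * f i\<bar> \<le> int n * (F * C)" if "k < n" "\<And>i. i < n \<Longrightarrow> \<bar>f i\<bar> \<le> C" for k f C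
  proof -
    have "\<bar>\<Sum>i<n. D k i * f i\<bar> \<le> (\<Sum>i<n. \<bar>D k i * f i\<bar>)" by (rule sum_abs)
    also have "\<dots> \<le> (\<Sum>i<n. F * C)" using D that F0 by (intro sum_mono) (auto simp: abs_mult intro!: mult_mono)
    finally show ?thesis by simp
  qed
  have nn: "0 \<le> M * (int n * (F * H))" "0 \<le> M * (int n * (F * (H + F))) + F * M"
    using M(1) H(2) F0 by auto
  have Pb: "\<bar>P z y\<bar> \<le> M * (int n * (F * H))" for z y
  proof (cases "z \<in> X")
    case True
    have "\<bar>\<Sum>i<n. D (g z) i * \<gamma> i y\<bar> \<le> int n * (F * H)" by (rule sum_bound) (use g True c in auto)
    then show ?thesis using True M(1) by (simp add: P_def abs_mult)
  qed (use nn in \<open>simp add: P_def\<close>)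
  have rb: "\<bar>r z\<bar> \<le> M * (int n * (F * (H + F))) + F * M" for z
  proof (cases "z \<in> X")
    case True
    have "\<bar>\<Sum>i<n. D (g z) i * (c i - s i)\<bar> \<le> int n * (F * (H + F))"
    proof (rule sum_bound)
      show "\<bar>c i - s i\<bar> \<le> H + F" if "i < n" for i using c(2)[OF that] s that by fastforce
    qed (use g True in auto)
    then have "\<bar>M * (\<Sum>i<n. D (g z) i * (c i - s i))\<bar> \<le> M * (int n * (F * (H + F)))"
      using M(1) by (simp add: abs_mult)
    moreover have "0 \<le> e * \<rho> z" "e * \<rho> z \<le> F * M" using e \<rho>[of z] F0 by (auto intro!: mult_mono)
    moreover have "r z = - (M * (\<Sum>i<n. D (g z) i * (c i - s i))) - e * \<rho> z" using True by (simp add: r_def)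
    ultimately show ?thesis by linarith
  qed (use nn in \<open>simp add: r_def\<close>)
  \<comment> \<open>The case \<open>\<sigma> = -1\<close> covers negated inequalities, so that truth
    values are preserved in both directions.\<close>
  have ineq: "\<sigma> * lin_eval \<mu>' t \<le> b"
    if t: "set (map snd t) \<subseteq> X \<union> Y" "\<sigma> = 1 \<or> \<sigma> = -1" "\<sigma> * lin_eval \<mu> t \<le> b" "M * lnorm t + \<bar>b\<bar> + lnorm t \<le> H"
    for \<sigma> t b
  proof -
    let ?K = "\<Sum>z\<in>X. lcoef t z * \<rho> z" and ?L = "\<Sum>y\<in>Y. lcoef t y * \<mu> y"
    define A where "A k = \<sigma> * (M * lcoef t (h k))" for k
    have split: "lin_eval \<kappa> t = (\<Sum>k<n. M * lcoef t (h k) * v k) + ?K + ?L"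
      if "\<And>z. z \<in> X \<Longrightarrow> \<kappa> z = M * v (g z) + \<rho> z" "\<And>y. y \<in> Y \<Longrightarrow> \<kappa> y = \<mu> y" for \<kappa> v
    proof -
      have "lin_eval \<kappa> t = (\<Sum>z\<in>X. lcoef t z * \<kappa> z) + (\<Sum>y\<in>Y. lcoef t y * \<kappa> y)"
        using lin_eval_lcoef[of "X \<union> Y" t \<kappa>] fin t(1) by (simp add: sum.union_disjoint)
      also have "(\<Sum>y\<in>Y. lcoef t y * \<kappa> y) = ?L" using that(2) by simp
      also have "(\<Sum>z\<in>X. lcoef t z * \<kappa> z) = (\<Sum>z\<in>X. M * lcoef t z * v (g z)) + ?K"
        using that(1) by (simp add: algebra_simps sum.distrib)
      also have "(\<Sum>z\<in>X. M * lcoef t z * v (g z)) = (\<Sum>k<n. M * lcoef t (h k) * v k)"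
      proof (rule sum.reindex_bij_betw[OF h, symmetric, THEN trans])
        have "g (h k) = k" if "k < n" for k using h that unfolding g_def by (simp add: bij_betw_def inv_into_f_f)
        then show "(\<Sum>k<n. M * lcoef t (h k) * v (g (h k))) = (\<Sum>k<n. M * lcoef t (h k) * v k)" by simp
      qed
      finally show ?thesis .
    qed
    have Asum: "(\<Sum>k<n. A k * v k) = \<sigma> * (\<Sum>k<n. M * lcoef t (h k) * v k)" for v
      by (simp add: A_def sum_distrib_left mult.assoc)
    have \<mu>: "\<mu> z = M * x0 (g z) + \<rho> z" if "z \<in> X" for z using g[OF that] by (simp add: x0_def \<rho>_def)
    have abs\<sigma>: "\<bar>\<sigma>\<bar> = 1" using t(2) by auto
    note l0 = lnorm_nonneg[of t]
    have Kb: "\<bar>?K\<bar> \<le> M * lnorm t"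
    proof -
      have "\<bar>?K\<bar> \<le> (\<Sum>z\<in>X. \<bar>lcoef t z * \<rho> z\<bar>)" by (rule sum_abs)
      also have "\<dots> \<le> (\<Sum>z\<in>X. \<bar>lcoef t z\<bar> * M)" using \<rho> by (intro sum_mono) (auto simp: abs_mult intro!: mult_left_mono)
      also have "\<dots> = M * (\<Sum>z\<in>X. \<bar>lcoef t z\<bar>)" by (simp add: sum_distrib_left mult.commute)
      also have "\<dots> \<le> M * lnorm t" using sum_lcoef_le[OF fin(1)] M(1) by (intro mult_left_mono) auto
      finally show ?thesis .
    qed
    \<comment> \<open>The inequality rewritten for the quotients by \<open>M\<close>: residues and
      parameters move to the right-hand side. Its size is what the hypothesis on \<open>H\<close>
      controls.\<close>
    have "(A, b - \<sigma> * ?K + (\<Sum>y\<in>Y. (- \<sigma> * lcoef t y) * \<mu> y)) \<in> R"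
      unfolding R_def mem_Collect_eq case_prod_conv
    proof (intro conjI exI allI impI)
      have "\<bar>\<sigma> * ?K\<bar> \<le> M * lnorm t" using Kb abs\<sigma> by (simp add: abs_mult)
      then show "\<bar>b - \<sigma> * ?K\<bar> \<le> H" using t(4) l0 by linarith
      have "0 \<le> M * lnorm t" using M(1) l0 by simp
      then show "\<bar>- \<sigma> * lcoef t y\<bar> \<le> H" for y using lcoef_le[of t y] t(4) abs\<sigma> by (simp add: abs_mult)
      show "\<bar>A k\<bar> \<le> H" for k
      proof -
        have "M * \<bar>lcoef t (h k)\<bar> \<le> M * lnorm t" using lcoef_le M(1) by (intro mult_left_mono) auto
        moreover have "\<bar>A k\<bar> = M * \<bar>lcoef t (h k)\<bar>" using abs\<sigma> M(1) by (simp add: A_def abs_mult)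
        ultimately show ?thesis using t(4) l0 by linarith
      qed
      have "lin_eval \<mu> t = (\<Sum>k<n. M * lcoef t (h k) * x0 k) + ?K + ?L"
        by (rule split) (use \<mu> in auto)
      then have "\<sigma> * lin_eval \<mu> t = (\<Sum>k<n. A k * x0 k) + \<sigma> * ?K + \<sigma> * ?L"
        unfolding Asum by (simp only: distrib_left)
      then show "0 \<le> slack n (A, b - \<sigma> * ?K + (\<Sum>y\<in>Y. (- \<sigma> * lcoef t y) * \<mu> y)) x0"
        using t(3) by (simp add: slack_def sum_distrib_left sum_negf mult.assoc)
    qed (rule refl)
    then have "0 \<le> slack n (A, b - \<sigma> * ?K + (\<Sum>y\<in>Y. (- \<sigma> * lcoef t y) * \<mu> y)) x" using feas by blast
    moreover have "\<sigma> * lin_eval \<mu>' t = (\<Sum>k<n. A k * x k) + \<sigma> * ?K + \<sigma> * ?L"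
    proof -
      have "y \<notin> X" if "y \<in> Y" for y using fin(3) that by blast
      then show ?thesis unfolding Asum by (subst split[of \<mu>' x]) (auto simp: \<mu>'_def algebra_simps)
    qed
    ultimately show ?thesis by (simp add: slack_def sum_distrib_left sum_negf mult.assoc)
  qed
  have atom: "pa_atom_sat \<mu>' a = pa_atom_sat \<mu> a" if a: "a \<in> set (batoms \<phi>)" for a
  proof -
    have tv: "set (map snd (atom_lin a)) \<subseteq> X \<union> Y" using vars[OF a] by (simp add: pa_atom_vars_lin)
    have iff: "(lin_eval \<mu>' t \<le> b) = (lin_eval \<mu> t \<le> b)"
      if "t = atom_lin a" "\<bar>b\<bar> + lnorm t + 1 \<le> atom_norm a" "0 \<le> lnorm t" for t b
    proof -
      have "M * lnorm t \<le> M * (atom_norm a - 1)" using M(1) that by (intro mult_left_mono) auto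
      then have *: "M * lnorm t + (\<bar>b\<bar> + 1) + lnorm t \<le> H" using H(1)[OF a] that(2) M(1)
        by (simp add: algebra_simps)
      have 1: "1 * lin_eval \<mu>' t \<le> b" if "1 * lin_eval \<mu> t \<le> b"
        by (rule ineq) (use that tv \<open>t = _\<close> * in auto)
      have 2: "- 1 * lin_eval \<mu>' t \<le> - b - 1" if "- 1 * lin_eval \<mu> t \<le> - b - 1"
        by (rule ineq) (use that tv \<open>t = _\<close> * in auto)
      show ?thesis using 1 2 by linarith
    qed
    show ?thesis
    proof (cases a)
      case (LinLe t b)
      then show ?thesis using iff[of t b] lnorm_nonneg[of t] by simp
    next
      case (LinCong t b m)
      show ?thesis
      proof (cases "m = 0")
        case True
        \<comment> \<open>Modulo 0 the atom is the equation \<open>t = b\<close>, that is,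
          \<open>t \<le> b\<close> together with the failure of
          \<open>t \<le> b - 1\<close>.\<close>
        have "(lin_eval \<mu>' t = b) = (lin_eval \<mu> t = b)"
          using iff[of t b] iff[of t "b - 1"] lnorm_nonneg[of t] by (simp add: LinCong) linarith
        then show ?thesis by (simp add: LinCong True)
      next
        case False
        have "m dvd M" using M(2)[OF a] False by (simp add: LinCong)
        have "M dvd \<mu>' z - \<mu> z" for z by (auto simp: \<mu>'_def \<rho>_def g mod_eq_dvd_iff[symmetric] mod_mult_self4)
        then have d: "m dvd \<mu>' z - \<mu> z" for z using \<open>m dvd M\<close> dvd_trans by blast
        have "m dvd lin_eval \<mu>' t - lin_eval \<mu> t"
        proof (induction t)
          case (Cons ay t)
          have eq: "lin_eval \<mu>' (ay # t) - lin_eval \<mu> (ay # t)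
            = fst ay * (\<mu>' (snd ay) - \<mu> (snd ay)) + (lin_eval \<mu>' t - lin_eval \<mu> t)"
            by (simp add: algebra_simps case_prod_beta)
          show ?case unfolding eq by (intro dvd_add dvd_mult d Cons)
        qed simp
        then have "lin_eval \<mu>' t mod m = lin_eval \<mu> t mod m" by (simp add: mod_eq_dvd_iff)
        then show ?thesis by (simp add: LinCong)
      qed
    qed
  qed
  have div: "((\<Sum>y\<in>Y. P z y * \<mu> y) - r z) div e = \<mu>' z" if "z \<in> X" for z
    using key[OF that] e by simp
  have "(\<lambda>z. if z \<in> X then ((\<Sum>y\<in>Y. P z y * \<mu> y) - r z) div e else \<mu> z) = \<mu>'"
    by (auto simp: fun_eq_iff div) (simp add: \<mu>'_def)
  then have "beval (pa_atom_sat (\<lambda>z. if z \<in> X then ((\<Sum>y\<in>Y. P z y * \<mu> y) - r z) div e else \<mu> z)) \<phi>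
      = beval (pa_atom_sat \<mu>) \<phi>"
    using beval_cong[of \<phi>, OF atom] by simp
  then show thesis using that[OF e(1,2), of P r] Pb rb key n_def by simp
qed

subsection \<open>Size estimates\<close>

lemma enc_nat_size: "int n + 1 \<le> 2 ^ length (enc_nat n)"
proof (induction n rule: less_induct)
  case (less n)
  show ?case
  proof (cases "n = 0")
    case False
    then have "int (n div 2) + 1 \<le> 2 ^ length (enc_nat (n div 2))" by (intro less) simp
    moreover have "int n \<le> 2 * int (n div 2) + 1" by linarith
    ultimately show ?thesis using False by (simp add: enc_nat_pos)
  qed (simp add: enc_nat_0)
qed

lemma enc_int_size: "\<bar>i\<bar> + 1 \<le> 2 ^ length (enc_int i)"
  using enc_nat_size[of "nat \<bar>i\<bar>"] by (simp add: enc_int_def)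

lemma mult_pow2_mono:
  assumes "a \<le> 2 ^ m" "b \<le> 2 ^ n" "0 \<le> a"
  shows "a * b \<le> (2::int) ^ (m + n)"
proof -
  have "a * b \<le> a * 2 ^ n" using assms(2,3) by (rule mult_left_mono)
  also have "\<dots> \<le> 2 ^ m * 2 ^ n" using assms(1) by (rule mult_right_mono) simp
  finally show ?thesis by (simp add: power_add)
qed

text \<open>Lengths of encodings add up, so their powers of two multiply; the norm, a sum, is
  dominated by the product of the values \<open>\<bar>a\<bar> + 1\<close>.\<close>

lemma enc_lin_size: "lnorm t + 1 \<le> 2 ^ length (enc_lin t)"
proof (induction t)
  case (Cons ay t)
  obtain a y where ay: "ay = (a, y)" by (cases ay)
  have "(\<bar>a\<bar> + 1) * (lnorm t + 1) \<le> 2 ^ (length (enc_int a) + length (enc_lin t))"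
    by (rule mult_pow2_mono[OF enc_int_size Cons.IH]) simp
  also have "\<dots> \<le> 2 ^ length (enc_lin (ay # t))"
    by (rule power_increasing) (auto simp: enc_lin_def enc_list_simps enc_pair_def ay)
  finally have "(\<bar>a\<bar> + 1) * (lnorm t + 1) \<le> 2 ^ length (enc_lin (ay # t))" .
  moreover have "\<bar>a\<bar> + lnorm t + 1 \<le> (\<bar>a\<bar> + 1) * (lnorm t + 1)"
    using lnorm_nonneg[of t] by (simp add: algebra_simps)
  ultimately show ?case by (simp add: lnorm_def ay)
qed (simp add: lnorm_def)

lemma enc_atom_size: "atom_norm a \<le> 2 ^ length (enc_pa_atom a)" "atom_mod a \<le> 2 ^ length (enc_pa_atom a)"
proof -
  have *: "lnorm t + \<bar>b\<bar> + 2 \<le> 2 ^ (length (enc_nat k) + (length (enc_lin t) + length (enc_int b)))" for t b k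
  proof -
    have 1: "(lnorm t + 1) * (\<bar>b\<bar> + 1) \<le> 2 ^ (length (enc_lin t) + length (enc_int b))"
      by (rule mult_pow2_mono[OF enc_lin_size enc_int_size]) (use lnorm_nonneg[of t] in simp)
    have "lnorm t + \<bar>b\<bar> + 2 \<le> 2 ^ 1 * ((lnorm t + 1) * (\<bar>b\<bar> + 1))"
      using mult_nonneg_nonneg[OF lnorm_nonneg[of t] abs_ge_zero[of b]] lnorm_nonneg[of t] by (simp add: algebra_simps)
    also have "\<dots> \<le> 2 ^ length (enc_nat k) * 2 ^ (length (enc_lin t) + length (enc_int b))"
      by (rule mult_mono[OF power_increasing 1]) (use enc_nat_nonempty lnorm_nonneg[of t] in auto)
    finally show ?thesis by (simp add: power_add)
  qed
  show "atom_norm a \<le> 2 ^ length (enc_pa_atom a)"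
  proof (cases a)
    case (LinLe t b)
    then show ?thesis using *[of t b 0] by simp
  next
    case (LinCong t b m)
    have "(2::int) ^ (length (enc_nat 1) + (length (enc_lin t) + length (enc_int b))) \<le> 2 ^ length (enc_pa_atom a)"
      by (rule power_increasing) (auto simp: LinCong)
    then show ?thesis using *[of t b 1] unfolding LinCong atom_norm.simps by linarith
  qed
  show "atom_mod a \<le> 2 ^ length (enc_pa_atom a)"
  proof (cases a)
    case (LinCong t b m)
    have "\<bar>m\<bar> + 1 \<le> 2 ^ length (enc_int m)" by (rule enc_int_size)
    also have "\<dots> \<le> 2 ^ length (enc_pa_atom a)" by (rule power_increasing) (auto simp: LinCong)
    finally show ?thesis using LinCong by auto
  qed simp
qed

lemma batoms_size:
  "a \<in> set (batoms \<phi>) \<Longrightarrow> length (f a) \<le> length (enc_bform f \<phi>)"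
  by (induction \<phi>) auto

text \<open>A product instead of a least common multiple: the atoms occupy disjoint parts of the
  input, so it is still at most 2 to the input length.\<close>

definition modulus :: "pa_atom bform \<Rightarrow> int" where
  "modulus \<phi> = prod_list (map atom_mod (batoms \<phi>))"

lemma modulus_simps:
  "modulus BTrue = 1" "modulus BFalse = 1" "modulus (BAtom a) = atom_mod a" "modulus (BNot g) = modulus g"
  "modulus (BAnd g h) = modulus g * modulus h" "modulus (BOr g h) = modulus g * modulus h"
  by (simp_all add: modulus_def)

lemma modulus_ge: "1 \<le> modulus \<phi>"
proof (induction \<phi>)
  case (BAtom a)
  show ?case by (simp add: modulus_simps atom_mod_ge)
next
  case (BAnd g h)
  then show ?case using mult_mono[of 1 "modulus g" 1 "modulus h"] by (simp add: modulus_simps)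
next
  case (BOr g h)
  then show ?case using mult_mono[of 1 "modulus g" 1 "modulus h"] by (simp add: modulus_simps)
qed (simp_all add: modulus_simps)

lemma modulus_size: "modulus \<phi> \<le> 2 ^ length (enc_bform enc_pa_atom \<phi>)"
proof (induction \<phi>)
  case (BAtom a)
  have "(2::int) ^ length (enc_pa_atom a) \<le> 2 ^ length (enc_bform enc_pa_atom (BAtom a))"
    by (rule power_increasing) auto
  then show ?case using enc_atom_size(2)[of a] unfolding modulus_simps by linarith
next
  case (BNot g)
  have "(2::int) ^ length (enc_bform enc_pa_atom g) \<le> 2 ^ length (enc_bform enc_pa_atom (BNot g))"
    by (rule power_increasing) auto
  then show ?case using BNot unfolding modulus_simps by linarith
next
  case (BAnd g h)
  have "modulus g * modulus h \<le> 2 ^ (length (enc_bform enc_pa_atom g) + length (enc_bform enc_pa_atom h))"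
    using modulus_ge[of g] by (intro mult_pow2_mono BAnd) simp
  also have "\<dots> \<le> 2 ^ length (enc_bform enc_pa_atom (BAnd g h))" by (rule power_increasing) auto
  finally show ?case by (simp only: modulus_simps)
next
  case (BOr g h)
  have "modulus g * modulus h \<le> 2 ^ (length (enc_bform enc_pa_atom g) + length (enc_bform enc_pa_atom h))"
    using modulus_ge[of g] by (intro mult_pow2_mono BOr) simp
  also have "\<dots> \<le> 2 ^ length (enc_bform enc_pa_atom (BOr g h))" by (rule power_increasing) auto
  finally show ?case by (simp only: modulus_simps)
qed (simp_all add: modulus_simps)

lemma atom_mod_dvd_modulus: "a \<in> set (batoms \<phi>) \<Longrightarrow> atom_mod a dvd modulus \<phi>"
  unfolding modulus_def by (rule prod_list_dvd) simp

text \<open>Regrouped, each quantity is a sum of at most three products of three factors below or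
  equal to \<open>D\<close>, with \<open>M * n\<close> counted as one factor. Since
  \<open>4 \<le> D\<close>, four such products fit into \<open>D ^ 4\<close>, and the fourth makes
  up for \<open>K + 1\<close> in place of \<open>K\<close>.\<close>

lemma small_model_bounds:
  fixes M n F H D K :: int
  assumes "1 \<le> M" "0 \<le> n" "M * n \<le> D" "1 \<le> F" "F \<le> D" "1 \<le> H" "H \<le> D" "M \<le> D" "4 \<le> D" "D ^ 4 \<le> K + 1"
  shows "F \<le> K" "M * (n * (F * H)) \<le> K" "M * (n * (F * (H + F))) + F * M \<le> K"
proof -
  define T where "T = D * D * D"
  have mono3: "a * b * c \<le> T" if "a \<le> D" "b \<le> D" "c \<le> D" "0 \<le> a" "0 \<le> b" "0 \<le> c" for a b c
  proof -
    have "a * b \<le> D * D" using that by (intro mult_mono) linarith+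
    moreover have "0 \<le> a * b" "0 \<le> D * D" using that by simp_all
    ultimately show ?thesis unfolding T_def using that by (intro mult_mono) linarith+
  qed
  have "4 * T \<le> D * T" using assms(9) by (intro mult_right_mono) (auto simp: T_def)
  then have K: "4 * T \<le> K + 1" using assms(10) by (simp add: T_def power4_eq_xxxx mult.assoc)
  have Mn: "0 \<le> M * n" using assms by simp
  have 1: "M * n * F * H \<le> T" "M * n * F * F \<le> T"
    by (rule mono3; use assms Mn in linarith)+
  have 2: "F * M * 1 \<le> T" "F * 1 * 1 \<le> T" "1 * 1 * 1 \<le> T"
    by (rule mono3; use assms in linarith)+
  show "F \<le> K" using 2 K by linarith
  show "M * (n * (F * H)) \<le> K" using 1 2 K by (simp only: mult.assoc)
  have "M * (n * (F * (H + F))) + F * M = M * n * F * H + M * n * F * F + F * M * 1" by (simp add: algebra_simps)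
  then show "M * (n * (F * (H + F))) + F * M \<le> K" using 1 2 K by linarith
qed

text \<open>\<open>M\<close> and all atom norms are at most \<open>2 ^ N\<close>, so
  \<open>H = 2 ^ (2 * N + 1)\<close> bounds \<open>(M + 1) * atom_norm a\<close>. With fewer than
  \<open>N\<close> bound variables, \<open>F\<close> is at most
  \<open>2 ^ (N * N + (2 * N + 1) * N)\<close>, hence at most
  \<open>2 ^ (4 * N ^ 2)\<close>.\<close>

lemma small_model_encoded:
  fixes \<mu> :: "nat \<Rightarrow> int"
  assumes N: "N = length (enc_epa (EPA xs \<phi>))" and Y: "finite Y" "set xs \<inter> Y = {}"
    and vars: "\<And>a. a \<in> set (batoms \<phi>) \<Longrightarrow> pa_atom_vars a \<subseteq> set xs \<union> Y"
    and K: "K = 2 ^ (N ^ 6) - 1"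
  obtains e P r where "1 \<le> e" "e \<le> K" "\<And>z y. \<bar>P z y\<bar> \<le> K" "\<And>z. \<bar>r z\<bar> \<le> K"
    "\<And>z. z \<in> set xs \<Longrightarrow> e dvd (\<Sum>y\<in>Y. P z y * \<mu> y) - r z"
    "beval (pa_atom_sat (\<lambda>z. if z \<in> set xs then ((\<Sum>y\<in>Y. P z y * \<mu> y) - r z) div e else \<mu> z)) \<phi>
      = beval (pa_atom_sat \<mu>) \<phi>"
proof -
  let ?n = "card (set xs)" and ?M = "modulus \<phi>" and ?H = "2 ^ (2 * N + 1) :: int"
  let ?F = "fact ?n * ?H ^ ?n :: int" and ?D = "2 ^ (4 * N ^ 2) :: int"
  have len: "length (enc_bform enc_pa_atom \<phi>) < N" "?n < N"
  proof -
    have "?n \<le> length xs" by (rule card_length)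
    then have "?n < length (enc_list enc_nat xs)" using length_le_enc_list[of xs enc_nat] by linarith
    moreover have "0 < length (enc_bform enc_pa_atom \<phi>)"
      using enc_nat_nonempty by (cases \<phi>) (auto simp: Suc_le_eq)
    ultimately show "length (enc_bform enc_pa_atom \<phi>) < N" "?n < N" by (auto simp: N)
  qed
  have "1 \<le> length (enc_bform enc_pa_atom \<phi>)"
    using enc_nat_nonempty by (cases \<phi>) (auto simp: Suc_le_eq)
  then have N2: "2 \<le> N" using len by linarith
  have pow: "(2::int) ^ a \<le> 2 ^ b" if "a \<le> b" for a b using that by (rule power_increasing) simp
  have M: "1 \<le> ?M" "?M \<le> 2 ^ N" using modulus_ge order_trans[OF modulus_size pow[of _ N]] len(1) by auto
  have norm: "?M * atom_norm a + atom_norm a \<le> ?H" if "a \<in> set (batoms \<phi>)" for a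
  proof -
    have "atom_norm a \<le> 2 ^ N"
      using enc_atom_size(1)[of a] batoms_size[OF that, of enc_pa_atom] pow[of "length (enc_pa_atom a)" N] len by linarith
    moreover have "0 \<le> atom_norm a" using lnorm_nonneg by (cases a) auto
    moreover have "?M + 1 \<le> 2 ^ (N + 1)" using M by simp
    ultimately have "(?M + 1) * atom_norm a \<le> 2 ^ (N + 1 + N)" using M(1) by (intro mult_pow2_mono) auto
    moreover have "N + 1 + N = 2 * N + 1" by simp
    ultimately show ?thesis by (simp only: distrib_right mult_1)
  qed
  have n: "int ?n \<le> 2 ^ N"
  proof -
    have "?n \<le> 2 ^ N" using len(2) less_exp[of N] by linarith
    then have "int ?n \<le> int (2 ^ N)" by (simp only: of_nat_le_iff)
    then show ?thesis by simp
  qed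
  have sq: "2 * N \<le> N ^ 2" "N \<le> N ^ 2" using N2 by (simp_all add: power2_eq_square)
  have H1: "1 \<le> ?H" by (rule one_le_power) simp
  have F: "?F \<le> ?D" "1 \<le> ?F"
  proof -
    have "(fact ?n :: int) \<le> int ?n ^ ?n" using fact_le_power[of ?n, where ?'a = int] by simp
    also have "\<dots> \<le> (2 ^ N) ^ ?n" using n by (intro power_mono) auto
    also have "\<dots> \<le> (2 ^ N) ^ N" using len by (intro power_increasing) auto
    finally have f: "(fact ?n :: int) \<le> 2 ^ (N * N)" by (simp add: power_mult)
    have "?H ^ ?n \<le> ?H ^ N" by (rule power_increasing[OF _ H1]) (use len in simp)
    then have h: "?H ^ ?n \<le> 2 ^ ((2 * N + 1) * N)" by (simp only: power_mult)
    have "?F \<le> 2 ^ (N * N + (2 * N + 1) * N)" by (rule mult_pow2_mono[OF f h]) simp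
    also have "\<dots> \<le> ?D" using sq by (intro pow) (simp add: power2_eq_square algebra_simps)
    finally show "?F \<le> ?D" .
    have "1 \<le> ?H ^ ?n" by (rule one_le_power[OF one_le_power]) simp
    then have "1 * 1 \<le> ?F" by (rule mult_mono[OF fact_ge_1]) simp_all
    then show "1 \<le> ?F" by (simp only: mult_1)
  qed
  have HD: "?H \<le> ?D" using sq N2 by (intro pow) linarith
  have Mn: "?M * int ?n \<le> ?D"
  proof -
    have "?M * int ?n \<le> 2 ^ (N + N)" using M n by (intro mult_pow2_mono) auto
    also have "\<dots> \<le> ?D" using sq by (intro pow) linarith
    finally show ?thesis .
  qed
  have MD: "?M \<le> ?D" using M(2) pow[of N "4 * N ^ 2"] sq by linarith
  have D1: "4 \<le> ?D" using pow[of 2 "4 * N ^ 2"] sq N2 by simp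
  \<comment> \<open>\<open>16 * N ^ 2 \<le> N ^ 6\<close> because \<open>2 \<le> N\<close>: prefix
    and body of the formula each take at least one bit.\<close>
  have D4: "?D ^ 4 \<le> K + 1"
  proof -
    have "2 ^ 4 * N ^ 2 \<le> N ^ 4 * N ^ 2" by (intro mult_le_mono1 power_mono[OF N2]) simp
    also have "\<dots> = N ^ (4 + 2)" by (simp only: power_add)
    finally have "4 * N ^ 2 * 4 \<le> N ^ 6" by simp
    then have "(2::int) ^ (4 * N ^ 2 * 4) \<le> 2 ^ (N ^ 6)" by (rule pow)
    then show ?thesis by (simp only: K power_mult)
  qed
  note bounds = small_model_bounds[OF M(1) of_nat_0_le_iff Mn F(2,1) H1 HD MD D1 D4]
  show thesis
  proof (rule small_model[where \<phi> = \<phi> and \<mu> = \<mu>, OF finite_set Y vars M(1) atom_mod_dvd_modulus norm H1 refl])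
    fix e :: int and P r
    assume *: "1 \<le> e" "e \<le> ?F" "\<And>z y. \<bar>P z y\<bar> \<le> ?M * (int ?n * (?F * ?H))"
      "\<And>z. \<bar>r z\<bar> \<le> ?M * (int ?n * (?F * (?H + ?F))) + ?F * ?M"
      "\<And>z. z \<in> set xs \<Longrightarrow> e dvd (\<Sum>y\<in>Y. P z y * \<mu> y) - r z"
      "beval (pa_atom_sat (\<lambda>z. if z \<in> set xs then ((\<Sum>y\<in>Y. P z y * \<mu> y) - r z) div e else \<mu> z)) \<phi>
        = beval (pa_atom_sat \<mu>) \<phi>"
    show thesis
    proof (rule that[OF *(1) _ _ _ *(5,6)])
      show "e \<le> K" by (rule order_trans[OF *(2) bounds(1)])
      show "\<bar>P z y\<bar> \<le> K" for z y by (rule order_trans[OF *(3) bounds(2)])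
      show "\<bar>r z\<bar> \<le> K" for z by (rule order_trans[OF *(4) bounds(3)])
    qed
  qed
qed

subsection \<open>Semantics of the bounded formula\<close>

lemma mpoly_eval_simps:
  "mpoly_eval L [] = 0" "mpoly_eval L ((c, es) # p) = c * prod_list (map (\<lambda>(x, e). x ^ e) (zip L es)) + mpoly_eval L p"
  "mpoly_eval L (p @ q) = mpoly_eval L p + mpoly_eval L q"
  by (simp_all add: mpoly_eval_def)

lemma unit_monomial: "i < length L \<Longrightarrow> prod_list (map (\<lambda>(x, e). x ^ e) (zip L (replicate i 0 @ [1]))) = (L ! i :: int)"
proof (induction i arbitrary: L)
  case 0
  then show ?case by (cases L) auto
next
  case (Suc i)
  then show ?case by (cases L) auto
qed

lemma unit_monomial0: "0 < length L \<Longrightarrow> prod_list (map (\<lambda>(x, e). x ^ e) (zip L [1])) = (L ! 0 :: int)"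
  using unit_monomial[of 0 L] by simp

lemma lincomb_map: "lincomb \<nu> L (map g Q) (map f Q) = (\<Sum>q\<leftarrow>Q. mpoly_eval L (f q) * \<nu> (g q))"
  by (induction Q) (auto simp: lincomb_def)

context encoded_input
begin

abbreviation "X \<equiv> set xs"
abbreviation "Y \<equiv> epa_fv (EPA xs \<phi>)"

lemma cpos_bound: "z \<in> X \<Longrightarrow> nmof w (cpos w z) = z \<and> 0 < cpos w z \<and> cpos w z < N"
proof -
  assume "z \<in> X"
  then obtain q where "q \<in> set B" "nmof w q = z" using names_B by (metis imageE)
  then show "nmof w (cpos w z) = z \<and> 0 < cpos w z \<and> cpos w z < N" using B_props by metis
qed

lemma cpos_free: "z \<in> Y \<Longrightarrow> nmof w (cpos w z) = z \<and> 0 < cpos w z \<and> cpos w z < N \<and> cpos w z \<in> set Q"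
proof -
  assume "z \<in> Y"
  then obtain q where "q \<in> set Q" "nmof w q = z" using names_Q by (metis imageE)
  then show "nmof w (cpos w z) = z \<and> 0 < cpos w z \<and> cpos w z < N \<and> cpos w z \<in> set Q" using Q_props by metis
qed

lemma index_less: "p < N \<Longrightarrow> q < N \<Longrightarrow> p * N + q < N * N"
proof -
  assume "p < N" "q < N"
  then have "p * N + q < Suc p * N" by simp
  also have "\<dots> \<le> N * N" using \<open>p < N\<close> by (intro mult_le_mono1) simp
  finally show ?thesis .
qed

lemma finite_Y: "finite Y"
  using names_Q by (metis finite_imageI finite_set)

lemma sum_Q: "(\<Sum>q\<leftarrow>Q. f q * \<nu> (nmof w q)) = (\<Sum>y\<in>Y. f (cpos w y) * (\<nu> y :: int))"
proof -
  have inj: "inj_on (nmof w) (set Q)" by (rule inj_on_inverseI[of _ "cpos w"]) (rule Q_props(2))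
  have "(\<Sum>q\<leftarrow>Q. f q * \<nu> (nmof w q)) = (\<Sum>q\<in>set Q. f q * \<nu> (nmof w q))"
    by (rule sum_list_distinct_conv_sum_set) simp
  also have "\<dots> = (\<Sum>q\<in>set Q. f (cpos w (nmof w q)) * \<nu> (nmof w q))"
    using Q_props(2) by (intro sum.cong) simp_all
  also have "\<dots> = (\<Sum>y\<in>nmof w ` set Q. f (cpos w y) * \<nu> y)"
    by (rule sum.reindex[OF inj, symmetric, unfolded comp_def])
  finally show ?thesis unfolding names_Q .
qed

text \<open>The value of the bounded variables: \<open>L ! 0\<close> is the common denominator, and the bound variable \<open>z\<close>
  stands for \<open>numer L \<nu> z div L ! 0\<close>.\<close>

definition numer :: "int list \<Rightarrow> (nat \<Rightarrow> int) \<Rightarrow> nat \<Rightarrow> int" where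
  "numer L \<nu> z = (\<Sum>y\<in>Y. L ! (cpos w z * N + cpos w y) * \<nu> y) - L ! (cpos w z * N)"

definition assign :: "int list \<Rightarrow> (nat \<Rightarrow> int) \<Rightarrow> nat \<Rightarrow> int" where
  "assign L \<nu> z = (if z \<in> X then numer L \<nu> z div L ! 0 else \<nu> z)"

lemma N_pos: "0 < N * N"
  using body_length enc_nat_nonempty by (auto simp: enc_list_def)

lemma coef_eval:
  assumes L: "length L = N * N" and q: "q < N"
  shows "mpoly_eval L (coef X (cpos w) N t q)
    = (\<Sum>(a, z)\<leftarrow>t. a * (if z \<in> X then L ! (cpos w z * N + q) else if cpos w z = q then L ! 0 else 0))"
proof (induction t)
  case (Cons az t)
  obtain a z where az: "az = (a, z)" by (cases az)
  have "mpoly_eval L (bmono X (cpos w) N q az)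
    = a * (if z \<in> X then L ! (cpos w z * N + q) else if cpos w z = q then L ! 0 else 0)"
    using L N_pos index_less[OF _ q, of "cpos w z"] cpos_bound[of z]
    by (auto simp: bmono_def az pexp_def mpoly_eval_simps unit_monomial unit_monomial0 simp del: One_nat_def)
  then show ?case using Cons by (simp add: coef_def mpoly_eval_simps az)
qed (simp add: coef_def mpoly_eval_simps)

lemma rhs_eval:
  assumes L: "length L = N * N"
  shows "mpoly_eval L (rhs X (cpos w) N t b)
    = b * L ! 0 + (\<Sum>(a, z)\<leftarrow>t. if z \<in> X then a * L ! (cpos w z * N) else 0)"
proof -
  have "mpoly_eval L (concat (map (rmono X (cpos w) N) t)) = (\<Sum>(a, z)\<leftarrow>t. if z \<in> X then a * L ! (cpos w z * N) else 0)"
  proof (induction t)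
    case (Cons az t)
    obtain a z where az: "az = (a, z)" by (cases az)
    have "mpoly_eval L (rmono X (cpos w) N az) = (if z \<in> X then a * L ! (cpos w z * N) else 0)"
      using L N_pos index_less[of "cpos w z" 0] cpos_bound[of z]
      by (auto simp: rmono_def az pexp_def mpoly_eval_simps unit_monomial simp del: One_nat_def)
    then show ?case using Cons by (simp add: mpoly_eval_simps az)
  qed (simp add: mpoly_eval_simps)
  then show ?thesis using L N_pos by (simp add: rhs_def mpoly_eval_simps unit_monomial0 del: One_nat_def)
qed

lemma lincomb_coef:
  assumes L: "length L = N * N" and t: "set (map snd t) \<subseteq> X \<union> Y"
  shows "lincomb \<nu> L (map (nmof w) Q) (map (coef X (cpos w) N t) Q)
    = (\<Sum>(a, z)\<leftarrow>t. a * (if z \<in> X then \<Sum>y\<in>Y. L ! (cpos w z * N + cpos w y) * \<nu> y else L ! 0 * \<nu> z))"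
proof -
  let ?c = "\<lambda>z q. if z \<in> X then L ! (cpos w z * N + q) else if cpos w z = q then L ! 0 else 0"
  have "lincomb \<nu> L (map (nmof w) Q) (map (coef X (cpos w) N t) Q)
      = (\<Sum>y\<in>Y. mpoly_eval L (coef X (cpos w) N t (cpos w y)) * \<nu> y)"
    unfolding lincomb_map by (rule sum_Q)
  also have "\<dots> = (\<Sum>y\<in>Y. (\<Sum>(a, z)\<leftarrow>t. a * ?c z (cpos w y)) * \<nu> y)"
    using coef_eval[OF L] cpos_free by (intro sum.cong) auto
  also have "\<dots> = (\<Sum>(a, z)\<leftarrow>t. a * (if z \<in> X then \<Sum>y\<in>Y. L ! (cpos w z * N + cpos w y) * \<nu> y else L ! 0 * \<nu> z))"
    using t
  proof (induction t)
    case (Cons az t)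
    obtain a z where az: "az = (a, z)" by (cases az)
    have *: "(\<Sum>y\<in>Y. ?c z (cpos w y) * \<nu> y)
      = (if z \<in> X then \<Sum>y\<in>Y. L ! (cpos w z * N + cpos w y) * \<nu> y else L ! 0 * \<nu> z)"
    proof (cases "z \<in> X")
      case False
      then have z: "z \<in> Y" using Cons.prems by (auto simp: az)
      have "(\<Sum>y\<in>Y. ?c z (cpos w y) * \<nu> y) = (\<Sum>y\<in>Y. if z = y then L ! 0 * \<nu> z else 0)"
      proof (rule sum.cong[OF refl])
        fix y assume y: "y \<in> Y"
        have "cpos w z = cpos w y \<longleftrightarrow> z = y" using cpos_free[OF z] cpos_free[OF y] by metis
        then show "?c z (cpos w y) * \<nu> y = (if z = y then L ! 0 * \<nu> z else 0)" using False by simp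
      qed
      also have "\<dots> = L ! 0 * \<nu> z" using z finite_Y by (simp del: epa_fv.simps)
      finally show ?thesis using False by simp
    qed simp
    have "(\<Sum>y\<in>Y. (\<Sum>(a, z)\<leftarrow>az # t. a * ?c z (cpos w y)) * \<nu> y)
      = a * (\<Sum>y\<in>Y. ?c z (cpos w y) * \<nu> y) + (\<Sum>y\<in>Y. (\<Sum>(a, z)\<leftarrow>t. a * ?c z (cpos w y)) * \<nu> y)"
      by (simp only: az list.map sum_list.Cons case_prod_conv distrib_right sum.distrib sum_distrib_left mult.assoc)
    then show ?case using Cons * by (simp only: az list.map sum_list.Cons case_prod_conv) simp
  qed simp
  finally show ?thesis .
qed

text \<open>Integrality makes the quotient exact, so \<open>L ! 0\<close> times the value of a bound
  variable is its numerator again; the offsets of the numerators form the second sum.\<close>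

lemma lin_scaled:
  assumes "\<And>z. z \<in> X \<Longrightarrow> L ! 0 dvd numer L \<nu> z"
  shows "(\<Sum>(a, z)\<leftarrow>t. a * (if z \<in> X then \<Sum>y\<in>Y. L ! (cpos w z * N + cpos w y) * \<nu> y else L ! 0 * \<nu> z))
    = L ! 0 * lin_eval (assign L \<nu>) t + (\<Sum>(a, z)\<leftarrow>t. if z \<in> X then a * L ! (cpos w z * N) else 0)"
proof (induction t)
  case (Cons az t)
  obtain a z where az: "az = (a, z)" by (cases az)
  have *: "a * (if z \<in> X then \<Sum>y\<in>Y. L ! (cpos w z * N + cpos w y) * \<nu> y else L ! 0 * \<nu> z)
    = L ! 0 * (a * assign L \<nu> z) + (if z \<in> X then a * L ! (cpos w z * N) else 0)"
  proof (cases "z \<in> X")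
    case True
    have "L ! 0 * (a * assign L \<nu> z) = a * (L ! 0 * (numer L \<nu> z div L ! 0))" using True by (simp add: assign_def)
    also have "\<dots> = a * numer L \<nu> z" using assms[OF True] by simp
    finally show ?thesis using True by (simp add: numer_def right_diff_distrib del: epa_fv.simps)
  qed (simp add: assign_def)
  have "lin_eval (assign L \<nu>) (az # t) = a * assign L \<nu> z + lin_eval (assign L \<nu>) t" by (simp add: az)
  then show ?case using Cons *
    by (simp only: az list.map sum_list.Cons case_prod_conv distrib_left)
qed simp

text \<open>Scaling by a positive denominator preserves inequalities; a congruence is scaled
  together with its modulus, which is correct for modulus 0 too.\<close>

lemma batom_sat:
  assumes L: "length L = N * N" and a: "a \<in> set (batoms \<phi>)" and e: "1 \<le> L ! 0"
    and int: "\<And>z. z \<in> X \<Longrightarrow> L ! 0 dvd numer L \<nu> z"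
  shows "bpa_atom_sat \<nu> (map (nmof w) Q) L (tr a) = pa_atom_sat (assign L \<nu>) a"
proof -
  have "pa_atom_vars a \<subseteq> X \<union> Y" using a by auto
  then have t: "set (map snd (atom_lin a)) \<subseteq> X \<union> Y" by (simp only: pa_atom_vars_lin)
  have lc: "lincomb \<nu> L (map (nmof w) Q) (map (coef X (cpos w) N (atom_lin a)) Q) = L ! 0 * lin_eval (assign L \<nu>) (atom_lin a)
      + (\<Sum>(a, z)\<leftarrow>atom_lin a. if z \<in> X then a * L ! (cpos w z * N) else 0)"
    by (rule trans[OF lincomb_coef[OF L t] lin_scaled]) (rule int)
  show ?thesis
  proof (cases a)
    case (LinLe t b)
    have "L ! 0 * lin_eval (assign L \<nu>) t \<le> b * L ! 0 \<longleftrightarrow> lin_eval (assign L \<nu>) t \<le> b"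
      using e by (simp add: mult.commute[of b] del: lin_eval.simps)
    then show ?thesis using lc unfolding LinLe
      by (simp add: rhs_eval[OF L] del: lin_eval.simps epa_fv.simps)
  next
    case (LinCong t b m)
    have m: "mpoly_eval L [(m, [1])] = L ! 0 * m" using L N_pos by (simp add: mpoly_eval_simps unit_monomial0 del: One_nat_def)
    have "(L ! 0 * x + R) mod (L ! 0 * m) = (b * L ! 0 + R) mod (L ! 0 * m) \<longleftrightarrow> x mod m = b mod m" for x R
    proof -
      have "L ! 0 * x + R - (b * L ! 0 + R) = L ! 0 * (x - b)" by (simp add: algebra_simps)
      then show ?thesis using e by (simp only: mod_eq_dvd_iff) simp
    qed
    then show ?thesis using lc unfolding LinCong
      by (simp add: rhs_eval[OF L] m del: lin_eval.simps epa_fv.simps One_nat_def)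
  qed
qed

lemma integrality_sat:
  assumes L: "length L = N * N" and p: "p \<in> set B"
  shows "bpa_atom_sat \<nu> (map (nmof w) Q) L (integrality N Q p) \<longleftrightarrow> L ! 0 dvd numer L \<nu> (nmof w p)"
proof -
  have pN: "p < N" and cp: "cpos w (nmof w p) = p" using B_props[OF p] by auto
  have "lincomb \<nu> L (map (nmof w) Q) (map (\<lambda>q. [(1, pexp N p q)]) Q)
    = (\<Sum>y\<in>Y. mpoly_eval L [(1, pexp N p (cpos w y))] * \<nu> y)"
    unfolding lincomb_map by (rule sum_Q)
  also have "\<dots> = (\<Sum>y\<in>Y. L ! (p * N + cpos w y) * \<nu> y)"
    using L index_less[OF pN] cpos_free
    by (intro sum.cong) (auto simp: mpoly_eval_simps pexp_def unit_monomial simp del: One_nat_def)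
  finally have 1: "lincomb \<nu> L (map (nmof w) Q) (map (\<lambda>q. [(1, pexp N p q)]) Q)
    = (\<Sum>y\<in>Y. L ! (p * N + cpos w y) * \<nu> y)" .
  have 2: "mpoly_eval L [(1, pexp N p 0)] = L ! (p * N)" "mpoly_eval L [(1, [1])] = L ! 0"
    using L N_pos index_less[of p 0] pN
    by (auto simp: mpoly_eval_simps pexp_def unit_monomial unit_monomial0 simp del: One_nat_def)
  show ?thesis unfolding integrality_def bpa_atom_sat.simps 1 2 numer_def cp by (rule mod_eq_dvd_iff)
qed

lemma positivity_sat:
  assumes L: "length L = N * N"
  shows "bpa_atom_sat \<nu> (map (nmof w) Q) L (positivity Q) \<longleftrightarrow> 1 \<le> L ! 0"
proof -
  have "lincomb \<nu> L (map (nmof w) Q) (map (\<lambda>_. []) Q) = 0"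
    by (simp add: lincomb_map mpoly_eval_simps)
  moreover have "mpoly_eval L [(1, [1]), (-1, [])] = L ! 0 - 1"
    using L N_pos by (simp add: mpoly_eval_simps unit_monomial0 del: One_nat_def)
  ultimately show ?thesis by (auto simp: positivity_def)
qed

abbreviation "\<psi> \<equiv> bounded_form X (cpos w) N Q B (map (nmof w) Q) \<phi>"

lemma matrix_sat:
  assumes L: "length L = N * N"
  shows "beval (bpa_atom_sat \<nu> (map (nmof w) Q) L) (BAnd (BAtom (positivity Q))
      (foldr (\<lambda>p. BAnd (BAtom (integrality N Q p))) B (map_bform tr \<phi>)))
    \<longleftrightarrow> 1 \<le> L ! 0 \<and> (\<forall>z\<in>X. L ! 0 dvd numer L \<nu> z) \<and> beval (pa_atom_sat (assign L \<nu>)) \<phi>"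
proof -
  have fold: "beval I (foldr (\<lambda>p. BAnd (BAtom (f p))) ps \<theta>) \<longleftrightarrow> (\<forall>p\<in>set ps. I (f p)) \<and> beval I \<theta>" for I f and ps :: "nat list" and \<theta>
    by (induction ps) auto
  have int: "(\<forall>p\<in>set B. bpa_atom_sat \<nu> (map (nmof w) Q) L (integrality N Q p)) \<longleftrightarrow> (\<forall>z\<in>X. L ! 0 dvd numer L \<nu> z)"
    using integrality_sat[OF L] unfolding names_B[symmetric] by blast
  \<comment> \<open>Translated atoms have the intended meaning only under positivity and
    integrality; where these fail, the whole conjunction is false anyway.\<close>
  have "beval (bpa_atom_sat \<nu> (map (nmof w) Q) L) (map_bform tr \<phi>) = beval (pa_atom_sat (assign L \<nu>)) \<phi>"
    if "1 \<le> L ! 0" "\<forall>z\<in>X. L ! 0 dvd numer L \<nu> z"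
    unfolding beval_map by (rule beval_cong) (use batom_sat[OF L] that in blast)
  then show ?thesis unfolding beval.simps fold int positivity_sat[OF L] by blast
qed

lemma bounded_form_sat: "bpa_sat \<nu> \<psi> = epa_sat \<nu> (EPA xs \<phi>)"
proof
  assume "bpa_sat \<nu> \<psi>"
  then obtain L where L: "length L = N * N" "beval (bpa_atom_sat \<nu> (map (nmof w) Q) L) (BAnd (BAtom (positivity Q))
      (foldr (\<lambda>p. BAnd (BAtom (integrality N Q p))) B (map_bform tr \<phi>)))"
    unfolding bounded_form_def bpa_sat.simps length_replicate by blast
  have "beval (pa_atom_sat (assign L \<nu>)) \<phi>" using L(2) unfolding matrix_sat[OF L(1)] by blast
  then show "epa_sat \<nu> (EPA xs \<phi>)"
    unfolding epa_sat.simps exists_prefix_iff by (intro exI[of _ "assign L \<nu>"]) (simp add: assign_def)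
next
  assume "epa_sat \<nu> (EPA xs \<phi>)"
  then obtain \<mu> where \<mu>: "\<And>z. z \<notin> X \<Longrightarrow> \<mu> z = \<nu> z" "beval (pa_atom_sat \<mu>) \<phi>"
    unfolding epa_sat.simps exists_prefix_iff by blast
  let ?K = "2 ^ (N ^ 6) - 1 :: int"
  have XY: "X \<inter> Y = {}" "\<And>a. a \<in> set (batoms \<phi>) \<Longrightarrow> pa_atom_vars a \<subseteq> X \<union> Y" by auto
  have Nw: "N = length (enc_epa (EPA xs \<phi>))" by (simp add: w)
  show "bpa_sat \<nu> \<psi>"
  proof (rule small_model_encoded[OF Nw finite_Y XY refl, of \<mu>])
    fix e :: int and P r
    assume *: "1 \<le> e" "e \<le> ?K" "\<And>z y. \<bar>P z y\<bar> \<le> ?K" "\<And>z. \<bar>r z\<bar> \<le> ?K"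
      "\<And>z. z \<in> X \<Longrightarrow> e dvd (\<Sum>y\<in>Y. P z y * \<mu> y) - r z"
      "beval (pa_atom_sat (\<lambda>z. if z \<in> X then ((\<Sum>y\<in>Y. P z y * \<mu> y) - r z) div e else \<mu> z)) \<phi>
        = beval (pa_atom_sat \<mu>) \<phi>"
    \<comment> \<open>Indices are decoded by division by \<open>N\<close>: remainder 0 means an
      offset, any other remainder a coefficient. Indices that belong to no names receive values as
      well, which is why \<open>P\<close> and \<open>r\<close> are bounded for all
      arguments.\<close>
    define L where "L = map (\<lambda>i. if i = 0 then e else if i mod N = 0 then r (nmof w (i div N))
      else P (nmof w (i div N)) (nmof w (i mod N))) [0..<N * N]"
    have len: "length L = N * N" by (simp add: L_def)
    have L0: "L ! 0 = e" using N_pos by (simp add: L_def)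
    have N0: "N \<noteq> 0" using N_pos by auto
    have Lr: "L ! (cpos w z * N) = r z" if "z \<in> X" for z
    proof -
      have "cpos w z * N < N * N" using cpos_bound[OF that] N0 by simp
      then show ?thesis using cpos_bound[OF that] N0 unfolding L_def by simp
    qed
    have LP: "L ! (cpos w z * N + cpos w y) = P z y" if "z \<in> X" "y \<in> Y" for z y
    proof -
      note cz = cpos_bound[OF that(1)] and cy = cpos_free[OF that(2)]
      have "(cpos w z * N + cpos w y) div N = cpos w z" "(cpos w z * N + cpos w y) mod N = cpos w y"
        using cy N0 by (simp_all del: length_0_conv)
      then show ?thesis using cz cy index_less[of "cpos w z" "cpos w y"] by (simp add: L_def)
    qed
    have nu: "\<nu> y = \<mu> y" if "y \<in> Y" for y using \<mu>(1)[of y] that by auto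
    have num: "numer L \<nu> z = (\<Sum>y\<in>Y. P z y * \<mu> y) - r z" if "z \<in> X" for z
      unfolding numer_def Lr[OF that] using LP[OF that] nu by (simp del: epa_fv.simps)
    have "assign L \<nu> = (\<lambda>z. if z \<in> X then ((\<Sum>y\<in>Y. P z y * \<mu> y) - r z) div e else \<mu> z)"
      using num \<mu>(1) L0 by (auto simp: assign_def fun_eq_iff simp del: epa_fv.simps)
    then have sat: "beval (bpa_atom_sat \<nu> (map (nmof w) Q) L) (BAnd (BAtom (positivity Q))
      (foldr (\<lambda>p. BAnd (BAtom (integrality N Q p))) B (map_bform tr \<phi>)))"
      unfolding matrix_sat[OF len] using *(1,5,6) \<mu>(2) num L0 by (simp del: epa_fv.simps)
    have bound: "\<bar>L ! i\<bar> \<le> int (replicate (N * N) (2 ^ N ^ 6 - 1) ! i)" if "i < N * N" for i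
    proof -
      have "\<bar>L ! i\<bar> \<le> ?K" using *(1-4) that by (auto simp: L_def)
      then show ?thesis using that by (simp add: of_nat_diff)
    qed
    show "bpa_sat \<nu> \<psi>"
      unfolding bounded_form_def bpa_sat.simps length_replicate using len bound sat by (intro exI[of _ L]) blast
  qed
qed

lemma bounded_form_fv: "bpa_fv \<psi> = Y"
  unfolding bounded_form_def bpa_fv.simps set_map names_Q ..

lemma pexp_length: "p < N \<Longrightarrow> q < N \<Longrightarrow> length (pexp N p q) \<le> N * N"
  using index_less[of p q] by (simp add: pexp_def)

lemma bounded_form_wf: "bpa_wf \<psi>"
proof -
  have exp1: "Suc 0 \<le> N * N" using N_pos by linarith
  have Qlt: "q < N" if "q \<in> set Q" for q using that by simp
  define good where "good a \<longleftrightarrow> bpa_atom_arity a = length Q \<and>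
    (\<forall>p\<in>set (bpa_atom_polys a). \<forall>(c, es)\<in>set p. length es \<le> N * N)" for a
  have 1: "good (positivity Q)" using exp1 by (auto simp: good_def positivity_def)
  have 2: "good (integrality N Q p)" if "p \<in> set B" for p
  proof -
    have "0 < N" using exp1 by (cases "N = 0") simp_all
    then have "length (pexp N p q) \<le> N * N" if "q \<in> set Q \<or> q = 0" for q
      using that Qlt pexp_length[OF B_props(4)[OF \<open>p \<in> set B\<close>]] by blast
    then show ?thesis unfolding good_def integrality_def using exp1 by simp
  qed
  have 3: "good (tr a)" if a: "a \<in> set (batoms \<phi>)" for a
  proof -
    have c: "length es \<le> N * N" if ces: "(c, es) \<in> set (coef X (cpos w) N t q)" and q: "q < N" for c es t q
    proof -
      obtain az where "(c, es) \<in> set (bmono X (cpos w) N q az)" using ces by (auto simp: coef_def)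
      then have "snd az \<in> X \<and> es = pexp N (cpos w (snd az)) q \<or> es = [1]" by (simp add: bmono_def split: if_splits)
      then show ?thesis using cpos_bound[of "snd az"] pexp_length[OF _ q, of "cpos w (snd az)"] exp1 by auto
    qed
    have r: "length es \<le> N * N" if ces: "(c, es) \<in> set (rhs X (cpos w) N t b)" for c es t b
    proof (cases "es = [1]")
      case False
      obtain az where "(c, es) \<in> set (rmono X (cpos w) N az)" using ces False by (auto simp: rhs_def)
      then have "snd az \<in> X \<and> es = pexp N (cpos w (snd az)) 0" by (simp add: rmono_def split: if_splits)
      moreover have "0 < N" using exp1 by (cases "N = 0") simp_all
      ultimately show ?thesis using cpos_bound[of "snd az"] pexp_length[of "cpos w (snd az)" 0] by simp
    qed (use exp1 in simp)
    have polys: "(\<exists>t b. p = rhs X (cpos w) N t b) \<or> (\<exists>t q. q < N \<and> p = coef X (cpos w) N t q) \<or> (\<exists>m. p = [(m, [1])])"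
      if "p \<in> set (bpa_atom_polys (tr a))" for p
      using that by (cases a) auto
    have "length es \<le> N * N" if "p \<in> set (bpa_atom_polys (tr a))" "(d, es) \<in> set p" for p d es
      using polys[OF that(1)]
    proof (elim disjE exE conjE)
      fix t b assume "p = rhs X (cpos w) N t b"
      then show ?thesis using that(2) by (intro r) simp
    next
      fix t q assume "q < N" "p = coef X (cpos w) N t q"
      then show ?thesis using that(2) by (intro c[of _ _ t q]) simp_all
    next
      fix m assume "p = [(m, [1])]"
      then show ?thesis using that(2) exp1 by simp
    qed
    then have "\<forall>p\<in>set (bpa_atom_polys (tr a)). \<forall>(c, es)\<in>set p. length es \<le> N * N" by blast
    moreover have "bpa_atom_arity (tr a) = length Q" by (cases a) simp_all
    ultimately show ?thesis unfolding good_def by (rule conjI[rotated])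
  qed
  have "good a" if "a \<in> set (batoms (foldr (\<lambda>p. BAnd (BAtom (integrality N Q p))) ps (map_bform tr \<phi>)))" "set ps \<subseteq> set B" for a ps
    using that
  proof (induction ps)
    case Nil
    then show ?case using 3 by (auto simp: batoms_map)
  next
    case (Cons p ps)
    then have "a = integrality N Q p \<or> a \<in> set (batoms (foldr (\<lambda>p. BAnd (BAtom (integrality N Q p))) ps (map_bform tr \<phi>)))"
      by simp
    then show ?case using Cons.IH Cons.prems(2) 2[of p] by (auto simp del: set_filter)
  qed
  then have "\<forall>a\<in>set (batoms (BAnd (BAtom (positivity Q))
      (foldr (\<lambda>p. BAnd (BAtom (integrality N Q p))) B (map_bform tr \<phi>)))). good a" using 1 by auto
  then show ?thesis unfolding bounded_form_def bpa_wf.simps length_replicate good_def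
    using distinct_names_Q by simp
qed

lemma write_bpa_correct:
  "\<exists>\<theta>. write_bpa w = enc_bpa \<theta> \<and> bpa_wf \<theta> \<and> bpa_fv \<theta> = epa_fv (EPA xs \<phi>)
    \<and> (\<forall>\<nu>. bpa_sat \<nu> \<theta> = epa_sat \<nu> (EPA xs \<phi>))"
proof (rule exI[of _ \<psi>], intro conjI allI)
  show "write_bpa w = enc_bpa \<psi>" by (rule write_bpa_eq)
  show "bpa_wf \<psi>" by (rule bounded_form_wf)
  show "bpa_fv \<psi> = Y" by (rule bounded_form_fv)
  show "bpa_sat \<nu> \<psi> = epa_sat \<nu> (EPA xs \<phi>)" for \<nu> by (rule bounded_form_sat)
qed

end

theorem theorem3p1:
  shows "\<exists>M::tm. \<exists>c k::nat. tm_wf M \<and>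
    (\<forall>\<phi>::epa. \<exists>t \<psi>. t \<le> c * (length (enc_epa \<phi>) + 1) ^ k
        \<and> tm_halts_with M (enc_epa \<phi>) t (enc_bpa \<psi>)
        \<and> bpa_wf \<psi>
        \<and> bpa_fv \<psi> = epa_fv \<phi>
        \<and> (\<forall>\<nu>. bpa_sat \<nu> \<psi> = epa_sat \<nu> \<phi>))"
proof -
  have gen: "\<exists>M c k. tm_wf M \<and> (\<forall>w. w \<noteq> [] \<longrightarrow> (\<exists>t \<le> c * (length w + 1) ^ k. tm_halts_with M w t (write_bpa w)))"
    by (rule tm_of_gn[OF gn_write_bpa])
  show ?thesis
    using gen
  proof (elim exE conjE)
    fix M c k
    assume M: "tm_wf M" "\<forall>w. w \<noteq> [] \<longrightarrow> (\<exists>t \<le> c * (length w + 1) ^ k. tm_halts_with M w t (write_bpa w))"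
    have "\<exists>t \<psi>. t \<le> c * (length (enc_epa \<phi>) + 1) ^ k \<and> tm_halts_with M (enc_epa \<phi>) t (enc_bpa \<psi>)
      \<and> bpa_wf \<psi> \<and> bpa_fv \<psi> = epa_fv \<phi> \<and> (\<forall>\<nu>. bpa_sat \<nu> \<psi> = epa_sat \<nu> \<phi>)" for \<phi>
    proof -
      obtain xs \<theta> where \<phi>: "EPA xs \<theta> = \<phi>" by (cases \<phi>) auto
      interpret encoded_input xs \<theta> "enc_epa \<phi>" by unfold_locales (simp only: \<phi>)
      \<comment> \<open>The generators are specified on nonempty words only.\<close>
      have "enc_epa \<phi> \<noteq> []" using N_pos by auto
      then obtain t where t: "t \<le> c * (length (enc_epa \<phi>) + 1) ^ k" "tm_halts_with M (enc_epa \<phi>) t (write_bpa (enc_epa \<phi>))"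
        using M(2) by blast
      from write_bpa_correct[unfolded \<phi>] show ?thesis
      proof (elim exE conjE)
        fix \<psi> assume \<psi>: "write_bpa (enc_epa \<phi>) = enc_bpa \<psi>" "bpa_wf \<psi>" "bpa_fv \<psi> = epa_fv \<phi>"
          "\<forall>\<nu>. bpa_sat \<nu> \<psi> = epa_sat \<nu> \<phi>"
        show ?thesis
          by (rule exI[of _ t], rule exI[of _ \<psi>]) (intro conjI t(1) t(2)[unfolded \<psi>(1)] \<psi>(2-4))
      qed
    qed
    note all = this
    show ?thesis
      by (rule exI[of _ M], rule exI[of _ c], rule exI[of _ k], rule conjI, rule M(1), rule allI, rule all)
  qed
qed

end
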